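(* Let $\sigma\subset N_{\mathbb Q}$ be a strongly convex rational polyhedral cone. The constructions $\mathcal L:\operatorname{Mod}^M_{S_\sigma}\to\operatorname{Vect}_\sigma$, $R\mapsto(E_R,\mathfrak v_R)$, and $\mathcal R:\operatorname{Vect}_\sigma\to\operatorname{Mod}^M_{S_\sigma}$, $(E,\mathfrak v)\mapsto\bigoplus_{m\in M}F_m(\mathfrak v)$, define an adjoint pair of functors ($\mathcal L$ is left adjoint to $\mathcal R$).
   Context: $\mathbf k$ is an algebraically closed field, $N$ a lattice, $M=\operatorname{Hom}(N,\mathbb Z)$. $\sigma^\vee=\{u\in M_{\mathbb Q}:\langle\rho,u\rangle\le0\ \forall\rho\in\sigma\}$ (negative of the usual convention), $S_\sigma=\mathbf k[\sigma^\vee\cap M]$ with monomials $\chi_u$. $\operatorname{Mod}^M_{S_\sigma}$ is the category of $M$-graded $S_\sigma$-modules with degree-preserving maps. $\hat{\mathcal O}_\sigma$ is the semialgebra (pointwise $\min$, $+$) of functions $\psi:\sigma\to\mathbb Q\cup\{\infty\}$ with $\psi(\ell\rho)=\ell\psi(\rho)$ for all $\ell\in\mathbb Q_{\ge0}$, $\rho\in\sigma$ (for $\ell=0$ imposed only when $\psi(\rho)\neq\infty$). Functions are compared pointwise; elements of $M$ are regarded as linear functions on $\sigma$. A prevaluation on a $\mathbf k$-vector space $E$ is a map $\mathfrak v:E\to\hat{\mathcal O}_\sigma$ with $\mathfrak v(f+g)\ge\min\{\mathfrak v(f),\mathfrak v(g)\}$, $\mathfrak v(cf)=\mathfrak v(f)$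 for $c\in\mathbf k\setminus\{0\}$, and $\mathfrak v(0)=\infty$. $\operatorname{Vect}_\sigma$ is the category of pairs $(E,\mathfrak v)$; a morphism $(E,\mathfrak v)\to(D,\mathfrak w)$ is a $\mathbf k$-linear map $\phi:E\to D$ with $\mathfrak v(f)\le\mathfrak w(\phi(f))$ for all $f\in E$. Functor $\mathcal L$: for $R=\bigoplus_mR_m$, let $\mathfrak m\subset S_\sigma$ be the ideal generated by $\chi_u-1$, $u\in\sigma^\vee\cap M$, let $E_R=R/\mathfrak mR$, and let $F_m(R)\subset E_R$ be the image of $R_m$. For $\rho\in\sigma\cap N$, $r\in\mathbb Q$, let $G^\rho_r(R)=\sum_{\langle\rho,m\rangle\ge r}F_m(R)$ and $\mathfrak v_R(f)(\rho)=\max\{r:f\in G^\rho_r(R)\}$ (equal to $\infty$ if the maximum is not attained), extended to $\sigma$ by homogeneity. On morphisms $\mathcal L$ is the induced map on quotients. Functor $\mathcal R$: for $(E,\mathfrak v)$ and $m\in M$, $F_m(\mathfrak v)=\{f\in E:\mathfrak v(f)\ge m\}$; $\chi_u$ acts on $\bigoplus_mF_m(\mathfrak v)$ by the inclusions $F_m(\mathfrak v)\subset F_{m+u}(\mathfrak v)$. On morphisms $\mathcal R$ is restriction to the $F_m$. *)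

theory Defs
  imports
    "HOL-Algebra.Algebraic_Closure_Type"
    "HOL-Library.Function_Algebras"
    "HOL-Library.Poly_Mapping"
    "HOL-Library.Extended"
begin

section \<open>Categories and functors\<close>

record ('o, 'f) category =
  Obj :: "'o set"
  Hom :: "'o \<Rightarrow> 'o \<Rightarrow> 'f set"
  Ident :: "'o \<Rightarrow> 'f"
  Comp :: "'o \<Rightarrow> 'o \<Rightarrow> 'o \<Rightarrow> 'f \<Rightarrow> 'f \<Rightarrow> 'f"
    \<comment> \<open>\<open>Comp C a b c g f\<close> is the composite of \<open>f : a \<rightarrow> b\<close> followed by \<open>g : b \<rightarrow> c\<close>\<close>

definition is_category :: "('o, 'f) category \<Rightarrow> bool" where
  "is_category C \<longleftrightarrow>
     (\<forall>a\<in>Obj C. Ident C a \<in> Hom C a a) \<and>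
     (\<forall>a\<in>Obj C. \<forall>b\<in>Obj C. \<forall>c\<in>Obj C. \<forall>f\<in>Hom C a b. \<forall>g\<in>Hom C b c.
        Comp C a b c g f \<in> Hom C a c) \<and>
     (\<forall>a\<in>Obj C. \<forall>b\<in>Obj C. \<forall>f\<in>Hom C a b.
        Comp C a a b f (Ident C a) = f \<and> Comp C a b b (Ident C b) f = f) \<and>
     (\<forall>z\<in>Obj C. \<forall>a\<in>Obj C. \<forall>b\<in>Obj C. \<forall>c\<in>Obj C.
        \<forall>f\<in>Hom C z a. \<forall>g\<in>Hom C a b. \<forall>h\<in>Hom C b c.
        Comp C z a c (Comp C a b c h g) f = Comp C z b c h (Comp C z a b g f))"

definition is_functor ::
  "('o, 'f) category \<Rightarrow> ('p, 'g) category \<Rightarrow> ('o \<Rightarrow> 'p) \<Rightarrow> ('o \<Rightarrow> 'o \<Rightarrow> 'f \<Rightarrow> 'g) \<Rightarrow> bool" where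
  "is_functor C D F Fmap \<longleftrightarrow>
     is_category C \<and> is_category D \<and>
     (\<forall>a\<in>Obj C. F a \<in> Obj D) \<and>
     (\<forall>a\<in>Obj C. \<forall>b\<in>Obj C. \<forall>f\<in>Hom C a b. Fmap a b f \<in> Hom D (F a) (F b)) \<and>
     (\<forall>a\<in>Obj C. Fmap a a (Ident C a) = Ident D (F a)) \<and>
     (\<forall>a\<in>Obj C. \<forall>b\<in>Obj C. \<forall>c\<in>Obj C. \<forall>f\<in>Hom C a b. \<forall>g\<in>Hom C b c.
        Fmap a c (Comp C a b c g f) = Comp D (F a) (F b) (F c) (Fmap b c g) (Fmap a b f))"


section \<open>Lattices and cones\<close>

text \<open>
  The type \<open>'v\<close> with scalar multiplication \<open>s\<close> is the rational vector space
  \<open>N \<otimes> \<rat>\<close>, and \<open>N\<close> is a lattice of full rank in it (rank 0 is allowed).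
\<close>

definition is_lattice :: "(rat \<Rightarrow> 'v \<Rightarrow> 'v) \<Rightarrow> ('v::ab_group_add) set \<Rightarrow> bool" where
  "is_lattice s N \<longleftrightarrow> vector_space s \<and>
     (\<exists>B. finite B \<and> \<not> module.dependent s B \<and> module.span s B = UNIV \<and>
          N = {\<Sum>b\<in>B. s (of_int (c b)) b | c. c \<in> (UNIV :: ('v \<Rightarrow> int) set)})"

text \<open>
  \<open>M = Hom(N, \<int>)\<close>, where a homomorphism \<open>N \<rightarrow> \<int>\<close> is represented by its unique linear
  extension to \<open>N \<otimes> \<rat>\<close>. Thus the pairing of \<open>\<rho>\<close> and \<open>u\<close> is the application \<open>u \<rho>\<close>.
\<close>

definition dual_lattice :: "(rat \<Rightarrow> 'v \<Rightarrow> 'v) \<Rightarrow> ('v::ab_group_add) set \<Rightarrow> ('v \<Rightarrow> rat) set" where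
  "dual_lattice s N = {u. Vector_Spaces.linear s (*) u \<and> u ` N \<subseteq> \<int>}"

definition rational_polyhedral_cone ::
  "(rat \<Rightarrow> 'v \<Rightarrow> 'v) \<Rightarrow> ('v::ab_group_add) set \<Rightarrow> 'v set \<Rightarrow> bool" where
  "rational_polyhedral_cone s N \<sigma> \<longleftrightarrow>
     (\<exists>G. finite G \<and> G \<subseteq> N \<and> \<sigma> = {\<Sum>g\<in>G. s (c g) g | c. \<forall>g\<in>G. 0 \<le> c g})"

definition strongly_convex :: "('v::ab_group_add) set \<Rightarrow> bool" where
  "strongly_convex \<sigma> \<longleftrightarrow> \<sigma> \<inter> uminus ` \<sigma> = {0}"

text \<open>The sign is the negative of the usual convention.\<close>

definition dual_cone ::
  "(rat \<Rightarrow> 'v \<Rightarrow> 'v) \<Rightarrow> ('v::ab_group_add) set \<Rightarrow> ('v \<Rightarrow> rat) set" where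
  "dual_cone s \<sigma> = {u. Vector_Spaces.linear s (*) u \<and> (\<forall>\<rho>\<in>\<sigma>. u \<rho> \<le> 0)}"


section \<open>Graded modules over the semigroup algebra\<close>

text \<open>
  The type \<open>'m \<Rightarrow>\<^sub>0 'k\<close> carries the convolution product, so the semigroup algebra
  \<open>k[\<sigma>\<^sup>\<or> \<inter> M]\<close> is the subring of elements supported in \<open>\<sigma>\<^sup>\<or> \<inter> M\<close>.
\<close>

definition cone_algebra ::
  "(rat \<Rightarrow> 'v \<Rightarrow> 'v) \<Rightarrow> ('v::ab_group_add) set \<Rightarrow> 'v set \<Rightarrow> (('v \<Rightarrow> rat) \<Rightarrow>\<^sub>0 'k::field) ring" where
  "cone_algebra s N \<sigma> =
     ring_of_type_algebra
       \<lparr>carrier := {p. Poly_Mapping.keys p \<subseteq> dual_cone s \<sigma> \<inter> dual_lattice s N}\<rparr>"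

abbreviation chi :: "('v \<Rightarrow> rat) \<Rightarrow> ('v \<Rightarrow> rat) \<Rightarrow>\<^sub>0 'k::field" where
  "chi u \<equiv> Poly_Mapping.single u 1"

record ('r, 'i, 'a) graded_module = "('r, 'a) module" +
  grade :: "'i \<Rightarrow> 'a set"

type_synonym ('k, 'v, 'a) cone_module =
  "(('v \<Rightarrow> rat) \<Rightarrow>\<^sub>0 'k, 'v \<Rightarrow> rat, 'a) graded_module"

definition is_graded_module ::
  "(rat \<Rightarrow> 'v \<Rightarrow> 'v) \<Rightarrow> ('v::ab_group_add) set \<Rightarrow> 'v set \<Rightarrow> ('k::field, 'v, 'a) cone_module \<Rightarrow> bool"
where
  "is_graded_module s N \<sigma> R \<longleftrightarrow>
     module (cone_algebra s N \<sigma>) R \<and>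
     (\<forall>m\<in>dual_lattice s N. subgroup (grade R m) (add_monoid R)) \<and>
     (\<forall>x\<in>carrier R. \<exists>!c. c \<in> (\<Pi>\<^sub>E m\<in>dual_lattice s N. grade R m) \<and>
        finite {m\<in>dual_lattice s N. c m \<noteq> \<zero>\<^bsub>R\<^esub>} \<and>
        x = (\<Oplus>\<^bsub>R\<^esub>m\<in>{m\<in>dual_lattice s N. c m \<noteq> \<zero>\<^bsub>R\<^esub>}. c m)) \<and>
     (\<forall>u\<in>dual_cone s \<sigma> \<inter> dual_lattice s N. \<forall>a. \<forall>m\<in>dual_lattice s N. \<forall>x\<in>grade R m.
        Poly_Mapping.single u a \<odot>\<^bsub>R\<^esub> x \<in> grade R (u + m))"

definition linear_maps ::
  "('r, 'p) ring_scheme \<Rightarrow> ('r, 'a, 'q) module_scheme \<Rightarrow> ('r, 'b, 't) module_scheme \<Rightarrow> ('a \<Rightarrow> 'b) set"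
where
  "linear_maps A V W = {f \<in> carrier V \<rightarrow>\<^sub>E carrier W.
     (\<forall>x\<in>carrier V. \<forall>y\<in>carrier V. f (x \<oplus>\<^bsub>V\<^esub> y) = f x \<oplus>\<^bsub>W\<^esub> f y) \<and>
     (\<forall>a\<in>carrier A. \<forall>x\<in>carrier V. f (a \<odot>\<^bsub>V\<^esub> x) = a \<odot>\<^bsub>W\<^esub> f x)}"

definition graded_maps ::
  "(rat \<Rightarrow> 'v \<Rightarrow> 'v) \<Rightarrow> ('v::ab_group_add) set \<Rightarrow> 'v set \<Rightarrow>
   ('k::field, 'v, 'a) cone_module \<Rightarrow> ('k, 'v, 'b) cone_module \<Rightarrow> ('a \<Rightarrow> 'b) set" where
  "graded_maps s N \<sigma> R R' = {f \<in> linear_maps (cone_algebra s N \<sigma>) R R'.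
     \<forall>m\<in>dual_lattice s N. f ` grade R m \<subseteq> grade R' m}"

text \<open>
  The set \<open>graded_maps\<close> is defined for modules on different carrier types;
  the category below consists of the modules on one fixed carrier type.
  The same holds for \<open>prevalued_maps\<close> and \<open>Vect_cat\<close>.
\<close>

definition Mod_cat ::
  "(rat \<Rightarrow> 'v \<Rightarrow> 'v) \<Rightarrow> ('v::ab_group_add) set \<Rightarrow> 'v set \<Rightarrow>
   (('k::field, 'v, 'a) cone_module, 'a \<Rightarrow> 'a) category" where
  "Mod_cat s N \<sigma> =
     \<lparr>Obj = Collect (is_graded_module s N \<sigma>),
      Hom = graded_maps s N \<sigma>,
      Ident = (\<lambda>R. \<lambda>x\<in>carrier R. x),
      Comp = (\<lambda>R R' R'' g f. compose (carrier R) g f)\<rparr>"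


section \<open>Prevalued vector spaces\<close>

text \<open>
  Values lie in \<open>\<rat> \<union> {\<infinity>}\<close>, that is, in \<open>rat extended\<close> without \<open>Minf\<close>.
  The function \<open>map_extended ((*) l)\<close> is multiplication by \<open>l\<close> fixing \<open>\<infinity>\<close>, so it is the
  right multiplication only for \<open>l > 0\<close> or finite arguments.
\<close>

definition pl_functions ::
  "(rat \<Rightarrow> 'v \<Rightarrow> 'v) \<Rightarrow> 'v set \<Rightarrow> ('v \<Rightarrow> rat extended) set" where
  "pl_functions s \<sigma> = {\<psi> \<in> \<sigma> \<rightarrow>\<^sub>E UNIV - {Minf}.
     \<forall>\<rho>\<in>\<sigma>. \<forall>l\<ge>0. (l = 0 \<longrightarrow> \<psi> \<rho> \<noteq> Pinf) \<longrightarrow> \<psi> (s l \<rho>) = map_extended ((*) l) (\<psi> \<rho>)}"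

record ('k, 'v, 'e) prevalued_space = "('k, 'e) module" +
  val :: "'e \<Rightarrow> 'v \<Rightarrow> rat extended"

definition is_prevaluation ::
  "(rat \<Rightarrow> 'v \<Rightarrow> 'v) \<Rightarrow> 'v set \<Rightarrow> ('k::field, 'e, 'q) module_scheme \<Rightarrow>
   ('e \<Rightarrow> 'v \<Rightarrow> rat extended) \<Rightarrow> bool" where
  "is_prevaluation s \<sigma> E v \<longleftrightarrow>
     v \<in> carrier E \<rightarrow> pl_functions s \<sigma> \<and>
     (\<forall>f\<in>carrier E. \<forall>g\<in>carrier E. \<forall>\<rho>\<in>\<sigma>. v (f \<oplus>\<^bsub>E\<^esub> g) \<rho> \<ge> min (v f \<rho>) (v g \<rho>)) \<and>
     (\<forall>c. c \<noteq> 0 \<longrightarrow> (\<forall>f\<in>carrier E. v (c \<odot>\<^bsub>E\<^esub> f) = v f)) \<and>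
     v \<zero>\<^bsub>E\<^esub> = (\<lambda>\<rho>\<in>\<sigma>. Pinf)"

definition is_prevalued_space ::
  "(rat \<Rightarrow> 'v \<Rightarrow> 'v) \<Rightarrow> 'v set \<Rightarrow> ('k::field, 'v, 'e) prevalued_space \<Rightarrow> bool" where
  "is_prevalued_space s \<sigma> E \<longleftrightarrow>
     module (ring_of_type_algebra :: 'k ring) E \<and> is_prevaluation s \<sigma> E (val E)"

definition prevalued_maps ::
  "'v set \<Rightarrow> ('k::field, 'v, 'e) prevalued_space \<Rightarrow> ('k, 'v, 'd) prevalued_space \<Rightarrow> ('e \<Rightarrow> 'd) set"
where
  "prevalued_maps \<sigma> E D = {\<phi> \<in> linear_maps (ring_of_type_algebra :: 'k ring) E D.
     \<forall>f\<in>carrier E. \<forall>\<rho>\<in>\<sigma>. val E f \<rho> \<le> val D (\<phi> f) \<rho>}"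

definition Vect_cat ::
  "(rat \<Rightarrow> 'v \<Rightarrow> 'v) \<Rightarrow> 'v set \<Rightarrow> (('k::field, 'v, 'e) prevalued_space, 'e \<Rightarrow> 'e) category" where
  "Vect_cat s \<sigma> =
     \<lparr>Obj = Collect (is_prevalued_space s \<sigma>),
      Hom = prevalued_maps \<sigma>,
      Ident = (\<lambda>E. \<lambda>f\<in>carrier E. f),
      Comp = (\<lambda>E D C g f. compose (carrier E) g f)\<rparr>"


section \<open>The functor from graded modules to prevalued spaces\<close>

definition torus_unit_ideal ::
  "(rat \<Rightarrow> 'v \<Rightarrow> 'v) \<Rightarrow> ('v::ab_group_add) set \<Rightarrow> 'v set \<Rightarrow> (('v \<Rightarrow> rat) \<Rightarrow>\<^sub>0 'k::field) set" where
  "torus_unit_ideal s N \<sigma> =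
     Idl\<^bsub>cone_algebra s N \<sigma>\<^esub> {chi u - 1 | u. u \<in> dual_cone s \<sigma> \<inter> dual_lattice s N}"

definition ideal_submodule ::
  "('r, 'p) ring_scheme \<Rightarrow> 'r set \<Rightarrow> ('r, 'a, 'q) module_scheme \<Rightarrow> 'a set" where
  "ideal_submodule A I R =
     \<Inter>{H. submodule H A R \<and> (\<forall>a\<in>I. \<forall>x\<in>carrier R. a \<odot>\<^bsub>R\<^esub> x \<in> H)}"

definition mR ::
  "(rat \<Rightarrow> 'v \<Rightarrow> 'v) \<Rightarrow> ('v::ab_group_add) set \<Rightarrow> 'v set \<Rightarrow> ('k::field, 'v, 'a) cone_module \<Rightarrow> 'a set"
where
  "mR s N \<sigma> R = ideal_submodule (cone_algebra s N \<sigma>) (torus_unit_ideal s N \<sigma>) R"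

text \<open>The quotient \<open>R / mR\<close> by cosets; the ring multiplication fields of the record are unused.\<close>

definition E_space ::
  "(rat \<Rightarrow> 'v \<Rightarrow> 'v) \<Rightarrow> ('v::ab_group_add) set \<Rightarrow> 'v set \<Rightarrow> ('k::field, 'v, 'a) cone_module \<Rightarrow>
   ('k, 'a set) module" where
  "E_space s N \<sigma> R =
     \<lparr>carrier = a_rcosets\<^bsub>R\<^esub> (mR s N \<sigma> R),
      monoid.mult = undefined,
      one = undefined,
      ring.zero = mR s N \<sigma> R,
      add = (<+>\<^bsub>R\<^esub>),
      module.smult = (\<lambda>c U. \<Union>x\<in>U. mR s N \<sigma> R +>\<^bsub>R\<^esub> (Poly_Mapping.single 0 c \<odot>\<^bsub>R\<^esub> x))\<rparr>"

definition F_piece ::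
  "(rat \<Rightarrow> 'v \<Rightarrow> 'v) \<Rightarrow> ('v::ab_group_add) set \<Rightarrow> 'v set \<Rightarrow> ('k::field, 'v, 'a) cone_module \<Rightarrow>
   ('v \<Rightarrow> rat) \<Rightarrow> 'a set set" where
  "F_piece s N \<sigma> R m = (\<lambda>x. mR s N \<sigma> R +>\<^bsub>R\<^esub> x) ` grade R m"

definition G_filtration ::
  "(rat \<Rightarrow> 'v \<Rightarrow> 'v) \<Rightarrow> ('v::ab_group_add) set \<Rightarrow> 'v set \<Rightarrow> ('k::field, 'v, 'a) cone_module \<Rightarrow>
   'v \<Rightarrow> rat \<Rightarrow> 'a set set" where
  "G_filtration s N \<sigma> R \<rho> r =
     {\<Oplus>\<^bsub>E_space s N \<sigma> R\<^esub>m\<in>J. c m | J c.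
        finite J \<and> J \<subseteq> {m \<in> dual_lattice s N. m \<rho> \<ge> r} \<and> (\<forall>m\<in>J. c m \<in> F_piece s N \<sigma> R m)}"

definition lattice_val ::
  "(rat \<Rightarrow> 'v \<Rightarrow> 'v) \<Rightarrow> ('v::ab_group_add) set \<Rightarrow> 'v set \<Rightarrow> ('k::field, 'v, 'a) cone_module \<Rightarrow>
   'a set \<Rightarrow> 'v \<Rightarrow> rat extended" where
  "lattice_val s N \<sigma> R f \<rho> =
     (if \<exists>r. f \<in> G_filtration s N \<sigma> R \<rho> r \<and> (\<forall>t. f \<in> G_filtration s N \<sigma> R \<rho> t \<longrightarrow> t \<le> r)
      then Fin (GREATEST r. f \<in> G_filtration s N \<sigma> R \<rho> r)
      else Pinf)"

text \<open>
  Extension by homogeneity: \<open>l\<close> is the least positive integer with \<open>l \<rho> \<in> N\<close>, so that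
  \<open>l = 1\<close> for \<open>\<rho> \<in> N\<close>.
\<close>

definition cone_val ::
  "(rat \<Rightarrow> 'v \<Rightarrow> 'v) \<Rightarrow> ('v::ab_group_add) set \<Rightarrow> 'v set \<Rightarrow> ('k::field, 'v, 'a) cone_module \<Rightarrow>
   'a set \<Rightarrow> 'v \<Rightarrow> rat extended" where
  "cone_val s N \<sigma> R f = (\<lambda>\<rho>\<in>\<sigma>.
     let l = (LEAST l::nat. l > 0 \<and> s (of_nat l) \<rho> \<in> N)
     in map_extended (\<lambda>q. q / of_nat l) (lattice_val s N \<sigma> R f (s (of_nat l) \<rho>)))"

definition L_obj ::
  "(rat \<Rightarrow> 'v \<Rightarrow> 'v) \<Rightarrow> ('v::ab_group_add) set \<Rightarrow> 'v set \<Rightarrow> ('k::field, 'v, 'a) cone_module \<Rightarrow>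
   ('k, 'v, 'a set) prevalued_space" where
  "L_obj s N \<sigma> R = module.extend (E_space s N \<sigma> R) (prevalued_space.fields (cone_val s N \<sigma> R))"

definition L_map ::
  "(rat \<Rightarrow> 'v \<Rightarrow> 'v) \<Rightarrow> ('v::ab_group_add) set \<Rightarrow> 'v set \<Rightarrow>
   ('k::field, 'v, 'a) cone_module \<Rightarrow> ('k, 'v, 'b) cone_module \<Rightarrow> ('a \<Rightarrow> 'b) \<Rightarrow> 'a set \<Rightarrow> 'b set" where
  "L_map s N \<sigma> R R' \<phi> =
     (\<lambda>U\<in>carrier (L_obj s N \<sigma> R). \<Union>x\<in>U. mR s N \<sigma> R' +>\<^bsub>R'\<^esub> \<phi> x)"


section \<open>The functor from prevalued spaces to graded modules\<close>

definition F_level ::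
  "'v set \<Rightarrow> ('k::field, 'v, 'e) prevalued_space \<Rightarrow> ('v \<Rightarrow> rat) \<Rightarrow> 'e set" where
  "F_level \<sigma> E m = {f \<in> carrier E. \<forall>\<rho>\<in>\<sigma>. val E f \<rho> \<ge> Fin (m \<rho>)}"

text \<open>
  The external direct sum of the \<open>F_level \<sigma> E m\<close>, as finitely supported families indexed by \<open>M\<close>.
  Since \<open>\<chi>\<^sub>u\<close> acts by the inclusions of the summand \<open>m - u\<close> into the summand \<open>m\<close>,
  the component of \<open>p x\<close> in degree \<open>m\<close> is the sum over \<open>u\<close> of \<open>p\<^sub>u x\<^sub>m\<^sub>-\<^sub>u\<close>.
\<close>

definition R_carrier ::
  "(rat \<Rightarrow> 'v \<Rightarrow> 'v) \<Rightarrow> ('v::ab_group_add) set \<Rightarrow> 'v set \<Rightarrow> ('k::field, 'v, 'e) prevalued_space \<Rightarrow>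
   (('v \<Rightarrow> rat) \<Rightarrow> 'e) set" where
  "R_carrier s N \<sigma> E = {x \<in> (\<Pi>\<^sub>E m\<in>dual_lattice s N. F_level \<sigma> E m).
     finite {m \<in> dual_lattice s N. x m \<noteq> \<zero>\<^bsub>E\<^esub>}}"

definition R_obj ::
  "(rat \<Rightarrow> 'v \<Rightarrow> 'v) \<Rightarrow> ('v::ab_group_add) set \<Rightarrow> 'v set \<Rightarrow> ('k::field, 'v, 'e) prevalued_space \<Rightarrow>
   ('k, 'v, ('v \<Rightarrow> rat) \<Rightarrow> 'e) cone_module" where
  "R_obj s N \<sigma> E =
     \<lparr>carrier = R_carrier s N \<sigma> E,
      monoid.mult = undefined,
      one = undefined,
      ring.zero = (\<lambda>m\<in>dual_lattice s N. \<zero>\<^bsub>E\<^esub>),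
      add = (\<lambda>x y. \<lambda>m\<in>dual_lattice s N. x m \<oplus>\<^bsub>E\<^esub> y m),
      module.smult = (\<lambda>p x. \<lambda>m\<in>dual_lattice s N.
        \<Oplus>\<^bsub>E\<^esub>u\<in>Poly_Mapping.keys p. Poly_Mapping.lookup p u \<odot>\<^bsub>E\<^esub> x (m - u)),
      grade = (\<lambda>m. {x \<in> R_carrier s N \<sigma> E. \<forall>m'\<in>dual_lattice s N - {m}. x m' = \<zero>\<^bsub>E\<^esub>})\<rparr>"

definition R_map ::
  "(rat \<Rightarrow> 'v \<Rightarrow> 'v) \<Rightarrow> ('v::ab_group_add) set \<Rightarrow> 'v set \<Rightarrow>
   ('k::field, 'v, 'e) prevalued_space \<Rightarrow> ('k, 'v, 'd) prevalued_space \<Rightarrow> ('e \<Rightarrow> 'd) \<Rightarrow>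
   (('v \<Rightarrow> rat) \<Rightarrow> 'e) \<Rightarrow> (('v \<Rightarrow> rat) \<Rightarrow> 'd)" where
  "R_map s N \<sigma> E D \<phi> = (\<lambda>x\<in>R_carrier s N \<sigma> E. \<lambda>m\<in>dual_lattice s N. \<phi> (x m))"

end

theory Submission
  imports Defs
begin

text \<open>
  Write \<open>M\<close> for the dual lattice, \<open>S\<close> for the semigroup of the cone and \<open>[x]\<close> for the class of
  \<open>x \<in> R\<close> in \<open>E\<^sub>R = R / mR\<close>. Passing to \<open>E\<^sub>R\<close> identifies \<open>\<chi>\<^sub>u x\<close> with \<open>x\<close>, and \<open>mR\<close> is the smallest
  submodule that does so. On the other side, \<open>\<chi>\<^sub>u\<close> acts on the module of a prevalued space \<open>E\<close> by
  inclusions inside \<open>E\<close>, so the map that adds up the members of a family, from the direct sum of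
  the \<open>F\<^sub>m\<close> to \<open>E\<close>, does not see \<open>\<chi>\<^sub>u\<close> either.

  The two transposes come from these observations. A map \<open>h : E\<^sub>R \<rightarrow> E\<close> gives
  \<open>x \<mapsto> (h [x\<^sub>m])\<^sub>m\<close>, where \<open>x\<^sub>m\<close> is the component of \<open>x\<close> in degree \<open>m\<close> (constant \<open>adjunct\<close>).
  A graded map \<open>g\<close> from \<open>R\<close> to the families gives \<open>[x] \<mapsto> \<Sum>\<^sub>m g(x)\<^sub>m\<close> (constant \<open>coadjunct\<close>); it is
  well defined because the kernel of \<open>x \<mapsto> \<Sum>\<^sub>m g(x)\<^sub>m\<close> is a submodule that contains every
  \<open>\<chi>\<^sub>u x - x\<close>. They are mutually inverse because \<open>x = \<Sum>\<^sub>m x\<^sub>m\<close>, and because \<open>g(x\<^sub>m)\<close> is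
  concentrated in degree \<open>m\<close>, where it agrees with \<open>g(x)\<close>.

  The valuations fit since both conditions say the same thing about the filtration. The value
  of \<open>f \<in> E\<^sub>R\<close> at \<open>\<rho>\<close> is at least \<open>r\<close> iff \<open>f = [x]\<close> for some \<open>x\<close> whose nonzero components all have
  degrees with \<open>m \<rho> \<ge> r\<close> (\<open>Fin_le_cone_val\<close> together with \<open>G_filtration_iff\<close>). In this form the axioms of
  a prevaluation can be read off, a class \<open>[x]\<close> with \<open>x \<in> R\<^sub>m\<close> has value at least \<open>m\<close>, which places
  \<open>h [x]\<close> in \<open>F\<^sub>m\<close>, and conversely a sum of elements of the \<open>F\<^sub>m\<close> with \<open>m \<rho> \<ge> r\<close> has value at least
  \<open>r\<close> at \<open>\<rho>\<close>. The one arithmetical point is that the valuation is defined by a maximum. For \<open>\<rho>\<close> in the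
  lattice the numbers \<open>m \<rho>\<close> are integers, so the set of admissible \<open>r\<close> has a maximum unless it is all
  of \<open>\<rat>\<close>; every other \<open>\<rho>\<close> has a positive multiple in the lattice, and scaling \<open>\<rho>\<close> rescales the
  filtration.
\<close>

section \<open>Categories of extensional maps\<close>

text \<open>
  Extensional functions are determined by their values on the carrier, so the unit and
  associativity laws hold as equations and only closure of the Hom sets is left to verify.
\<close>

lemma concrete_is_category:
  assumes hom_ext: "\<And>a b. a \<in> Obj C \<Longrightarrow> b \<in> Obj C \<Longrightarrow> Hom C a b \<subseteq> car a \<rightarrow>\<^sub>E car b"
    and ident: "\<And>a. Ident C a = (\<lambda>x\<in>car a. x)"
    and comp: "\<And>a b c f g. Comp C a b c g f = compose (car a) g f"
    and ident_hom: "\<And>a. a \<in> Obj C \<Longrightarrow> (\<lambda>x\<in>car a. x) \<in> Hom C a a"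
    and comp_hom: "\<And>a b c f g. a \<in> Obj C \<Longrightarrow> b \<in> Obj C \<Longrightarrow> c \<in> Obj C \<Longrightarrow> f \<in> Hom C a b \<Longrightarrow>
      g \<in> Hom C b c \<Longrightarrow> compose (car a) g f \<in> Hom C a c"
  shows "is_category C"
  unfolding is_category_def ident comp
proof (intro conjI ballI)
  fix a b f assume ab: "a \<in> Obj C" "b \<in> Obj C" and f: "f \<in> Hom C a b"
  have f': "f \<in> car a \<rightarrow>\<^sub>E car b" using hom_ext ab f by blast
  show "compose (car a) f (\<lambda>x\<in>car a. x) = f"
    using f' by (auto simp: compose_def fun_eq_iff PiE_def extensional_def)
  show "compose (car a) (\<lambda>x\<in>car b. x) f = f"
    using f' by (auto simp: compose_def fun_eq_iff PiE_def extensional_def)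
next
  fix z a b c f g h
  assume o: "z \<in> Obj C" "a \<in> Obj C" "b \<in> Obj C" "c \<in> Obj C"
    and f: "f \<in> Hom C z a" and g: "g \<in> Hom C a b" and h: "h \<in> Hom C b c"
  have "f \<in> car z \<rightarrow>\<^sub>E car a" using hom_ext o f by blast
  then show "compose (car z) (compose (car a) h g) f = compose (car z) h (compose (car z) g f)"
    by (auto simp: compose_def fun_eq_iff PiE_def)
qed (use ident_hom comp_hom in auto)


section \<open>Additive and linear maps\<close>

lemma abelian_group_hom_additiveI:
  assumes "abelian_group V" "abelian_group W" "f \<in> carrier V \<rightarrow> carrier W"
    and "\<And>x y. x \<in> carrier V \<Longrightarrow> y \<in> carrier V \<Longrightarrow> f (x \<oplus>\<^bsub>V\<^esub> y) = f x \<oplus>\<^bsub>W\<^esub> f y"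
  shows "abelian_group_hom V W f"
  using assms
  by (intro abelian_group_homI)
     (auto intro!: group_hom.intro abelian_group.a_group group_hom_axioms.intro simp: hom_def)

lemma (in abelian_group_hom) hom_finsum:
  "y \<in> J \<rightarrow> carrier G \<Longrightarrow> h (\<Oplus>\<^bsub>G\<^esub>j\<in>J. y j) = (\<Oplus>\<^bsub>H\<^esub>j\<in>J. h (y j))"
proof (induction J rule: infinite_finite_induct)
  case (insert j J)
  then have "y j \<in> carrier G" "y \<in> J \<rightarrow> carrier G" by auto
  with insert show ?case by (simp add: Pi_iff)
qed auto

lemma linear_mapsI:
  assumes "f \<in> carrier V \<rightarrow>\<^sub>E carrier W"
    and "\<And>x y. x \<in> carrier V \<Longrightarrow> y \<in> carrier V \<Longrightarrow> f (x \<oplus>\<^bsub>V\<^esub> y) = f x \<oplus>\<^bsub>W\<^esub> f y"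
    and "\<And>a x. a \<in> carrier A \<Longrightarrow> x \<in> carrier V \<Longrightarrow> f (a \<odot>\<^bsub>V\<^esub> x) = a \<odot>\<^bsub>W\<^esub> f x"
  shows "f \<in> linear_maps A V W"
  using assms by (simp add: linear_maps_def)

lemma linear_mapsD:
  assumes "f \<in> linear_maps A V W"
  shows "f \<in> carrier V \<rightarrow>\<^sub>E carrier W"
    and "x \<in> carrier V \<Longrightarrow> f x \<in> carrier W"
    and "x \<in> carrier V \<Longrightarrow> y \<in> carrier V \<Longrightarrow> f (x \<oplus>\<^bsub>V\<^esub> y) = f x \<oplus>\<^bsub>W\<^esub> f y"
    and "a \<in> carrier A \<Longrightarrow> x \<in> carrier V \<Longrightarrow> f (a \<odot>\<^bsub>V\<^esub> x) = a \<odot>\<^bsub>W\<^esub> f x"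
  using assms by (auto simp: linear_maps_def)

lemma linear_maps_group_hom:
  assumes "f \<in> linear_maps A V W" "module A V" "module A W"
  shows "abelian_group_hom V W f"
  using assms
  by (intro abelian_group_hom_additiveI) (auto simp: linear_maps_def module_def PiE_def)

lemma linear_maps_ident:
  assumes "module A V"
  shows "(\<lambda>x\<in>carrier V. x) \<in> linear_maps A V V"
proof -
  interpret module A V by fact
  show ?thesis by (rule linear_mapsI) auto
qed

lemma linear_maps_compose:
  assumes f: "f \<in> linear_maps A U V" and g: "g \<in> linear_maps A V W" and U: "module A U"
  shows "compose (carrier U) g f \<in> linear_maps A U W"
proof -
  interpret module A U by fact
  show ?thesis
    using linear_mapsD[OF f] linear_mapsD[OF g]
    by (intro linear_mapsI) (auto simp: compose_def)
qed


section \<open>Submodules\<close>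

lemma (in module) smult_minus_left:
  assumes "a \<in> carrier R" "b \<in> carrier R" "x \<in> carrier M"
  shows "(a \<ominus>\<^bsub>R\<^esub> b) \<odot>\<^bsub>M\<^esub> x = a \<odot>\<^bsub>M\<^esub> x \<ominus>\<^bsub>M\<^esub> b \<odot>\<^bsub>M\<^esub> x"
  using assms by (simp add: a_minus_def smult_l_distr smult_l_minus)

text \<open>
  The map \<open>f\<close> need only be additive. This covers maps into a space with scalars from a different
  ring, such as the ground field instead of the semigroup algebra.
\<close>

lemma (in module) submodule_vimage:
  assumes f: "abelian_group_hom M W f" and H: "subgroup H (add_monoid W)"
    and smult: "\<And>a x. a \<in> carrier R \<Longrightarrow> x \<in> carrier M \<Longrightarrow> f x \<in> H \<Longrightarrow> f (a \<odot>\<^bsub>M\<^esub> x) \<in> H"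
  shows "submodule {x \<in> carrier M. f x \<in> H} R M"
proof -
  interpret f: abelian_group_hom M W f by fact
  interpret H: additive_subgroup H W using H by (rule additive_subgroupI)
  show ?thesis by (rule submoduleI) (use smult in auto)
qed

lemma (in module) submodule_ideal_submodule:
  assumes "I \<subseteq> carrier R"
  shows "submodule (ideal_submodule R I M) R M"
proof -
  let ?\<H> = "{H. submodule H R M \<and> (\<forall>a\<in>I. \<forall>x\<in>carrier M. a \<odot>\<^bsub>M\<^esub> x \<in> H)}"
  have sub: "submodule H R M" if "H \<in> ?\<H>" for H using that by simp
  have zero: "\<zero>\<^bsub>M\<^esub> \<in> H" if "H \<in> ?\<H>" for H
    using subgroup.one_closed[OF submodule.axioms(1)[OF sub[OF that]]] by simp
  have "carrier M \<in> ?\<H>"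
    using assms carrier_is_submodule by auto
  then have "\<Inter>?\<H> \<subseteq> carrier M" by (rule Inter_lower)
  then show ?thesis
    unfolding ideal_submodule_def
  proof (rule submoduleI)
    show "\<zero>\<^bsub>M\<^esub> \<in> \<Inter>?\<H>" using zero by (rule InterI)
  next
    fix a assume "a \<in> \<Inter>?\<H>"
    then show "\<ominus>\<^bsub>M\<^esub> a \<in> \<Inter>?\<H>"
      by (intro InterI) (drule (1) InterD, erule submoduleE(3)[OF sub])
  next
    fix a b assume "a \<in> \<Inter>?\<H>" "b \<in> \<Inter>?\<H>"
    then show "a \<oplus>\<^bsub>M\<^esub> b \<in> \<Inter>?\<H>"
      by (intro InterI) (drule (1) InterD, drule (1) InterD, erule (1) submoduleE(5)[OF sub])
  next
    fix a x assume "a \<in> carrier R" "x \<in> \<Inter>?\<H>"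
    then show "a \<odot>\<^bsub>M\<^esub> x \<in> \<Inter>?\<H>"
      by (intro InterI) (drule (1) InterD, erule (1) submoduleE(4)[OF sub])
  qed
qed

lemma smult_in_ideal_submodule:
  "a \<in> I \<Longrightarrow> x \<in> carrier M \<Longrightarrow> a \<odot>\<^bsub>M\<^esub> x \<in> ideal_submodule R I M"
  by (auto simp: ideal_submodule_def)

text \<open>
  For a submodule \<open>H\<close>, the scalars that carry the whole module into \<open>H\<close> form an ideal. Hence
  \<open>I M \<subseteq> H\<close> need only be tested on generators of \<open>I\<close>.
\<close>

lemma (in module) genideal_submodule_subset:
  assumes H: "submodule H R M" and S: "S \<subseteq> carrier R"
    and gen: "\<And>a x. a \<in> S \<Longrightarrow> x \<in> carrier M \<Longrightarrow> a \<odot>\<^bsub>M\<^esub> x \<in> H"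
  shows "ideal_submodule R (Idl\<^bsub>R\<^esub> S) M \<subseteq> H"
proof -
  \<comment> \<open>The colon ideal of \<open>H\<close> in the module.\<close>
  define K where "K = {a \<in> carrier R. \<forall>x\<in>carrier M. a \<odot>\<^bsub>M\<^esub> x \<in> H}"
  note E = submoduleE[OF H]
  have "ideal K R"
  proof (rule idealI)
    show "subgroup K (add_monoid R)"
    proof (rule group.subgroupI[OF R.a_group])
      show "K \<noteq> {}"
        using subgroup.one_closed[OF submodule.axioms(1)[OF H]] by (auto simp: K_def intro!: exI[of _ "\<zero>\<^bsub>R\<^esub>"])
      fix a assume "a \<in> K"
      then show "inv\<^bsub>add_monoid R\<^esub> a \<in> K"
        using E(3) by (auto simp: K_def smult_l_minus simp flip: a_inv_def)
    qed (use E in \<open>auto simp: K_def smult_l_distr\<close>)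
    fix a b assume ab: "a \<in> K" "b \<in> carrier R"
    then show "b \<otimes>\<^bsub>R\<^esub> a \<in> K" "a \<otimes>\<^bsub>R\<^esub> b \<in> K"
      using E by (auto simp: K_def smult_assoc1)
  qed (rule R.ring_axioms)
  moreover have "S \<subseteq> K" using S gen by (auto simp: K_def)
  ultimately have "Idl\<^bsub>R\<^esub> S \<subseteq> K" by (rule R.genideal_minimal)
  then have "H \<in> {H. submodule H R M \<and> (\<forall>a\<in>Idl\<^bsub>R\<^esub> S. \<forall>x\<in>carrier M. a \<odot>\<^bsub>M\<^esub> x \<in> H)}"
    using H by (auto simp: K_def)
  then show ?thesis unfolding ideal_submodule_def by (rule Inter_lower)
qed


section \<open>Extended values\<close>

text \<open>
  Rational lower bounds determine a value, with \<open>Pinf\<close> being the one that admits all of them. They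
  translate statements about valuations into statements about filtrations.
\<close>

lemma extended_le_iff_Fin:
  "a \<le> b \<longleftrightarrow> (\<forall>r. Fin r \<le> a \<longrightarrow> Fin r \<le> b)" for a b :: "rat extended"
proof
  assume R: "\<forall>r. Fin r \<le> a \<longrightarrow> Fin r \<le> b"
  show "a \<le> b"
  proof (cases a)
    case Pinf
    then show ?thesis
    proof (cases b)
      case (Fin y)
      then show ?thesis using R[rule_format, of "y + 1"] Pinf by simp
    qed (use R in auto)
  qed (use R in auto)
qed (meson order.trans)

lemma extended_eqI:
  "(\<And>r. Fin r \<le> a \<longleftrightarrow> Fin r \<le> b) \<Longrightarrow> a = b" for a b :: "rat extended"
  by (rule order.antisym; subst extended_le_iff_Fin; blast)

lemma Fin_le_map_mult:
  "0 < l \<Longrightarrow> Fin r \<le> map_extended ((*) l) a \<longleftrightarrow> Fin (r / l) \<le> a" for l r :: rat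
  by (cases a) (auto simp: field_simps)


section \<open>Monomial induction\<close>

text \<open>
  The set \<open>K\<close> confines the induction to polynomials supported in a subsemigroup, which is where the
  module laws are available.
\<close>

lemma monomial_induct [consumes 1, case_names zero single add]:
  assumes "Poly_Mapping.keys p \<subseteq> K"
    and zero: "P 0"
    and single: "\<And>u a. u \<in> K \<Longrightarrow> P (Poly_Mapping.single u a)"
    and add: "\<And>p q. Poly_Mapping.keys p \<subseteq> K \<Longrightarrow> Poly_Mapping.keys q \<subseteq> K \<Longrightarrow> P p \<Longrightarrow> P q \<Longrightarrow> P (p + q)"
  shows "P (p :: 'i \<Rightarrow>\<^sub>0 'k::comm_monoid_add)"
  using assms(1)
proof (induction p rule: update_induct)
  case (update f a b)
  have eq: "Poly_Mapping.update a b f = Poly_Mapping.single a b + f"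
    using update(1)
    by (intro poly_mapping_eqI) (auto simp: lookup_update lookup_add lookup_single in_keys_iff when_def)
  have "insert a (Poly_Mapping.keys f) \<subseteq> K"
    using update(1,2,4) by (auto simp: in_keys_iff lookup_update subset_iff split: if_splits)
  then show ?case unfolding eq using update(3) by (intro add single) auto
qed (rule zero)


section \<open>The cone and the dual lattice\<close>

locale toric_cone =
  fixes s :: "rat \<Rightarrow> 'v \<Rightarrow> 'v::ab_group_add" and N \<sigma> :: "'v set"
  assumes lattice: "is_lattice s N"
    and cone: "rational_polyhedral_cone s N \<sigma>"
begin

abbreviation "M \<equiv> dual_lattice s N"
abbreviation "S \<equiv> dual_cone s \<sigma> \<inter> M"
abbreviation "A \<equiv> cone_algebra s N \<sigma>"

sublocale vs: vector_space s
  using lattice by (simp add: is_lattice_def)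

lemma linear_functional_iff:
  "Vector_Spaces.linear s (*) u \<longleftrightarrow>
     (\<forall>x y. u (x + y) = u x + u y) \<and> (\<forall>c x. u (s c x) = c * u x)"
proof -
  have "vector_space ((*) :: rat \<Rightarrow> rat \<Rightarrow> rat)"
    by unfold_locales (simp_all add: algebra_simps)
  then show ?thesis using vs.vector_space_axioms by (auto simp: Vector_Spaces.linear_iff)
qed

lemma dual_lattice_zero: "0 \<in> M"
  and dual_lattice_add: "u \<in> M \<Longrightarrow> v \<in> M \<Longrightarrow> u + v \<in> M"
  and dual_lattice_diff: "u \<in> M \<Longrightarrow> v \<in> M \<Longrightarrow> u - v \<in> M"
  by (auto simp: dual_lattice_def linear_functional_iff algebra_simps image_subset_iff)

lemma dual_lattice_scale: "m \<in> M \<Longrightarrow> m (s c x) = c * m x"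
  and dual_lattice_Ints: "m \<in> M \<Longrightarrow> x \<in> N \<Longrightarrow> m x \<in> \<int>"
  by (auto simp: dual_lattice_def linear_functional_iff)

lemma dual_cone_zero: "0 \<in> S"
  and dual_cone_add: "u \<in> S \<Longrightarrow> v \<in> S \<Longrightarrow> u + v \<in> S"
  using dual_lattice_zero dual_lattice_add
  by (auto simp: dual_cone_def linear_functional_iff algebra_simps intro: add_nonpos_nonpos)

lemma dual_cone_nonpos: "u \<in> S \<Longrightarrow> \<rho> \<in> \<sigma> \<Longrightarrow> u \<rho> \<le> 0"
  by (auto simp: dual_cone_def)

lemma cone_scale: "\<rho> \<in> \<sigma> \<Longrightarrow> 0 \<le> l \<Longrightarrow> s l \<rho> \<in> \<sigma>"
proof -
  obtain G where G: "\<sigma> = {\<Sum>g\<in>G. s (c g) g | c. \<forall>g\<in>G. 0 \<le> c g}"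
    using cone by (auto simp: rational_polyhedral_cone_def)
  assume "\<rho> \<in> \<sigma>" and l: "0 \<le> l"
  then obtain c where c: "\<rho> = (\<Sum>g\<in>G. s (c g) g)" "\<forall>g\<in>G. 0 \<le> c g" using G by auto
  then have "s l \<rho> = (\<Sum>g\<in>G. s (l * c g) g)"
    by (simp add: vs.scale_sum_right)
  then show "s l \<rho> \<in> \<sigma>" unfolding G using c(2) l by (auto intro!: exI[of _ "\<lambda>g. l * c g"])
qed

lemma common_denominator:
  "finite B \<Longrightarrow> \<exists>l::nat. l > 0 \<and> (\<forall>b\<in>B. of_nat l * (r b :: rat) \<in> \<int>)"
proof (induction B rule: finite_induct)
  case (insert b B)
  then obtain l :: nat where l: "l > 0" "\<forall>b\<in>B. of_nat l * r b \<in> \<int>" by auto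
  obtain p q where pq: "r b = Rat.Fract p q" "q > 0" by (cases "r b") auto
  have "of_nat (l * nat q) * r b = of_int (int l * p)"
    using pq by (simp add: Fract_of_int_quotient)
  then have "of_nat (l * nat q) * r b \<in> \<int>" by (metis Ints_of_int)
  moreover have "of_nat (l * nat q) * r c \<in> \<int>" if "c \<in> B" for c
  proof -
    have "of_nat (l * nat q) * r c = of_nat (nat q) * (of_nat l * r c)" by simp
    then show ?thesis using l(2) that by (metis Ints_mult Ints_of_nat)
  qed
  ultimately show ?case using l(1) pq(2) by (intro exI[of _ "l * nat q"]) auto
qed (auto intro: exI[of _ 1])

text \<open>
  Clear the denominators of the coordinates of \<open>x\<close> in a basis of the lattice.
\<close>

lemma lattice_multiple: "\<exists>l::nat. l > 0 \<and> s (of_nat l) x \<in> N"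
proof -
  obtain B where B: "finite B" "vs.span B = UNIV"
    and N: "N = {\<Sum>b\<in>B. s (of_int (c b)) b | c. c \<in> (UNIV :: ('v \<Rightarrow> int) set)}"
    using lattice unfolding is_lattice_def by blast
  obtain r where x: "x = (\<Sum>b\<in>B. s (r b) b)"
    using vs.span_finite[OF B(1)] unfolding B(2) by blast
  obtain l :: nat where l: "l > 0" "\<forall>b\<in>B. of_nat l * r b \<in> \<int>"
    using common_denominator[OF B(1)] by blast
  then have "\<forall>b\<in>B. \<exists>c. of_nat l * r b = of_int c" by (auto elim: Ints_cases)
  then obtain c where c: "\<forall>b\<in>B. of_nat l * r b = of_int (c b)"
    by (rule bchoice[THEN exE])
  have "s (of_nat l) x = (\<Sum>b\<in>B. s (of_nat l * r b) b)"
    unfolding x by (simp add: vs.scale_sum_right)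
  also have "\<dots> = (\<Sum>b\<in>B. s (of_int (c b)) b)"
    using c by (intro sum.cong) auto
  finally show ?thesis using l(1) N by blast
qed


section \<open>The semigroup algebra\<close>

lemma cone_algebra_simps:
  "carrier A = {p. Poly_Mapping.keys p \<subseteq> S}"
  "p \<otimes>\<^bsub>A\<^esub> q = p * q" "p \<oplus>\<^bsub>A\<^esub> q = p + q" "\<one>\<^bsub>A\<^esub> = 1" "\<zero>\<^bsub>A\<^esub> = 0"
  by (simp_all add: cone_algebra_def ring_of_type_algebra_def)

lemma single_in_cone_algebra: "u \<in> S \<Longrightarrow> Poly_Mapping.single u a \<in> carrier A"
  by (simp add: cone_algebra_simps)

lemma cring_cone_algebra: "cring (A :: (('v \<Rightarrow> rat) \<Rightarrow>\<^sub>0 'k::field) ring)"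
proof (rule cringI)
  have add: "p + q \<in> carrier A" if "p \<in> carrier A" "q \<in> carrier A" for p q :: "('v \<Rightarrow> rat) \<Rightarrow>\<^sub>0 'k"
    using that keys_add[of p q] by (auto simp: cone_algebra_simps)
  have uminus: "- p \<in> carrier A" if "p \<in> carrier A" for p :: "('v \<Rightarrow> rat) \<Rightarrow>\<^sub>0 'k"
    using that by (auto simp: cone_algebra_simps in_keys_iff subset_iff)
  have mult: "p * q \<in> carrier A" if "p \<in> carrier A" "q \<in> carrier A" for p q :: "('v \<Rightarrow> rat) \<Rightarrow>\<^sub>0 'k"
  proof -
    have "w \<in> S" if "w \<in> Poly_Mapping.keys (p * q)" for w
    proof -
      obtain u v where "u \<in> Poly_Mapping.keys p" "v \<in> Poly_Mapping.keys q" and w: "w = u + v"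
        using keys_mult[of p q] \<open>w \<in> _\<close> by blast
      then have "u \<in> S" "v \<in> S"
        using \<open>p \<in> carrier A\<close> \<open>q \<in> carrier A\<close> unfolding cone_algebra_simps by blast+
      then show ?thesis unfolding w by (rule dual_cone_add)
    qed
    then show ?thesis unfolding cone_algebra_simps by blast
  qed
  show "abelian_group (A :: (('v \<Rightarrow> rat) \<Rightarrow>\<^sub>0 'k) ring)"
  proof (rule abelian_groupI)
    fix p :: "('v \<Rightarrow> rat) \<Rightarrow>\<^sub>0 'k" assume "p \<in> carrier A"
    then show "\<exists>q\<in>carrier A. q \<oplus>\<^bsub>A\<^esub> p = \<zero>\<^bsub>A\<^esub>"
      using uminus by (intro bexI[of _ "- p"]) (simp_all add: cone_algebra_simps)
  qed (use add in \<open>simp_all add: cone_algebra_simps(2-) add_ac, simp add: cone_algebra_simps\<close>)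
  show "comm_monoid (A :: (('v \<Rightarrow> rat) \<Rightarrow>\<^sub>0 'k) ring)"
    using mult dual_cone_zero
    by (intro comm_monoidI) (simp_all add: cone_algebra_simps(2-) mult_ac, simp add: cone_algebra_simps)
qed (simp add: cone_algebra_simps distrib_right)

lemma one_in_cone_algebra: "1 \<in> carrier A"
  using dual_cone_zero by (simp add: cone_algebra_simps)

lemma diff_cone_algebra:
  assumes "p \<in> carrier A" "q \<in> carrier A"
  shows "p \<ominus>\<^bsub>A\<^esub> q = p - (q :: ('v \<Rightarrow> rat) \<Rightarrow>\<^sub>0 'k::field)"
proof -
  interpret cring "A :: (('v \<Rightarrow> rat) \<Rightarrow>\<^sub>0 'k) ring" by (rule cring_cone_algebra)
  have "- q \<in> carrier A"
    using assms by (auto simp: cone_algebra_simps in_keys_iff subset_iff)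
  then have "\<ominus>\<^bsub>A\<^esub> q = - q"
    using assms by (intro minus_equality) (simp_all add: cone_algebra_simps(2-))
  then show ?thesis by (simp add: a_minus_def cone_algebra_simps(2-))
qed

lemma linear_mapsI_monomials:
  fixes V :: "(('v \<Rightarrow> rat) \<Rightarrow>\<^sub>0 'k::field, 'a, 'q) module_scheme"
    and W :: "(('v \<Rightarrow> rat) \<Rightarrow>\<^sub>0 'k, 'b, 't) module_scheme"
  assumes V: "module A V" and W: "module A W" and f: "f \<in> carrier V \<rightarrow>\<^sub>E carrier W"
    and add: "\<And>x y. x \<in> carrier V \<Longrightarrow> y \<in> carrier V \<Longrightarrow> f (x \<oplus>\<^bsub>V\<^esub> y) = f x \<oplus>\<^bsub>W\<^esub> f y"
    and single: "\<And>u a x. u \<in> S \<Longrightarrow> x \<in> carrier V \<Longrightarrow>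
      f (Poly_Mapping.single u a \<odot>\<^bsub>V\<^esub> x) = Poly_Mapping.single u a \<odot>\<^bsub>W\<^esub> f x"
  shows "f \<in> linear_maps A V W"
proof (rule linear_mapsI[OF f add])
  interpret V: module A V by fact
  interpret W: module A W by fact
  fix p :: "('v \<Rightarrow> rat) \<Rightarrow>\<^sub>0 'k" and x assume p: "p \<in> carrier A" and x: "x \<in> carrier V"
  then have "Poly_Mapping.keys p \<subseteq> S" by (simp add: cone_algebra_simps)
  then show "f (p \<odot>\<^bsub>V\<^esub> x) = p \<odot>\<^bsub>W\<^esub> f x"
  proof (induction rule: monomial_induct)
    case zero
    have fx: "f x \<in> carrier W" using f x by auto
    interpret abelian_group_hom V W f
      using f add by (intro abelian_group_hom_additiveI V.abelian_group_axioms W.abelian_group_axioms) auto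
    show ?case using V.smult_l_null[OF x] W.smult_l_null[OF fx] by (simp add: cone_algebra_simps)
  next
    case (add p q)
    then have pq: "p \<in> carrier A" "q \<in> carrier A" by (simp_all add: cone_algebra_simps)
    have fx: "f x \<in> carrier W" using f x by auto
    show ?case
      using V.smult_l_distr[OF pq x] W.smult_l_distr[OF pq fx] add assms(4) pq x
      by (simp add: cone_algebra_simps(3))
  qed (use single x in auto)
qed

end


section \<open>Homogeneous components\<close>

text \<open>
  The condition characterises exactly one family when \<open>x\<close> lies in the carrier of a graded module;
  outside the dual lattice that family is \<open>undefined\<close>.
\<close>

definition graded_component ::
  "(rat \<Rightarrow> 'v \<Rightarrow> 'v) \<Rightarrow> ('v::ab_group_add) set \<Rightarrow> ('k::field, 'v, 'a) cone_module \<Rightarrow>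
   'a \<Rightarrow> ('v \<Rightarrow> rat) \<Rightarrow> 'a" where
  "graded_component s N R x = (THE c. c \<in> (\<Pi>\<^sub>E m\<in>dual_lattice s N. grade R m) \<and>
     finite {m\<in>dual_lattice s N. c m \<noteq> \<zero>\<^bsub>R\<^esub>} \<and>
     x = (\<Oplus>\<^bsub>R\<^esub>m\<in>{m\<in>dual_lattice s N. c m \<noteq> \<zero>\<^bsub>R\<^esub>}. c m))"

locale graded_cone_module = toric_cone s N \<sigma>
  for s :: "rat \<Rightarrow> 'v \<Rightarrow> 'v::ab_group_add" and N \<sigma> :: "'v set" +
  fixes R :: "('k::field, 'v, 'a) cone_module"
  assumes graded: "is_graded_module s N \<sigma> R"
begin

sublocale md: module A R
  using graded by (simp add: is_graded_module_def)

abbreviation "component \<equiv> graded_component s N R"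
abbreviation "support x \<equiv> {m\<in>M. component x m \<noteq> \<zero>\<^bsub>R\<^esub>}"

lemma grade_subgroup: "m \<in> M \<Longrightarrow> additive_subgroup (grade R m) R"
  using graded by (auto simp: is_graded_module_def intro: additive_subgroup.intro)

lemma grade_carrier: "m \<in> M \<Longrightarrow> x \<in> grade R m \<Longrightarrow> x \<in> carrier R"
  using additive_subgroup.a_subset[OF grade_subgroup] by blast

lemma single_smult_grade:
  "u \<in> S \<Longrightarrow> m \<in> M \<Longrightarrow> x \<in> grade R m \<Longrightarrow> Poly_Mapping.single u a \<odot>\<^bsub>R\<^esub> x \<in> grade R (u + m)"
  using graded by (auto simp: is_graded_module_def)

lemma decomposition_ex1:
  "x \<in> carrier R \<Longrightarrow> \<exists>!c. c \<in> (\<Pi>\<^sub>E m\<in>M. grade R m) \<and> finite {m\<in>M. c m \<noteq> \<zero>\<^bsub>R\<^esub>} \<and>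
     x = (\<Oplus>\<^bsub>R\<^esub>m\<in>{m\<in>M. c m \<noteq> \<zero>\<^bsub>R\<^esub>}. c m)"
  using graded unfolding is_graded_module_def by blast

lemma
  assumes "x \<in> carrier R"
  shows component_grade: "m \<in> M \<Longrightarrow> component x m \<in> grade R m"
    and finite_support: "finite (support x)"
    and component_sum: "(\<Oplus>\<^bsub>R\<^esub>m\<in>support x. component x m) = x"
  using theI'[OF decomposition_ex1[OF assms]] unfolding graded_component_def[symmetric]
  by (auto simp: PiE_iff)

lemma component_carrier: "x \<in> carrier R \<Longrightarrow> m \<in> M \<Longrightarrow> component x m \<in> carrier R"
  using component_grade grade_carrier by blast

text \<open>
  To compute components it suffices to exhibit a homogeneous expansion over any finite index set,
  in which some terms may vanish.
\<close>

lemma component_eqI: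
  assumes c: "\<And>m. m \<in> M \<Longrightarrow> c m \<in> grade R m" and J: "finite J" "J \<subseteq> M"
    and zero: "\<And>m. m \<in> M \<Longrightarrow> m \<notin> J \<Longrightarrow> c m = \<zero>\<^bsub>R\<^esub>"
    and x: "x = (\<Oplus>\<^bsub>R\<^esub>m\<in>J. c m)" and m: "m \<in> M"
  shows "component x m = c m"
proof -
  let ?c = "restrict c M"
  have cJ: "c \<in> J \<rightarrow> carrier R" using c J(2) grade_carrier by blast
  have supp: "{m\<in>M. ?c m \<noteq> \<zero>\<^bsub>R\<^esub>} \<subseteq> J" using zero by auto
  have "(\<Oplus>\<^bsub>R\<^esub>m\<in>{m\<in>M. ?c m \<noteq> \<zero>\<^bsub>R\<^esub>}. ?c m) = (\<Oplus>\<^bsub>R\<^esub>m\<in>J. c m)"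
    by (rule md.M.add.finprod_mono_neutral_cong_left[OF J(1) supp _ _ cJ]) (use J(2) in auto)
  with x have sum: "x = (\<Oplus>\<^bsub>R\<^esub>m\<in>{m\<in>M. ?c m \<noteq> \<zero>\<^bsub>R\<^esub>}. ?c m)" by (simp only:)
  have x_carrier: "x \<in> carrier R" unfolding x using cJ by (rule md.M.finsum_closed)
  have gr: "?c \<in> (\<Pi>\<^sub>E m\<in>M. grade R m)" using c by auto
  have fin: "finite {m\<in>M. ?c m \<noteq> \<zero>\<^bsub>R\<^esub>}" using supp J(1) by (rule finite_subset)
  have "component x = ?c"
    unfolding graded_component_def
    by (rule the1_equality[OF decomposition_ex1[OF x_carrier]]) (intro conjI gr fin sum)
  then show ?thesis using m by simp
qed

lemma component_sum_superset:
  assumes x: "x \<in> carrier R" and J: "finite J" "J \<subseteq> M" "support x \<subseteq> J"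
  shows "(\<Oplus>\<^bsub>R\<^esub>m\<in>J. component x m) = x"
proof -
  have "(\<Oplus>\<^bsub>R\<^esub>m\<in>J. component x m) = (\<Oplus>\<^bsub>R\<^esub>m\<in>support x. component x m)"
    using J component_carrier[OF x]
    by (intro md.M.add.finprod_mono_neutral_cong_right) auto
  then show ?thesis using component_sum[OF x] by simp
qed

lemma component_add:
  assumes x: "x \<in> carrier R" and y: "y \<in> carrier R" and m: "m \<in> M"
  shows "component (x \<oplus>\<^bsub>R\<^esub> y) m = component x m \<oplus>\<^bsub>R\<^esub> component y m"
proof (rule component_eqI[where J = "support x \<union> support y", OF _ _ _ _ _ m])
  let ?J = "support x \<union> support y"
  have fin: "finite ?J" using finite_support x y by auto
  have "x = (\<Oplus>\<^bsub>R\<^esub>m\<in>?J. component x m)" "y = (\<Oplus>\<^bsub>R\<^esub>m\<in>?J. component y m)"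
    using component_sum_superset x y fin by auto
  then show "x \<oplus>\<^bsub>R\<^esub> y = (\<Oplus>\<^bsub>R\<^esub>m\<in>?J. component x m \<oplus>\<^bsub>R\<^esub> component y m)"
    using component_carrier x y by (subst md.M.finsum_addf) auto
  show "finite ?J" by (fact fin)
next
  fix m assume "m \<in> M"
  then show "component x m \<oplus>\<^bsub>R\<^esub> component y m \<in> grade R m"
    using component_grade x y by (intro additive_subgroup.a_closed[OF grade_subgroup])
qed auto

lemma component_single_smult:
  assumes x: "x \<in> carrier R" and u: "u \<in> S" and m: "m \<in> M"
  shows "component (Poly_Mapping.single u a \<odot>\<^bsub>R\<^esub> x) m =
    Poly_Mapping.single u a \<odot>\<^bsub>R\<^esub> component x (m - u)"
proof (rule component_eqI[where J = "(+) u ` support x", OF _ _ _ _ _ m])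
  have uM: "u \<in> M" using u by simp
  have a: "Poly_Mapping.single u a \<in> carrier A" using u by (rule single_in_cone_algebra)
  show "finite ((+) u ` support x)" using finite_support[OF x] by simp
  show "(+) u ` support x \<subseteq> M" using uM dual_lattice_add by auto
  have "Poly_Mapping.single u a \<odot>\<^bsub>R\<^esub> x =
      Poly_Mapping.single u a \<odot>\<^bsub>R\<^esub> (\<Oplus>\<^bsub>R\<^esub>m\<in>support x. component x m)"
    using component_sum[OF x] by simp
  also have "\<dots> = (\<Oplus>\<^bsub>R\<^esub>m\<in>support x. Poly_Mapping.single u a \<odot>\<^bsub>R\<^esub> component x m)"
    using finite_support[OF x] a component_carrier[OF x] by (intro md.finsum_smult_ldistr) auto
  also have "\<dots> = (\<Oplus>\<^bsub>R\<^esub>m\<in>support x. Poly_Mapping.single u a \<odot>\<^bsub>R\<^esub> component x (u + m - u))"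
    by simp
  also have "\<dots> = (\<Oplus>\<^bsub>R\<^esub>m\<in>(+) u ` support x. Poly_Mapping.single u a \<odot>\<^bsub>R\<^esub> component x (m - u))"
  proof (rule md.M.finsum_reindex[symmetric])
    show "(\<lambda>m. Poly_Mapping.single u a \<odot>\<^bsub>R\<^esub> component x (m - u)) \<in> (+) u ` support x \<rightarrow> carrier R"
    proof
      fix m assume "m \<in> (+) u ` support x"
      then have "m - u \<in> M" using uM dual_lattice_add dual_lattice_diff by blast
      then show "Poly_Mapping.single u a \<odot>\<^bsub>R\<^esub> component x (m - u) \<in> carrier R"
        using a component_carrier[OF x] by (intro md.smult_closed)
    qed
  qed (rule inj_onI, rule add_left_imp_eq)
  finally show "Poly_Mapping.single u a \<odot>\<^bsub>R\<^esub> x =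
    (\<Oplus>\<^bsub>R\<^esub>m\<in>(+) u ` support x. Poly_Mapping.single u a \<odot>\<^bsub>R\<^esub> component x (m - u))" .
  fix m assume m: "m \<in> M"
  have mu: "m - u \<in> M" using m uM by (rule dual_lattice_diff)
  show "Poly_Mapping.single u a \<odot>\<^bsub>R\<^esub> component x (m - u) \<in> grade R m"
    using single_smult_grade[OF u mu component_grade[OF x mu], of a] by simp
  assume m_notin: "m \<notin> (+) u ` support x"
  have "m - u \<notin> support x"
  proof
    assume "m - u \<in> support x"
    then have "u + (m - u) \<in> (+) u ` support x" by (rule imageI)
    moreover have "u + (m - u) = m" by simp
    ultimately show False using m_notin by (simp only:)
  qed
  then show "Poly_Mapping.single u a \<odot>\<^bsub>R\<^esub> component x (m - u) = \<zero>\<^bsub>R\<^esub>"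
    using mu md.smult_r_null[OF a] by simp
qed

lemma component_finsum:
  assumes J: "finite J" "J \<subseteq> M" and y: "\<And>m. m \<in> J \<Longrightarrow> y m \<in> grade R m" and m: "m \<in> M"
  shows "component (\<Oplus>\<^bsub>R\<^esub>m\<in>J. y m) m = (if m \<in> J then y m else \<zero>\<^bsub>R\<^esub>)"
proof (rule component_eqI[OF _ J _ _ m])
  show "(\<Oplus>\<^bsub>R\<^esub>m\<in>J. y m) = (\<Oplus>\<^bsub>R\<^esub>m\<in>J. if m \<in> J then y m else \<zero>\<^bsub>R\<^esub>)"
    using y J(2) grade_carrier by (intro md.M.finsum_cong') auto
qed (use y J additive_subgroup.zero_closed[OF grade_subgroup] in auto)

lemma component_of_grade:
  assumes x: "x \<in> grade R m" and m: "m \<in> M" "m' \<in> M"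
  shows "component x m' = (if m' = m then x else \<zero>\<^bsub>R\<^esub>)"
  using component_finsum[of "{m}" "\<lambda>_. x" m'] grade_carrier[OF m(1) x] assms by simp

end

lemma graded_maps_component:
  assumes "graded_cone_module s N \<sigma> R" "graded_cone_module s N \<sigma> R'"
    and f: "f \<in> graded_maps s N \<sigma> R R'" and x: "x \<in> carrier R" and m: "m \<in> dual_lattice s N"
  shows "graded_component s N R' (f x) m = f (graded_component s N R x m)"
proof -
  interpret R: graded_cone_module s N \<sigma> R by fact
  interpret R': graded_cone_module s N \<sigma> R' by fact
  have lin: "f \<in> linear_maps (cone_algebra s N \<sigma>) R R'"
    and gr: "\<And>m x. m \<in> dual_lattice s N \<Longrightarrow> x \<in> grade R m \<Longrightarrow> f x \<in> grade R' m"
    using f by (auto simp: graded_maps_def)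
  interpret f: abelian_group_hom R R' f
    using lin R.md.module_axioms R'.md.module_axioms by (rule linear_maps_group_hom)
  show ?thesis
  proof (rule R'.component_eqI[where J = "R.support x", OF _ _ _ _ _ m])
    have "f x = f (\<Oplus>\<^bsub>R\<^esub>m\<in>R.support x. R.component x m)" using R.component_sum[OF x] by simp
    also have "\<dots> = (\<Oplus>\<^bsub>R'\<^esub>m\<in>R.support x. f (R.component x m))"
      using R.component_carrier[OF x] by (intro f.hom_finsum) auto
    finally show "f x = (\<Oplus>\<^bsub>R'\<^esub>m\<in>R.support x. f (R.component x m))" .
  qed (use gr R.component_grade[OF x] R.finite_support[OF x] in auto)
qed


section \<open>The quotient space of a graded module\<close>

abbreviation ground_field :: "'k::field ring" where
  "ground_field \<equiv> ring_of_type_algebra"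

lemma ground_field_simps:
  "carrier ground_field = UNIV" "a \<otimes>\<^bsub>ground_field\<^esub> b = a * b" "a \<oplus>\<^bsub>ground_field\<^esub> b = a + b"
  "\<one>\<^bsub>ground_field\<^esub> = 1" "\<zero>\<^bsub>ground_field\<^esub> = 0"
  by (simp_all add: ring_of_type_algebra_def)

context graded_cone_module
begin

lemma torus_unit_generators:
  "{chi u - 1 | u. u \<in> S} \<subseteq> carrier (A :: (('v \<Rightarrow> rat) \<Rightarrow>\<^sub>0 'k) ring)"
proof -
  have "(chi u - 1 :: ('v \<Rightarrow> rat) \<Rightarrow>\<^sub>0 'k) \<in> carrier A" if u: "u \<in> S" for u
  proof -
    have "chi u \<ominus>\<^bsub>A\<^esub> 1 \<in> carrier (A :: (('v \<Rightarrow> rat) \<Rightarrow>\<^sub>0 'k) ring)"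
      using single_in_cone_algebra[OF u] one_in_cone_algebra by (rule md.R.minus_closed)
    then show ?thesis
      by (simp only: diff_cone_algebra[OF single_in_cone_algebra[OF u] one_in_cone_algebra])
  qed
  then show ?thesis by blast
qed

lemma chi_minus_one_smult:
  assumes u: "u \<in> S" and x: "x \<in> carrier R"
  shows "(chi u - 1) \<odot>\<^bsub>R\<^esub> x = chi u \<odot>\<^bsub>R\<^esub> x \<ominus>\<^bsub>R\<^esub> x"
proof -
  have "\<one>\<^bsub>A\<^esub> \<odot>\<^bsub>R\<^esub> x = x" using x by (rule md.smult_one)
  then have "1 \<odot>\<^bsub>R\<^esub> x = x" by (simp only: cone_algebra_simps)
  then show ?thesis
    using md.smult_minus_left[OF single_in_cone_algebra[OF u] one_in_cone_algebra x]
    by (simp add: diff_cone_algebra[OF single_in_cone_algebra[OF u] one_in_cone_algebra])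
qed

lemma mR_submodule: "submodule (mR s N \<sigma> R) A R"
proof -
  have "ideal (torus_unit_ideal s N \<sigma>) (A :: (('v \<Rightarrow> rat) \<Rightarrow>\<^sub>0 'k) ring)"
    unfolding torus_unit_ideal_def by (rule md.R.genideal_ideal[OF torus_unit_generators])
  then have "torus_unit_ideal s N \<sigma> \<subseteq> carrier (A :: (('v \<Rightarrow> rat) \<Rightarrow>\<^sub>0 'k) ring)"
    by (intro additive_subgroup.a_subset ideal.axioms(1))
  then show ?thesis unfolding mR_def by (rule md.submodule_ideal_submodule)
qed

sublocale mR: abelian_subgroup "mR s N \<sigma> R" R
  using mR_submodule md.M.abelian_group_axioms
  by (intro abelian_subgroupI3 additive_subgroupI) (auto dest: submodule.axioms(1))

lemma chi_minus_id_in_mR: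
  assumes u: "u \<in> S" and x: "x \<in> carrier R"
  shows "chi u \<odot>\<^bsub>R\<^esub> x \<ominus>\<^bsub>R\<^esub> x \<in> mR s N \<sigma> R"
proof -
  have "(chi u - 1 :: ('v \<Rightarrow> rat) \<Rightarrow>\<^sub>0 'k) \<in> torus_unit_ideal s N \<sigma>"
    unfolding torus_unit_ideal_def
    by (rule set_mp[OF md.R.genideal_self[OF torus_unit_generators]]) (use u in blast)
  then show ?thesis
    unfolding mR_def chi_minus_one_smult[OF u x, symmetric] using x by (rule smult_in_ideal_submodule)
qed

text \<open>
  Together with \<open>chi_minus_id_in_mR\<close> this characterises \<open>mR\<close> as the smallest submodule modulo
  which all \<open>\<chi>\<^sub>u\<close> act as the identity.
\<close>

lemma mR_subset:
  assumes H: "submodule H A R"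
    and chi: "\<And>u x. u \<in> S \<Longrightarrow> x \<in> carrier R \<Longrightarrow> chi u \<odot>\<^bsub>R\<^esub> x \<ominus>\<^bsub>R\<^esub> x \<in> H"
  shows "mR s N \<sigma> R \<subseteq> H"
  unfolding mR_def torus_unit_ideal_def
  by (rule md.genideal_submodule_subset[OF H torus_unit_generators])
     (auto simp: chi_minus_one_smult chi)

abbreviation "cls x \<equiv> mR s N \<sigma> R +>\<^bsub>R\<^esub> x"

lemma cls_eqI:
  assumes "x \<in> carrier R" "y \<in> carrier R" "x \<ominus>\<^bsub>R\<^esub> y \<in> mR s N \<sigma> R"
  shows "cls x = cls y"
proof -
  have "x \<in> cls y" using assms mR.a_rcos_module_rev by (simp add: a_minus_def)
  then show ?thesis using assms(2) mR.a_repr_independence' by blast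
qed

lemma cls_eqD:
  assumes "x \<in> carrier R" "y \<in> carrier R" "cls x = cls y"
  shows "x \<ominus>\<^bsub>R\<^esub> y \<in> mR s N \<sigma> R"
  using assms mR.a_rcos_self[of x] mR.a_rcos_module_imp[of y x] by (simp add: a_minus_def)

lemma UN_cls:
  assumes x: "x \<in> carrier R" and const: "\<And>y. y \<in> carrier R \<Longrightarrow> cls y = cls x \<Longrightarrow> f y = f x"
  shows "(\<Union>y\<in>cls x. f y) = f x"
proof -
  have "f y = f x" if "y \<in> cls x" for y
    using const mR.a_elemrcos_carrier[OF x that] mR.a_repr_independence'[OF that x] by blast
  then show ?thesis using mR.a_rcos_self[OF x] by blast
qed

lemma cls_chi: "u \<in> S \<Longrightarrow> x \<in> carrier R \<Longrightarrow> cls (chi u \<odot>\<^bsub>R\<^esub> x) = cls x"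
  by (intro cls_eqI chi_minus_id_in_mR md.smult_closed single_in_cone_algebra)

text \<open>
  Factor the monomial as \<open>\<chi>\<^sub>u\<close> times a scalar; the first factor disappears in the quotient.
\<close>

lemma cls_single:
  assumes u: "u \<in> S" and x: "x \<in> carrier R"
  shows "cls (Poly_Mapping.single u a \<odot>\<^bsub>R\<^esub> x) = cls (Poly_Mapping.single 0 a \<odot>\<^bsub>R\<^esub> x)"
proof -
  have a: "Poly_Mapping.single 0 a \<in> carrier A"
    using dual_cone_zero by (rule single_in_cone_algebra)
  have "Poly_Mapping.single u a = chi u \<otimes>\<^bsub>A\<^esub> Poly_Mapping.single 0 a"
    by (simp add: cone_algebra_simps mult_single)
  then have "Poly_Mapping.single u a \<odot>\<^bsub>R\<^esub> x = chi u \<odot>\<^bsub>R\<^esub> (Poly_Mapping.single 0 a \<odot>\<^bsub>R\<^esub> x)"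
    using md.smult_assoc1[OF single_in_cone_algebra[OF u] a x] by simp
  then show ?thesis using cls_chi[OF u md.smult_closed[OF a x]] by simp
qed

lemma E_space_simps:
  "carrier (E_space s N \<sigma> R) = cls ` carrier R"
  "\<zero>\<^bsub>E_space s N \<sigma> R\<^esub> = cls \<zero>\<^bsub>R\<^esub>"
  "x \<in> carrier R \<Longrightarrow> y \<in> carrier R \<Longrightarrow> cls x \<oplus>\<^bsub>E_space s N \<sigma> R\<^esub> cls y = cls (x \<oplus>\<^bsub>R\<^esub> y)"
  by (auto simp: E_space_def A_RCOSETS_def' mR.a_rcos_sum mR.a_subset)

lemma E_space_smult:
  assumes x: "x \<in> carrier R"
  shows "c \<odot>\<^bsub>E_space s N \<sigma> R\<^esub> cls x = cls (Poly_Mapping.single 0 c \<odot>\<^bsub>R\<^esub> x)"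
proof -
  have c: "Poly_Mapping.single 0 c \<in> carrier A"
    using dual_cone_zero by (rule single_in_cone_algebra)
  have const: "cls (Poly_Mapping.single 0 c \<odot>\<^bsub>R\<^esub> y) = cls (Poly_Mapping.single 0 c \<odot>\<^bsub>R\<^esub> x)"
    if y: "y \<in> carrier R" and eq: "cls y = cls x" for y
  proof (rule cls_eqI)
    have "Poly_Mapping.single 0 c \<odot>\<^bsub>R\<^esub> (y \<ominus>\<^bsub>R\<^esub> x) \<in> mR s N \<sigma> R"
      using c cls_eqD[OF y x eq] by (rule submodule.smult_closed[OF mR_submodule])
    then show "Poly_Mapping.single 0 c \<odot>\<^bsub>R\<^esub> y \<ominus>\<^bsub>R\<^esub> Poly_Mapping.single 0 c \<odot>\<^bsub>R\<^esub> x \<in> mR s N \<sigma> R"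
      using c x y by (simp add: a_minus_def md.smult_r_distr md.smult_r_minus)
  qed (use c x y in auto)
  have "c \<odot>\<^bsub>E_space s N \<sigma> R\<^esub> cls x = (\<Union>y\<in>cls x. cls (Poly_Mapping.single 0 c \<odot>\<^bsub>R\<^esub> y))"
    by (simp add: E_space_def)
  also have "\<dots> = cls (Poly_Mapping.single 0 c \<odot>\<^bsub>R\<^esub> x)"
    using x const by (rule UN_cls)
  finally show ?thesis .
qed

text \<open>
  The quotient occurs both as a bare vector space and, with a prevaluation added to the record,
  as a prevalued space; the extension is left open so that both cases are covered.
\<close>

lemma quotient_module:
  fixes V :: "('k, 'a set, 'q) module_scheme"
  assumes V: "carrier V = carrier (E_space s N \<sigma> R)" "ring.zero V = ring.zero (E_space s N \<sigma> R)"
    "ring.add V = ring.add (E_space s N \<sigma> R)" "module.smult V = module.smult (E_space s N \<sigma> R)"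
  shows "module ground_field V"
proof (rule moduleI)
  note V = V E_space_simps E_space_smult
  have c: "Poly_Mapping.single 0 c \<in> carrier A" for c :: 'k
    using dual_cone_zero by (rule single_in_cone_algebra)
  show "cring ground_field" by (rule cring_from_type_algebra)
  show "abelian_group V"
  proof (rule abelian_groupI)
    fix U assume "U \<in> carrier V"
    then obtain x where x: "x \<in> carrier R" "U = cls x" using V by auto
    then show "\<exists>U'\<in>carrier V. U' \<oplus>\<^bsub>V\<^esub> U = \<zero>\<^bsub>V\<^esub>"
      by (intro bexI[of _ "cls (\<ominus>\<^bsub>R\<^esub> x)"]) (auto simp: V md.M.l_neg)
  qed (auto simp: V md.M.a_ac)
  fix a b :: 'k and U U' assume "U \<in> carrier V"
  then obtain x where x: "x \<in> carrier R" "U = cls x" using V by auto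
  show "a \<odot>\<^bsub>V\<^esub> U \<in> carrier V" using x c by (auto simp: V)
  show "(a \<oplus>\<^bsub>ground_field\<^esub> b) \<odot>\<^bsub>V\<^esub> U = a \<odot>\<^bsub>V\<^esub> U \<oplus>\<^bsub>V\<^esub> b \<odot>\<^bsub>V\<^esub> U"
    using x c md.smult_l_distr[OF c c x(1), of a b]
    by (simp add: V ground_field_simps cone_algebra_simps single_add)
  show "(a \<otimes>\<^bsub>ground_field\<^esub> b) \<odot>\<^bsub>V\<^esub> U = a \<odot>\<^bsub>V\<^esub> (b \<odot>\<^bsub>V\<^esub> U)"
    using x c md.smult_assoc1[OF c c x(1), of a b]
    by (simp add: V ground_field_simps cone_algebra_simps mult_single)
  show "\<one>\<^bsub>ground_field\<^esub> \<odot>\<^bsub>V\<^esub> U = U"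
    using x md.smult_one[OF x(1)] by (simp add: V ground_field_simps cone_algebra_simps)
  assume "U' \<in> carrier V"
  then obtain y where y: "y \<in> carrier R" "U' = cls y" using V by auto
  show "a \<odot>\<^bsub>V\<^esub> (U \<oplus>\<^bsub>V\<^esub> U') = a \<odot>\<^bsub>V\<^esub> U \<oplus>\<^bsub>V\<^esub> a \<odot>\<^bsub>V\<^esub> U'"
    using x y c by (simp add: V md.smult_r_distr)
qed

lemma L_obj_simps:
  "carrier (L_obj s N \<sigma> R) = carrier (E_space s N \<sigma> R)"
  "ring.zero (L_obj s N \<sigma> R) = ring.zero (E_space s N \<sigma> R)"
  "ring.add (L_obj s N \<sigma> R) = ring.add (E_space s N \<sigma> R)"
  "module.smult (L_obj s N \<sigma> R) = module.smult (E_space s N \<sigma> R)"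
  "val (L_obj s N \<sigma> R) = cone_val s N \<sigma> R"
  by (simp_all add: L_obj_def module.defs prevalued_space.defs)

lemmas L_space_simps = L_obj_simps(1-4)[unfolded E_space_simps(1)] E_space_simps(2,3) E_space_smult

lemma module_E_space: "module ground_field (E_space s N \<sigma> R)"
  by (rule quotient_module) simp_all

lemma module_L_obj: "module ground_field (L_obj s N \<sigma> R)"
  by (rule quotient_module) (simp_all add: L_obj_simps)

lemma cls_hom: "abelian_group_hom R (E_space s N \<sigma> R) (\<lambda>x. cls x)"
  by (rule abelian_group_hom_additiveI[OF md.M.abelian_group_axioms module.axioms(2)[OF module_E_space]])
     (simp_all add: E_space_simps)


section \<open>The filtration and its valuation\<close>

text \<open>
  Collecting the summands of a filtration element gives one representative \<open>x\<close> with the summands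
  as its components; conversely the components of \<open>x\<close> provide the summands.
  All properties of the filtration follow from those of components.
\<close>

lemma G_filtration_iff:
  "U \<in> G_filtration s N \<sigma> R \<rho> r \<longleftrightarrow>
     (\<exists>x\<in>carrier R. U = cls x \<and> (\<forall>m\<in>support x. r \<le> m \<rho>))"
proof
  interpret cls: abelian_group_hom R "E_space s N \<sigma> R" "\<lambda>x. cls x" by (rule cls_hom)
  {
    assume "U \<in> G_filtration s N \<sigma> R \<rho> r"
    then obtain J c where J: "finite J" "J \<subseteq> {m \<in> M. m \<rho> \<ge> r}"
      and c: "\<forall>m\<in>J. c m \<in> F_piece s N \<sigma> R m" and U: "U = (\<Oplus>\<^bsub>E_space s N \<sigma> R\<^esub>m\<in>J. c m)"
      by (auto simp: G_filtration_def)
    have "\<forall>m\<in>J. \<exists>y. y \<in> grade R m \<and> c m = cls y" using c by (auto simp: F_piece_def)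
    from bchoice[OF this] obtain y where y: "\<forall>m\<in>J. y m \<in> grade R m \<and> c m = cls (y m)" ..
    have JM: "J \<subseteq> M" using J(2) by blast
    have yR: "y \<in> J \<rightarrow> carrier R" using y JM grade_carrier by blast
    let ?x = "\<Oplus>\<^bsub>R\<^esub>m\<in>J. y m"
    have "U = (\<Oplus>\<^bsub>E_space s N \<sigma> R\<^esub>m\<in>J. cls (y m))"
      unfolding U
    proof (rule cls.H.finsum_cong')
      show "(\<lambda>m. cls (y m)) \<in> J \<rightarrow> carrier (E_space s N \<sigma> R)"
      proof
        fix m assume "m \<in> J"
        then have "y m \<in> carrier R" using yR by blast
        then show "cls (y m) \<in> carrier (E_space s N \<sigma> R)" by (rule cls.hom_closed)
      qed
    qed (use y in auto)
    also have "\<dots> = cls ?x" using yR by (rule cls.hom_finsum[symmetric])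
    finally have "U = cls ?x" .
    moreover have "?x \<in> carrier R" using yR by (rule md.M.finsum_closed)
    moreover have "r \<le> m \<rho>" if "m \<in> support ?x" for m
    proof -
      have "m \<in> J"
        using that component_finsum[OF J(1) JM, of y m] y by (cases "m \<in> J") auto
      then show ?thesis using J(2) by blast
    qed
    ultimately show "\<exists>x\<in>carrier R. U = cls x \<and> (\<forall>m\<in>support x. r \<le> m \<rho>)" by blast
  next
    assume "\<exists>x\<in>carrier R. U = cls x \<and> (\<forall>m\<in>support x. r \<le> m \<rho>)"
    then obtain x where x: "x \<in> carrier R" and U: "U = cls x" and r: "\<forall>m\<in>support x. r \<le> m \<rho>"
      by blast
    have "cls x = (\<Oplus>\<^bsub>E_space s N \<sigma> R\<^esub>m\<in>support x. cls (component x m))"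
      using cls.hom_finsum[of "component x" "support x"] component_sum[OF x] component_carrier[OF x]
      by auto
    moreover have "\<forall>m\<in>support x. cls (component x m) \<in> F_piece s N \<sigma> R m"
      using component_grade[OF x] by (auto simp: F_piece_def)
    ultimately show "U \<in> G_filtration s N \<sigma> R \<rho> r"
      unfolding G_filtration_def U using finite_support[OF x] r
      by (intro CollectI exI[of _ "support x"] exI[of _ "\<lambda>m. cls (component x m)"]) auto
  }
qed

lemma G_filtration_antimono:
  "U \<in> G_filtration s N \<sigma> R \<rho> r \<Longrightarrow> t \<le> r \<Longrightarrow> U \<in> G_filtration s N \<sigma> R \<rho> t"
  unfolding G_filtration_iff by (meson order_trans)

lemma G_filtration_exhausts:
  assumes "U \<in> carrier (E_space s N \<sigma> R)"
  shows "\<exists>r. U \<in> G_filtration s N \<sigma> R \<rho> r"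
proof -
  obtain x where x: "x \<in> carrier R" "U = cls x" using assms by (auto simp: E_space_simps)
  \<comment> \<open>The inserted \<open>0\<close> keeps the minimum meaningful when \<open>x\<close> has no components.\<close>
  let ?r = "Min (insert 0 ((\<lambda>m. m \<rho>) ` support x))"
  have "\<forall>m\<in>support x. ?r \<le> m \<rho>" using finite_support[OF x(1)] by (auto intro!: Min_le)
  then show ?thesis using x by (auto simp: G_filtration_iff)
qed

text \<open>
  Jumps of the filtration at a lattice point occur at integers only, since \<open>m \<rho>\<close> is an integer.
\<close>

lemma G_filtration_ceiling:
  assumes \<rho>: "\<rho> \<in> N" and U: "U \<in> G_filtration s N \<sigma> R \<rho> r"
  shows "U \<in> G_filtration s N \<sigma> R \<rho> (of_int \<lceil>r\<rceil>)"
proof -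
  have "of_int \<lceil>r\<rceil> \<le> m \<rho>" if m: "m \<in> M" and r: "r \<le> m \<rho>" for m
  proof -
    obtain k where "m \<rho> = of_int k" using dual_lattice_Ints[OF m \<rho>] by (auto elim: Ints_cases)
    then show ?thesis using r by (simp add: ceiling_le_iff)
  qed
  then show ?thesis using U unfolding G_filtration_iff by blast
qed

lemma G_filtration_scale:
  assumes "0 < l"
  shows "G_filtration s N \<sigma> R (s l \<rho>) r = G_filtration s N \<sigma> R \<rho> (r / l)"
proof -
  have "r \<le> m (s l \<rho>) \<longleftrightarrow> r / l \<le> m \<rho>" if "m \<in> M" for m
    using assms dual_lattice_scale[OF that] by (simp add: field_simps)
  then show ?thesis by (auto simp: G_filtration_iff intro!: set_eqI bex_cong)
qed

lemma G_filtration_zero: "cls \<zero>\<^bsub>R\<^esub> \<in> G_filtration s N \<sigma> R \<rho> r"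
proof -
  have "support \<zero>\<^bsub>R\<^esub> = {}"
    using component_finsum[of "{}"] by auto
  then show ?thesis by (auto simp: G_filtration_iff)
qed

lemma G_filtration_add:
  assumes "U \<in> G_filtration s N \<sigma> R \<rho> r" "U' \<in> G_filtration s N \<sigma> R \<rho> r"
  shows "U \<oplus>\<^bsub>E_space s N \<sigma> R\<^esub> U' \<in> G_filtration s N \<sigma> R \<rho> r"
proof -
  obtain x y where x: "x \<in> carrier R" "U = cls x" "\<forall>m\<in>support x. r \<le> m \<rho>"
    and y: "y \<in> carrier R" "U' = cls y" "\<forall>m\<in>support y. r \<le> m \<rho>"
    using assms by (auto simp: G_filtration_iff)
  have "support (x \<oplus>\<^bsub>R\<^esub> y) \<subseteq> support x \<union> support y"
    using component_add[OF x(1) y(1)] by auto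
  then show ?thesis
    unfolding G_filtration_iff using x y E_space_simps(3)
    by (intro bexI[of _ "x \<oplus>\<^bsub>R\<^esub> y"]) auto
qed

lemma G_filtration_smult:
  assumes "U \<in> G_filtration s N \<sigma> R \<rho> r"
  shows "c \<odot>\<^bsub>E_space s N \<sigma> R\<^esub> U \<in> G_filtration s N \<sigma> R \<rho> r"
proof -
  obtain x where x: "x \<in> carrier R" "U = cls x" "\<forall>m\<in>support x. r \<le> m \<rho>"
    using assms by (auto simp: G_filtration_iff)
  have c: "Poly_Mapping.single 0 c \<in> carrier A"
    using dual_cone_zero by (rule single_in_cone_algebra)
  have "support (Poly_Mapping.single 0 c \<odot>\<^bsub>R\<^esub> x) \<subseteq> support x"
    using component_single_smult[OF x(1) dual_cone_zero, of _ c] md.smult_r_null[OF c] by auto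
  then show ?thesis
    unfolding G_filtration_iff using x c E_space_smult
    by (intro bexI[of _ "Poly_Mapping.single 0 c \<odot>\<^bsub>R\<^esub> x"]) auto
qed

text \<open>
  This is homogeneity with factor \<open>0\<close>: every nonzero vector has value \<open>0\<close> at the origin.
\<close>

lemma G_filtration_origin:
  assumes "U \<in> carrier (E_space s N \<sigma> R)"
  shows "U \<in> G_filtration s N \<sigma> R 0 r \<longleftrightarrow> r \<le> 0 \<or> U = cls \<zero>\<^bsub>R\<^esub>"
proof
  have m0: "m 0 = 0" if "m \<in> M" for m using dual_lattice_scale[OF that, of 0 0] by simp
  assume "U \<in> G_filtration s N \<sigma> R 0 r"
  then obtain x where x: "x \<in> carrier R" "U = cls x" "\<forall>m\<in>support x. r \<le> m 0"
    by (auto simp: G_filtration_iff)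
  show "r \<le> 0 \<or> U = cls \<zero>\<^bsub>R\<^esub>"
  proof (cases "support x = {}")
    case True
    have "x = \<zero>\<^bsub>R\<^esub>" using component_sum[OF x(1)] unfolding True by simp
    then show ?thesis using x(2) by simp
  next
    case False
    then obtain m where "m \<in> support x" by blast
    then have "r \<le> m 0" "m \<in> M" using x(3) by blast+
    then show ?thesis using m0[OF \<open>m \<in> M\<close>] by simp
  qed
next
  obtain x where x: "x \<in> carrier R" "U = cls x" using assms by (auto simp: E_space_simps)
  have m0: "m 0 = 0" if "m \<in> M" for m using dual_lattice_scale[OF that, of 0 0] by simp
  assume "r \<le> 0 \<or> U = cls \<zero>\<^bsub>R\<^esub>"
  then show "U \<in> G_filtration s N \<sigma> R 0 r"
  proof
    assume "r \<le> 0"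
    then have "\<forall>m\<in>support x. r \<le> m 0" using m0 by fastforce
    then show ?thesis unfolding G_filtration_iff using x by blast
  qed (simp add: G_filtration_zero)
qed

end

text \<open>
  A nonempty down-closed set of rationals that jumps only at integers either has a maximum or is
  everything, so the value \<open>Pinf\<close> for a maximum that is not attained is the correct one.
\<close>

lemma Fin_le_greatest_iff:
  fixes P :: "rat \<Rightarrow> bool"
  assumes antimono: "\<And>r t. P r \<Longrightarrow> t \<le> r \<Longrightarrow> P t"
    and nonempty: "\<exists>r. P r"
    and ceiling: "\<And>r. P r \<Longrightarrow> P (of_int \<lceil>r\<rceil>)"
  shows "Fin r \<le> (if \<exists>r. P r \<and> (\<forall>t. P t \<longrightarrow> t \<le> r) then Fin (GREATEST r. P r) else Pinf) \<longleftrightarrow> P r"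
proof (cases "\<exists>r. P r \<and> (\<forall>t. P t \<longrightarrow> t \<le> r)")
  case True
  then obtain q where q: "P q" "\<forall>t. P t \<longrightarrow> t \<le> q" by blast
  then have greatest: "(GREATEST r. P r) = q" by (intro Greatest_equality) auto
  have "P r \<longleftrightarrow> r \<le> q" using q antimono[OF q(1)] by blast
  then show ?thesis unfolding if_P[OF True] greatest by simp
next
  case False
  have "P r"
  proof (rule ccontr)
    assume "\<not> P r"
    then have below: "t < r" if "P t" for t using that antimono by (meson not_le)
    obtain r0 where r0: "P r0" using nonempty by blast
    \<comment> \<open>The integral levels above \<open>r0\<close> at which \<open>P\<close> holds; their maximum would be a maximum of \<open>P\<close>.\<close>
    let ?K = "{k \<in> {\<lceil>r0\<rceil>..\<lceil>r\<rceil>}. P (of_int k)}"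
    have mem: "\<lceil>t\<rceil> \<in> ?K" if t: "P t" "r0 \<le> t" for t
      using ceiling[OF t(1)] below[OF t(1)] t(2) by (auto intro: ceiling_mono)
    have fin: "finite ?K" by (rule finite_subset[of _ "{\<lceil>r0\<rceil>..\<lceil>r\<rceil>}"]) auto
    have ne: "?K \<noteq> {}" using mem[OF r0] by blast
    have "P (of_int (Max ?K))" using Max_in[OF fin ne] by blast
    moreover have "t \<le> of_int (Max ?K)" if "P t" for t
    proof (cases "r0 \<le> t")
      case True
      then have "\<lceil>t\<rceil> \<le> Max ?K" using Max_ge[OF fin mem[OF that]] by blast
      then show ?thesis by (simp add: ceiling_le_iff)
    next
      case False
      moreover have "\<lceil>r0\<rceil> \<le> Max ?K" using Max_ge[OF fin mem[OF r0]] by blast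
      ultimately show ?thesis by (simp add: ceiling_le_iff)
    qed
    ultimately show False using False by blast
  qed
  then show ?thesis unfolding if_not_P[OF False] by simp
qed

context graded_cone_module
begin

lemma Fin_le_lattice_val:
  assumes "\<rho> \<in> N" "U \<in> carrier (E_space s N \<sigma> R)"
  shows "Fin r \<le> lattice_val s N \<sigma> R U \<rho> \<longleftrightarrow> U \<in> G_filtration s N \<sigma> R \<rho> r"
  unfolding lattice_val_def
  by (rule Fin_le_greatest_iff[where P = "\<lambda>r. U \<in> G_filtration s N \<sigma> R \<rho> r"])
     (use assms G_filtration_antimono G_filtration_exhausts G_filtration_ceiling in blast)+

text \<open>
  The definition of the value at \<open>\<rho>\<close> passes to a lattice multiple \<open>l \<rho>\<close>, but the filtration at
  \<open>l \<rho>\<close> and level \<open>l r\<close> is the one at \<open>\<rho>\<close> and level \<open>r\<close>, so \<open>l\<close> drops out.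
\<close>

lemma Fin_le_cone_val:
  assumes \<rho>: "\<rho> \<in> \<sigma>" and U: "U \<in> carrier (E_space s N \<sigma> R)"
  shows "Fin r \<le> cone_val s N \<sigma> R U \<rho> \<longleftrightarrow> U \<in> G_filtration s N \<sigma> R \<rho> r"
proof -
  define l where "l = (LEAST l::nat. l > 0 \<and> s (of_nat l) \<rho> \<in> N)"
  have l: "l > 0" "s (of_nat l) \<rho> \<in> N"
    using LeastI_ex[OF lattice_multiple[of \<rho>]] unfolding l_def by blast+
  have div: "(\<lambda>q. q / of_nat l) = (*) (1 / of_nat l :: rat)" by (rule ext) simp
  have "Fin r \<le> cone_val s N \<sigma> R U \<rho> \<longleftrightarrow>
      Fin (of_nat l * r) \<le> lattice_val s N \<sigma> R U (s (of_nat l) \<rho>)"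
    using \<rho> l(1) by (simp add: cone_val_def Let_def l_def[symmetric] div Fin_le_map_mult mult.commute)
  also have "\<dots> \<longleftrightarrow> U \<in> G_filtration s N \<sigma> R \<rho> r"
    using l U by (simp add: Fin_le_lattice_val G_filtration_scale)
  finally show ?thesis .
qed

lemma cone_val_pl_functions:
  assumes U: "U \<in> carrier (E_space s N \<sigma> R)"
  shows "cone_val s N \<sigma> R U \<in> pl_functions s \<sigma>"
  unfolding pl_functions_def
proof (intro CollectI conjI ballI allI impI PiE_I)
  fix \<rho> assume \<rho>: "\<rho> \<in> \<sigma>"
  obtain r where "Fin r \<le> cone_val s N \<sigma> R U \<rho>"
    using G_filtration_exhausts[OF U] Fin_le_cone_val[OF \<rho> U] by blast
  then have not_Minf: "cone_val s N \<sigma> R U \<rho> \<noteq> Minf" by auto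
  then show "cone_val s N \<sigma> R U \<rho> \<in> UNIV - {Minf}" by simp
  fix l :: rat assume l: "0 \<le> l" "l = 0 \<longrightarrow> cone_val s N \<sigma> R U \<rho> \<noteq> Pinf"
  have l\<rho>: "s l \<rho> \<in> \<sigma>" using \<rho> l(1) by (rule cone_scale)
  show "cone_val s N \<sigma> R U (s l \<rho>) = map_extended ((*) l) (cone_val s N \<sigma> R U \<rho>)"
  proof (cases "l = 0")
    case True
    then obtain q where q: "cone_val s N \<sigma> R U \<rho> = Fin q"
      using l(2) not_Minf by (cases "cone_val s N \<sigma> R U \<rho>") auto
    \<comment> \<open>The zero vector is excluded because its value at \<open>\<rho>\<close> is infinite.\<close>
    have "U \<noteq> cls \<zero>\<^bsub>R\<^esub>"
    proof
      assume "U = cls \<zero>\<^bsub>R\<^esub>"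
      then have "Fin (q + 1) \<le> cone_val s N \<sigma> R U \<rho>"
        using Fin_le_cone_val[OF \<rho> U] G_filtration_zero by simp
      then show False using q by simp
    qed
    then have "Fin r \<le> cone_val s N \<sigma> R U 0 \<longleftrightarrow> Fin r \<le> Fin 0" for r
      using Fin_le_cone_val[of 0 U] G_filtration_origin[OF U] l\<rho> U True by simp
    then have "cone_val s N \<sigma> R U 0 = Fin 0" by (rule extended_eqI)
    then show ?thesis using True q by simp
  next
    case False
    then show ?thesis
      using l(1) \<rho> l\<rho> U
      by (intro extended_eqI) (simp add: Fin_le_map_mult Fin_le_cone_val G_filtration_scale)
  qed
qed (auto simp: cone_val_def)

lemma cone_val_smult_ge:
  assumes U: "U \<in> carrier (E_space s N \<sigma> R)" and \<rho>: "\<rho> \<in> \<sigma>"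
  shows "cone_val s N \<sigma> R U \<rho> \<le> cone_val s N \<sigma> R (c \<odot>\<^bsub>E_space s N \<sigma> R\<^esub> U) \<rho>"
proof -
  have cU: "c \<odot>\<^bsub>E_space s N \<sigma> R\<^esub> U \<in> carrier (E_space s N \<sigma> R)"
    using module.smult_closed[OF module_E_space _ U] by (simp add: ground_field_simps)
  show ?thesis
    unfolding extended_le_iff_Fin[of "cone_val s N \<sigma> R U \<rho>"]
      Fin_le_cone_val[OF \<rho> U] Fin_le_cone_val[OF \<rho> cU]
    using G_filtration_smult by blast
qed

lemma is_prevalued_space_L_obj: "is_prevalued_space s \<sigma> (L_obj s N \<sigma> R)"
  unfolding is_prevalued_space_def is_prevaluation_def L_obj_simps
proof (intro conjI module_L_obj ballI allI impI)
  interpret E: module ground_field "E_space s N \<sigma> R" by (rule module_E_space)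
  show "cone_val s N \<sigma> R \<in> carrier (E_space s N \<sigma> R) \<rightarrow> pl_functions s \<sigma>"
    using cone_val_pl_functions by blast
  fix U U' \<rho> assume U: "U \<in> carrier (E_space s N \<sigma> R)"
  show "min (cone_val s N \<sigma> R U \<rho>) (cone_val s N \<sigma> R U' \<rho>)
      \<le> cone_val s N \<sigma> R (U \<oplus>\<^bsub>E_space s N \<sigma> R\<^esub> U') \<rho>"
    if U': "U' \<in> carrier (E_space s N \<sigma> R)" and \<rho>: "\<rho> \<in> \<sigma>"
    unfolding extended_le_iff_Fin[of "min _ _"] min.bounded_iff Fin_le_cone_val[OF \<rho> U]
      Fin_le_cone_val[OF \<rho> U'] Fin_le_cone_val[OF \<rho> E.a_closed[OF U U']]
    using G_filtration_add by blast
  fix c :: 'k assume c: "c \<noteq> 0"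
  show "cone_val s N \<sigma> R (c \<odot>\<^bsub>E_space s N \<sigma> R\<^esub> U) = cone_val s N \<sigma> R U"
  proof (rule ext)
    fix \<rho>
    show "cone_val s N \<sigma> R (c \<odot>\<^bsub>E_space s N \<sigma> R\<^esub> U) \<rho> = cone_val s N \<sigma> R U \<rho>"
    proof (cases "\<rho> \<in> \<sigma>")
      case True
      have cU: "c \<odot>\<^bsub>E_space s N \<sigma> R\<^esub> U \<in> carrier (E_space s N \<sigma> R)"
        using U by (simp add: ground_field_simps)
      have "inverse c \<odot>\<^bsub>E_space s N \<sigma> R\<^esub> (c \<odot>\<^bsub>E_space s N \<sigma> R\<^esub> U) = U"
        using E.smult_assoc1[of "inverse c" c U] E.smult_one[OF U] U c by (simp add: ground_field_simps)
      then show ?thesis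
        using cone_val_smult_ge[OF U True, of c] cone_val_smult_ge[OF cU True, of "inverse c"]
        by simp
    qed (simp add: cone_val_def)
  qed
next
  show "cone_val s N \<sigma> R \<zero>\<^bsub>E_space s N \<sigma> R\<^esub> = (\<lambda>\<rho>\<in>\<sigma>. Pinf)"
  proof (rule ext)
    fix \<rho>
    have "cls \<zero>\<^bsub>R\<^esub> \<in> carrier (E_space s N \<sigma> R)" by (simp add: E_space_simps)
    then have "cone_val s N \<sigma> R (cls \<zero>\<^bsub>R\<^esub>) \<rho> = Pinf" if "\<rho> \<in> \<sigma>"
      using that by (intro extended_eqI) (simp add: Fin_le_cone_val G_filtration_zero)
    then show "cone_val s N \<sigma> R \<zero>\<^bsub>E_space s N \<sigma> R\<^esub> \<rho> = (\<lambda>\<rho>\<in>\<sigma>. Pinf) \<rho>"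
      by (simp add: E_space_simps cone_val_def)
  qed
qed

end


section \<open>Induced maps on the quotient spaces\<close>

lemma graded_mapsD:
  assumes "f \<in> graded_maps s N \<sigma> R R'"
  shows "f \<in> linear_maps (cone_algebra s N \<sigma>) R R'"
    and "m \<in> dual_lattice s N \<Longrightarrow> x \<in> grade R m \<Longrightarrow> f x \<in> grade R' m"
  using assms by (auto simp: graded_maps_def)

text \<open>
  The preimage of \<open>mR'\<close> is a submodule of \<open>R\<close> modulo which \<open>\<chi>\<^sub>u\<close> is the identity.
\<close>

lemma graded_maps_mR:
  assumes "graded_cone_module s N \<sigma> R" "graded_cone_module s N \<sigma> R'"
    and f: "f \<in> graded_maps s N \<sigma> R R'" and x: "x \<in> mR s N \<sigma> R"
  shows "f x \<in> mR s N \<sigma> R'"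
proof -
  interpret R: graded_cone_module s N \<sigma> R by fact
  interpret R': graded_cone_module s N \<sigma> R' by fact
  note lin = graded_mapsD(1)[OF f]
  note D = linear_mapsD[OF lin]
  interpret f: abelian_group_hom R R' f
    using lin R.md.module_axioms R'.md.module_axioms by (rule linear_maps_group_hom)
  have "mR s N \<sigma> R \<subseteq> {x \<in> carrier R. f x \<in> mR s N \<sigma> R'}"
  proof (rule R.mR_subset)
    show "submodule {x \<in> carrier R. f x \<in> mR s N \<sigma> R'} R.A R"
      using D(4) submodule.smult_closed[OF R'.mR_submodule]
      by (intro R.md.submodule_vimage[OF f.is_abelian_group_hom R'.mR.a_subgroup]) simp
    fix u x assume u: "u \<in> R.S" and x: "x \<in> carrier R"
    have chi: "chi u \<odot>\<^bsub>R\<^esub> x \<in> carrier R" "f (chi u \<odot>\<^bsub>R\<^esub> x) = chi u \<odot>\<^bsub>R'\<^esub> f x"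
      using R.single_in_cone_algebra[OF u] x by (rule R.md.smult_closed D(4))+
    have "f (chi u \<odot>\<^bsub>R\<^esub> x \<ominus>\<^bsub>R\<^esub> x) = chi u \<odot>\<^bsub>R'\<^esub> f x \<ominus>\<^bsub>R'\<^esub> f x"
      using x chi by (simp add: a_minus_def)
    then show "chi u \<odot>\<^bsub>R\<^esub> x \<ominus>\<^bsub>R\<^esub> x \<in> {x \<in> carrier R. f x \<in> mR s N \<sigma> R'}"
      using R'.chi_minus_id_in_mR[OF u D(2)[OF x]] x chi by simp
  qed
  then show ?thesis using x by blast
qed

lemma L_map_cls:
  assumes "graded_cone_module s N \<sigma> R" "graded_cone_module s N \<sigma> R'"
    and f: "f \<in> graded_maps s N \<sigma> R R'" and x: "x \<in> carrier R"
  shows "L_map s N \<sigma> R R' f (mR s N \<sigma> R +>\<^bsub>R\<^esub> x) = mR s N \<sigma> R' +>\<^bsub>R'\<^esub> f x"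
proof -
  interpret R: graded_cone_module s N \<sigma> R by fact
  interpret R': graded_cone_module s N \<sigma> R' by fact
  note lin = graded_mapsD(1)[OF f]
  note D = linear_mapsD[OF lin]
  interpret f: abelian_group_hom R R' f
    using lin R.md.module_axioms R'.md.module_axioms by (rule linear_maps_group_hom)
  have "R'.cls (f y) = R'.cls (f x)" if y: "y \<in> carrier R" and eq: "R.cls y = R.cls x" for y
  proof (rule R'.cls_eqI)
    have "f (y \<ominus>\<^bsub>R\<^esub> x) \<in> mR s N \<sigma> R'"
      using R.cls_eqD[OF y x eq] by (rule graded_maps_mR[OF assms(1-3)])
    then show "f y \<ominus>\<^bsub>R'\<^esub> f x \<in> mR s N \<sigma> R'" using x y by (simp add: a_minus_def)
  qed (use x y in auto)
  then have "(\<Union>y\<in>R.cls x. R'.cls (f y)) = R'.cls (f x)" by (rule R.UN_cls[OF x])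
  then show ?thesis using x by (simp add: L_map_def R.L_space_simps)
qed

text \<open>
  Graded maps commute with taking components and hence do not enlarge supports; therefore the
  induced map respects the filtrations, which is the inequality between the valuations.
\<close>

lemma L_map_prevalued_maps:
  fixes R :: "('k::field, 'v::ab_group_add, 'a) cone_module" and R' :: "('k, 'v, 'b) cone_module"
  assumes "graded_cone_module s N \<sigma> R" "graded_cone_module s N \<sigma> R'"
    and f: "f \<in> graded_maps s N \<sigma> R R'"
  shows "L_map s N \<sigma> R R' f \<in> prevalued_maps \<sigma> (L_obj s N \<sigma> R) (L_obj s N \<sigma> R')"
proof -
  interpret R: graded_cone_module s N \<sigma> R by fact
  interpret R': graded_cone_module s N \<sigma> R' by fact
  note D = linear_mapsD[OF graded_mapsD(1)[OF f]]
  note [simp] = L_map_cls[OF assms] D(2)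
  have "L_map s N \<sigma> R R' f \<in> linear_maps ground_field (L_obj s N \<sigma> R) (L_obj s N \<sigma> R')"
  proof (rule linear_mapsI)
    show "L_map s N \<sigma> R R' f \<in> carrier (L_obj s N \<sigma> R) \<rightarrow>\<^sub>E carrier (L_obj s N \<sigma> R')"
    proof (rule PiE_I)
      fix U assume "U \<in> carrier (L_obj s N \<sigma> R)"
      then show "L_map s N \<sigma> R R' f U \<in> carrier (L_obj s N \<sigma> R')"
        by (auto simp: R.L_space_simps R'.L_space_simps)
    qed (simp add: L_map_def)
    fix U assume "U \<in> carrier (L_obj s N \<sigma> R)"
    then obtain x where x: "x \<in> carrier R" "U = R.cls x" by (auto simp: R.L_space_simps)
    fix c :: 'k
    have c: "Poly_Mapping.single 0 c \<in> carrier R.A"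
      using R.dual_cone_zero by (rule R.single_in_cone_algebra)
    show "L_map s N \<sigma> R R' f (c \<odot>\<^bsub>L_obj s N \<sigma> R\<^esub> U) = c \<odot>\<^bsub>L_obj s N \<sigma> R'\<^esub> L_map s N \<sigma> R R' f U"
      using x c R.md.smult_closed[OF c x(1)] D(4)[OF c x(1)]
      by (simp add: R.L_space_simps R'.L_space_simps)
    fix U' assume "U' \<in> carrier (L_obj s N \<sigma> R)"
    then obtain y where y: "y \<in> carrier R" "U' = R.cls y" by (auto simp: R.L_space_simps)
    show "L_map s N \<sigma> R R' f (U \<oplus>\<^bsub>L_obj s N \<sigma> R\<^esub> U') =
      L_map s N \<sigma> R R' f U \<oplus>\<^bsub>L_obj s N \<sigma> R'\<^esub> L_map s N \<sigma> R R' f U'"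
      using x y D(3) by (simp add: R.L_space_simps R'.L_space_simps)
  qed
  moreover have "val (L_obj s N \<sigma> R) U \<rho> \<le> val (L_obj s N \<sigma> R') (L_map s N \<sigma> R R' f U) \<rho>"
    if "U \<in> carrier (L_obj s N \<sigma> R)" and \<rho>: "\<rho> \<in> \<sigma>" for U \<rho>
  proof -
    have U: "U \<in> carrier (E_space s N \<sigma> R)" using that(1) by (simp add: R.L_obj_simps)
    then have U': "L_map s N \<sigma> R R' f U \<in> carrier (E_space s N \<sigma> R')"
      by (auto simp: R.E_space_simps R'.E_space_simps)
    have f0: "f \<zero>\<^bsub>R\<^esub> = \<zero>\<^bsub>R'\<^esub>"
      using abelian_group_hom.hom_zero[OF linear_maps_group_hom[OF graded_mapsD(1)[OF f]
            R.md.module_axioms R'.md.module_axioms]] .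
    have "L_map s N \<sigma> R R' f U \<in> G_filtration s N \<sigma> R' \<rho> r"
      if G: "U \<in> G_filtration s N \<sigma> R \<rho> r" for r
    proof -
      obtain x where x: "x \<in> carrier R" "U = R.cls x" "\<forall>m\<in>R.support x. r \<le> m \<rho>"
        using G by (auto simp: R.G_filtration_iff)
      have "R'.support (f x) \<subseteq> R.support x"
        using graded_maps_component[OF assms x(1)] f0 by auto
      then have "\<forall>m\<in>R'.support (f x). r \<le> m \<rho>" using x(3) by blast
      then show ?thesis
        unfolding R'.G_filtration_iff using x D(2)[OF x(1)]
        by (intro bexI[of _ "f x"]) auto
    qed
    then show ?thesis
      unfolding R.L_obj_simps R'.L_obj_simps extended_le_iff_Fin[of "cone_val s N \<sigma> R U \<rho>"]
        R.Fin_le_cone_val[OF \<rho> U] R'.Fin_le_cone_val[OF \<rho> U'] by blast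
  qed
  ultimately show ?thesis by (simp add: prevalued_maps_def)
qed


section \<open>Sublevel spaces of a prevaluation\<close>

locale prevalued_cone_space = toric_cone s N \<sigma>
  for s :: "rat \<Rightarrow> 'v \<Rightarrow> 'v::ab_group_add" and N \<sigma> :: "'v set" +
  fixes E :: "('k::field, 'v, 'e) prevalued_space"
  assumes prevalued: "is_prevalued_space s \<sigma> E"
begin

sublocale E: module ground_field E
  using prevalued by (simp add: is_prevalued_space_def)

lemmas E_smult = E.smult_closed[unfolded ground_field_simps, OF UNIV_I]
  E.smult_r_null[unfolded ground_field_simps, OF UNIV_I]
  E.smult_l_null[unfolded ground_field_simps]
  E.smult_one[unfolded ground_field_simps]

lemmas E_smult_distr = E.smult_l_distr[unfolded ground_field_simps, OF UNIV_I UNIV_I]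
  E.smult_r_distr[unfolded ground_field_simps, OF UNIV_I]

lemmas E_smult_assoc = E.smult_assoc1[unfolded ground_field_simps, OF UNIV_I UNIV_I]

lemma val_zero: "\<rho> \<in> \<sigma> \<Longrightarrow> val E \<zero>\<^bsub>E\<^esub> \<rho> = Pinf"
  using prevalued by (simp add: is_prevalued_space_def is_prevaluation_def)

lemma val_add_ge:
  assumes "\<rho> \<in> \<sigma>" "f \<in> carrier E" "g \<in> carrier E" "a \<le> val E f \<rho>" "a \<le> val E g \<rho>"
  shows "a \<le> val E (f \<oplus>\<^bsub>E\<^esub> g) \<rho>"
proof -
  have "min (val E f \<rho>) (val E g \<rho>) \<le> val E (f \<oplus>\<^bsub>E\<^esub> g) \<rho>"
    using prevalued assms(1-3) by (simp add: is_prevalued_space_def is_prevaluation_def)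
  moreover have "a \<le> min (val E f \<rho>) (val E g \<rho>)" using assms(4,5) by (rule min.boundedI)
  ultimately show ?thesis by (rule order_trans[rotated])
qed

lemma val_smult_ge:
  assumes "\<rho> \<in> \<sigma>" "f \<in> carrier E" "a \<le> val E f \<rho>"
  shows "a \<le> val E (c \<odot>\<^bsub>E\<^esub> f) \<rho>"
proof (cases "c = 0")
  case True
  then show ?thesis using assms by (simp add: E_smult val_zero)
next
  case False
  then show ?thesis
    using prevalued assms by (simp add: is_prevalued_space_def is_prevaluation_def)
qed

lemma val_finsum_ge:
  assumes \<rho>: "\<rho> \<in> \<sigma>"
  shows "y \<in> J \<rightarrow> carrier E \<Longrightarrow> (\<And>j. j \<in> J \<Longrightarrow> a \<le> val E (y j) \<rho>) \<Longrightarrow>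
    a \<le> val E (\<Oplus>\<^bsub>E\<^esub>j\<in>J. y j) \<rho>"
proof (induction J rule: infinite_finite_induct)
  case (insert j J)
  then have y: "y j \<in> carrier E" "y \<in> J \<rightarrow> carrier E" by auto
  have "a \<le> val E (y j \<oplus>\<^bsub>E\<^esub> (\<Oplus>\<^bsub>E\<^esub>j\<in>J. y j)) \<rho>"
    using \<rho> y(1) E.M.finsum_closed[OF y(2)] insert y(2) by (intro val_add_ge) auto
  then show ?case using insert(1,2) y by simp
qed (simp_all add: val_zero[OF \<rho>])

abbreviation "F \<equiv> F_level \<sigma> E"

lemma F_carrier: "f \<in> F m \<Longrightarrow> f \<in> carrier E"
  by (simp add: F_level_def)

lemma F_zero: "\<zero>\<^bsub>E\<^esub> \<in> F m"
  by (simp add: F_level_def val_zero)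

lemma F_add: "f \<in> F m \<Longrightarrow> g \<in> F m \<Longrightarrow> f \<oplus>\<^bsub>E\<^esub> g \<in> F m"
  by (simp add: F_level_def val_add_ge)

lemma F_smult: "f \<in> F m \<Longrightarrow> c \<odot>\<^bsub>E\<^esub> f \<in> F m"
  by (simp add: F_level_def E_smult val_smult_ge)

lemma F_uminus: "f \<in> F m \<Longrightarrow> \<ominus>\<^bsub>E\<^esub> f \<in> F m"
  using F_smult[of f m "\<ominus>\<^bsub>ground_field\<^esub> \<one>\<^bsub>ground_field\<^esub>"]
  by (simp add: E.smult_l_minus F_carrier)

text \<open>
  By the sign convention \<open>u\<close> is nonpositive on the cone, so adding \<open>u\<close> to the bound weakens it.
\<close>

lemma F_mono:
  assumes u: "u \<in> S" and f: "f \<in> F (m - u)"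
  shows "f \<in> F m"
proof -
  have "Fin (m \<rho>) \<le> val E f \<rho>" if \<rho>: "\<rho> \<in> \<sigma>" for \<rho>
  proof -
    have "Fin (m \<rho>) \<le> Fin ((m - u) \<rho>)" using dual_cone_nonpos[OF u \<rho>] by simp
    also have "\<dots> \<le> val E f \<rho>" using f \<rho> by (simp add: F_level_def)
    finally show ?thesis .
  qed
  then show ?thesis using F_carrier[OF f] by (simp add: F_level_def)
qed


section \<open>The graded module of a prevalued space\<close>

abbreviation "RE \<equiv> R_obj s N \<sigma> E"

lemma RE_simps:
  "\<zero>\<^bsub>RE\<^esub> = (\<lambda>m\<in>M. \<zero>\<^bsub>E\<^esub>)"
  "x \<oplus>\<^bsub>RE\<^esub> y = (\<lambda>m\<in>M. x m \<oplus>\<^bsub>E\<^esub> y m)"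
  "p \<odot>\<^bsub>RE\<^esub> x = (\<lambda>m\<in>M. \<Oplus>\<^bsub>E\<^esub>u\<in>Poly_Mapping.keys p. Poly_Mapping.lookup p u \<odot>\<^bsub>E\<^esub> x (m - u))"
  "grade RE m = {x \<in> carrier RE. \<forall>m'\<in>M - {m}. x m' = \<zero>\<^bsub>E\<^esub>}"
  by (simp_all add: R_obj_def)

lemma RE_carrier_iff:
  "x \<in> carrier RE \<longleftrightarrow> x \<in> (\<Pi>\<^sub>E m\<in>M. F m) \<and> finite {m\<in>M. x m \<noteq> \<zero>\<^bsub>E\<^esub>}"
  by (simp add: R_obj_def R_carrier_def)

lemma RE_level: "x \<in> carrier RE \<Longrightarrow> m \<in> M \<Longrightarrow> x m \<in> F m"
  and RE_finite: "x \<in> carrier RE \<Longrightarrow> finite {m\<in>M. x m \<noteq> \<zero>\<^bsub>E\<^esub>}"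
  and RE_outside: "x \<in> carrier RE \<Longrightarrow> m \<notin> M \<Longrightarrow> x m = undefined"
  by (auto simp: RE_carrier_iff PiE_iff extensional_def)

lemma RE_at: "x \<in> carrier RE \<Longrightarrow> m \<in> M \<Longrightarrow> x m \<in> carrier E"
  using RE_level F_carrier by blast

lemma RE_eqI:
  assumes "x \<in> carrier RE" "y \<in> carrier RE" "\<And>m. m \<in> M \<Longrightarrow> x m = y m"
  shows "x = y"
proof (rule ext)
  fix m show "x m = y m"
    using assms(3) RE_outside[OF assms(1)] RE_outside[OF assms(2)] by (cases "m \<in> M") simp_all
qed

lemma RE_restrictI:
  assumes "\<And>m. m \<in> M \<Longrightarrow> y m \<in> F m" "finite J" "\<And>m. m \<in> M \<Longrightarrow> m \<notin> J \<Longrightarrow> y m = \<zero>\<^bsub>E\<^esub>"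
  shows "restrict y M \<in> carrier RE"
proof -
  have "{m\<in>M. restrict y M m \<noteq> \<zero>\<^bsub>E\<^esub>} \<subseteq> J" using assms(3) by auto
  then have "finite {m\<in>M. restrict y M m \<noteq> \<zero>\<^bsub>E\<^esub>}" using assms(2) by (rule finite_subset)
  moreover have "restrict y M \<in> (\<Pi>\<^sub>E m\<in>M. F m)" using assms(1) by simp
  ultimately show ?thesis unfolding RE_carrier_iff by blast
qed

lemma RE_add_closed: "x \<in> carrier RE \<Longrightarrow> y \<in> carrier RE \<Longrightarrow> x \<oplus>\<^bsub>RE\<^esub> y \<in> carrier RE"
  unfolding RE_simps
  by (rule RE_restrictI[where J = "{m\<in>M. x m \<noteq> \<zero>\<^bsub>E\<^esub>} \<union> {m\<in>M. y m \<noteq> \<zero>\<^bsub>E\<^esub>}"])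
     (auto simp: RE_level RE_finite F_add)

lemma RE_zero_closed: "\<zero>\<^bsub>RE\<^esub> \<in> carrier RE"
  unfolding RE_simps by (rule RE_restrictI[where J = "{}"]) (auto simp: F_zero)

lemma abelian_group_RE: "abelian_group RE"
proof (rule abelian_groupI)
  fix x assume x: "x \<in> carrier RE"
  show "\<zero>\<^bsub>RE\<^esub> \<oplus>\<^bsub>RE\<^esub> x = x"
    by (rule RE_eqI) (use x in \<open>simp_all add: RE_add_closed RE_zero_closed\<close>, simp add: RE_simps RE_at)
  show "\<exists>y\<in>carrier RE. y \<oplus>\<^bsub>RE\<^esub> x = \<zero>\<^bsub>RE\<^esub>"
  proof
    show "(\<lambda>m\<in>M. \<ominus>\<^bsub>E\<^esub> x m) \<in> carrier RE"
      using x by (intro RE_restrictI[OF _ RE_finite[OF x]]) (auto simp: RE_level F_uminus)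
    show "(\<lambda>m\<in>M. \<ominus>\<^bsub>E\<^esub> x m) \<oplus>\<^bsub>RE\<^esub> x = \<zero>\<^bsub>RE\<^esub>"
      unfolding RE_simps using x by (intro restrict_ext) (simp add: RE_at E.M.l_neg)
  qed
  fix y assume y: "y \<in> carrier RE"
  show "x \<oplus>\<^bsub>RE\<^esub> y \<in> carrier RE" using x y by (rule RE_add_closed)
  show "x \<oplus>\<^bsub>RE\<^esub> y = y \<oplus>\<^bsub>RE\<^esub> x"
    unfolding RE_simps using x y by (intro restrict_ext) (simp add: RE_at E.M.a_comm)
  fix z assume z: "z \<in> carrier RE"
  show "(x \<oplus>\<^bsub>RE\<^esub> y) \<oplus>\<^bsub>RE\<^esub> z = x \<oplus>\<^bsub>RE\<^esub> (y \<oplus>\<^bsub>RE\<^esub> z)"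
    unfolding RE_simps using x y z by (intro restrict_ext) (simp add: RE_at E.M.a_assoc)
qed (rule RE_zero_closed)

text \<open>
  Sums for different scalars can be compared once they run over a common index set.
\<close>

lemma RE_smult_superset:
  assumes x: "x \<in> carrier RE" and m: "m \<in> M"
    and K: "finite K" "Poly_Mapping.keys p \<subseteq> K" "K \<subseteq> S"
  shows "(p \<odot>\<^bsub>RE\<^esub> x) m = (\<Oplus>\<^bsub>E\<^esub>u\<in>K. Poly_Mapping.lookup p u \<odot>\<^bsub>E\<^esub> x (m - u))"
proof -
  have at: "x (m - u) \<in> carrier E" if "u \<in> K" for u
  proof -
    have "u \<in> M" using that K(3) by blast
    then show ?thesis using RE_at[OF x dual_lattice_diff[OF m]] by blast
  qed
  have "(\<Oplus>\<^bsub>E\<^esub>u\<in>Poly_Mapping.keys p. Poly_Mapping.lookup p u \<odot>\<^bsub>E\<^esub> x (m - u)) =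
      (\<Oplus>\<^bsub>E\<^esub>u\<in>K. Poly_Mapping.lookup p u \<odot>\<^bsub>E\<^esub> x (m - u))"
    using K at by (intro E.M.add.finprod_mono_neutral_cong_left) (auto simp: in_keys_iff E_smult)
  then show ?thesis using m by (simp add: RE_simps)
qed

lemma RE_smult_single:
  assumes x: "x \<in> carrier RE" and u: "u \<in> S" and m: "m \<in> M"
  shows "(Poly_Mapping.single u a \<odot>\<^bsub>RE\<^esub> x) m = a \<odot>\<^bsub>E\<^esub> x (m - u)"
proof -
  have "u \<in> M" using u by blast
  then have "a \<odot>\<^bsub>E\<^esub> x (m - u) \<in> carrier E" using RE_at[OF x dual_lattice_diff[OF m]] E_smult by blast
  then show ?thesis
    using RE_smult_superset[OF x m, of "{u}" "Poly_Mapping.single u a"] u by simp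
qed

lemma RE_smult_add_left:
  assumes x: "x \<in> carrier RE" and p: "Poly_Mapping.keys p \<subseteq> S" and q: "Poly_Mapping.keys q \<subseteq> S"
  shows "(p + q) \<odot>\<^bsub>RE\<^esub> x = p \<odot>\<^bsub>RE\<^esub> x \<oplus>\<^bsub>RE\<^esub> q \<odot>\<^bsub>RE\<^esub> x"
proof (rule ext)
  fix m
  show "((p + q) \<odot>\<^bsub>RE\<^esub> x) m = (p \<odot>\<^bsub>RE\<^esub> x \<oplus>\<^bsub>RE\<^esub> q \<odot>\<^bsub>RE\<^esub> x) m"
  proof (cases "m \<in> M")
    case m: True
    let ?K = "Poly_Mapping.keys p \<union> Poly_Mapping.keys q"
    have K: "finite ?K" "?K \<subseteq> S" "Poly_Mapping.keys (p + q) \<subseteq> ?K" using p q keys_add[of p q] by auto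
    have at: "x (m - u) \<in> carrier E" if "u \<in> ?K" for u
    proof -
      have "u \<in> M" using that K(2) by blast
      then show ?thesis using RE_at[OF x dual_lattice_diff[OF m]] by blast
    qed
    have "((p + q) \<odot>\<^bsub>RE\<^esub> x) m = (\<Oplus>\<^bsub>E\<^esub>u\<in>?K. Poly_Mapping.lookup (p + q) u \<odot>\<^bsub>E\<^esub> x (m - u))"
      using K by (intro RE_smult_superset[OF x m])
    also have "\<dots> = (\<Oplus>\<^bsub>E\<^esub>u\<in>?K. Poly_Mapping.lookup p u \<odot>\<^bsub>E\<^esub> x (m - u) \<oplus>\<^bsub>E\<^esub>
        Poly_Mapping.lookup q u \<odot>\<^bsub>E\<^esub> x (m - u))"
      using at by (intro E.M.finsum_cong') (auto simp: lookup_add E_smult E_smult_distr)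
    also have "\<dots> = (\<Oplus>\<^bsub>E\<^esub>u\<in>?K. Poly_Mapping.lookup p u \<odot>\<^bsub>E\<^esub> x (m - u)) \<oplus>\<^bsub>E\<^esub>
        (\<Oplus>\<^bsub>E\<^esub>u\<in>?K. Poly_Mapping.lookup q u \<odot>\<^bsub>E\<^esub> x (m - u))"
      using at by (intro E.M.finsum_addf) (auto simp: E_smult)
    also have "\<dots> = (p \<odot>\<^bsub>RE\<^esub> x) m \<oplus>\<^bsub>E\<^esub> (q \<odot>\<^bsub>RE\<^esub> x) m"
      using K by (simp only: RE_smult_superset[OF x m K(1) Un_upper1 K(2)]
          RE_smult_superset[OF x m K(1) Un_upper2 K(2)])
    finally show ?thesis using m by (simp add: RE_simps(2))
  qed (simp add: RE_simps)
qed

lemma RE_smult_zero_left: "0 \<odot>\<^bsub>RE\<^esub> x = \<zero>\<^bsub>RE\<^esub>"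
  by (simp add: RE_simps)

lemma RE_smult_closed:
  assumes x: "x \<in> carrier RE" and p: "Poly_Mapping.keys p \<subseteq> S"
  shows "p \<odot>\<^bsub>RE\<^esub> x \<in> carrier RE"
  using p
proof (induction p rule: monomial_induct)
  case (single u a)
  have uM: "u \<in> M" using single by blast
  have "Poly_Mapping.single u a \<odot>\<^bsub>RE\<^esub> x = (\<lambda>m\<in>M. a \<odot>\<^bsub>E\<^esub> x (m - u))"
  proof (rule ext)
    fix m
    show "(Poly_Mapping.single u a \<odot>\<^bsub>RE\<^esub> x) m = (\<lambda>m\<in>M. a \<odot>\<^bsub>E\<^esub> x (m - u)) m"
      using RE_smult_single[OF x single] by (cases "m \<in> M") (simp_all, simp add: RE_simps)
  qed
  also have "\<dots> \<in> carrier RE"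
  proof (rule RE_restrictI)
    show "finite ((+) u ` {m\<in>M. x m \<noteq> \<zero>\<^bsub>E\<^esub>})" using RE_finite[OF x] by (rule finite_imageI)
    fix m assume m: "m \<in> M"
    have mu: "m - u \<in> M" using m uM by (rule dual_lattice_diff)
    show "a \<odot>\<^bsub>E\<^esub> x (m - u) \<in> F m"
      by (rule F_mono[OF single F_smult[OF RE_level[OF x mu]]])
    assume m_notin: "m \<notin> (+) u ` {m\<in>M. x m \<noteq> \<zero>\<^bsub>E\<^esub>}"
    have "x (m - u) = \<zero>\<^bsub>E\<^esub>"
    proof (rule ccontr)
      assume "x (m - u) \<noteq> \<zero>\<^bsub>E\<^esub>"
      then have "u + (m - u) \<in> (+) u ` {m\<in>M. x m \<noteq> \<zero>\<^bsub>E\<^esub>}" using mu by (intro imageI) blast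
      moreover have "u + (m - u) = m" by simp
      ultimately show False using m_notin by (simp only:)
    qed
    then show "a \<odot>\<^bsub>E\<^esub> x (m - u) = \<zero>\<^bsub>E\<^esub>" by (simp add: E_smult)
  qed
  finally show ?case .
next
  case (add p q)
  then show ?case using RE_smult_add_left[OF x] RE_add_closed by simp
qed (simp add: RE_smult_zero_left RE_zero_closed)

lemma RE_smult_add_right:
  assumes x: "x \<in> carrier RE" and y: "y \<in> carrier RE" and p: "Poly_Mapping.keys p \<subseteq> S"
  shows "p \<odot>\<^bsub>RE\<^esub> (x \<oplus>\<^bsub>RE\<^esub> y) = p \<odot>\<^bsub>RE\<^esub> x \<oplus>\<^bsub>RE\<^esub> p \<odot>\<^bsub>RE\<^esub> y"
proof (rule RE_eqI)
  fix m assume m: "m \<in> M"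
  have mu: "m - u \<in> M" if "u \<in> Poly_Mapping.keys p" for u
  proof -
    have "u \<in> M" using that p by blast
    then show ?thesis by (rule dual_lattice_diff[OF m])
  qed
  have "(\<Oplus>\<^bsub>E\<^esub>u\<in>Poly_Mapping.keys p. Poly_Mapping.lookup p u \<odot>\<^bsub>E\<^esub> (x \<oplus>\<^bsub>RE\<^esub> y) (m - u)) =
      (\<Oplus>\<^bsub>E\<^esub>u\<in>Poly_Mapping.keys p. Poly_Mapping.lookup p u \<odot>\<^bsub>E\<^esub> x (m - u) \<oplus>\<^bsub>E\<^esub>
        Poly_Mapping.lookup p u \<odot>\<^bsub>E\<^esub> y (m - u))"
    using mu RE_at[OF x] RE_at[OF y]
    by (intro E.M.finsum_cong') (auto simp: RE_simps(2) E_smult E_smult_distr)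
  also have "\<dots> = (\<Oplus>\<^bsub>E\<^esub>u\<in>Poly_Mapping.keys p. Poly_Mapping.lookup p u \<odot>\<^bsub>E\<^esub> x (m - u)) \<oplus>\<^bsub>E\<^esub>
      (\<Oplus>\<^bsub>E\<^esub>u\<in>Poly_Mapping.keys p. Poly_Mapping.lookup p u \<odot>\<^bsub>E\<^esub> y (m - u))"
    using mu RE_at[OF x] RE_at[OF y] by (intro E.M.finsum_addf) (auto simp: E_smult)
  finally show "(p \<odot>\<^bsub>RE\<^esub> (x \<oplus>\<^bsub>RE\<^esub> y)) m = (p \<odot>\<^bsub>RE\<^esub> x \<oplus>\<^bsub>RE\<^esub> p \<odot>\<^bsub>RE\<^esub> y) m"
    using m by (simp add: RE_simps(2,3))
qed (use assms in \<open>simp_all add: RE_smult_closed RE_add_closed\<close>)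

text \<open>
  Both sides are additive in \<open>p\<close> and in \<open>q\<close>, which leaves monomials. There the law says that two
  successive shifts by \<open>u\<close> and \<open>v\<close> amount to a shift by \<open>u + v\<close>.
\<close>

lemma RE_smult_assoc:
  assumes p: "Poly_Mapping.keys p \<subseteq> S" and q: "Poly_Mapping.keys q \<subseteq> S" and x: "x \<in> carrier RE"
  shows "(p * q) \<odot>\<^bsub>RE\<^esub> x = p \<odot>\<^bsub>RE\<^esub> (q \<odot>\<^bsub>RE\<^esub> x)"
  using p
proof (induction p rule: monomial_induct)
  have mult: "Poly_Mapping.keys (p * q) \<subseteq> S"
    if "Poly_Mapping.keys p \<subseteq> S" "Poly_Mapping.keys q \<subseteq> S" for p q :: "('v \<Rightarrow> rat) \<Rightarrow>\<^sub>0 'k"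
    using monoid.m_closed[of A p q, OF ring.is_monoid[OF cring.axioms(1)[OF cring_cone_algebra]]] that
    by (simp add: cone_algebra_simps)
  {
    case zero
    then show ?case by (simp add: RE_smult_zero_left)
  next
    case (add p1 p2)
    then show ?case
      using x q mult[OF add(1) q] mult[OF add(2) q]
      by (simp add: distrib_right RE_smult_add_left RE_smult_closed)
  next
    case (single u a)
    have ukeys: "Poly_Mapping.keys (Poly_Mapping.single u a) \<subseteq> S" using single by simp
    show ?case
      using q
    proof (induction q rule: monomial_induct)
      case zero
      have "Poly_Mapping.single u a \<odot>\<^bsub>RE\<^esub> \<zero>\<^bsub>RE\<^esub> = \<zero>\<^bsub>RE\<^esub>"
      proof (rule RE_eqI)
        fix m assume m: "m \<in> M"
        have "m - u \<in> M" using m single by (intro dual_lattice_diff) auto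
        then show "(Poly_Mapping.single u a \<odot>\<^bsub>RE\<^esub> \<zero>\<^bsub>RE\<^esub>) m = \<zero>\<^bsub>RE\<^esub> m"
          using RE_smult_single[OF RE_zero_closed single m] m by (simp add: RE_simps(1) E_smult)
      qed (intro RE_smult_closed RE_zero_closed ukeys)+
      then show ?case by (simp add: RE_smult_zero_left)
    next
      case (add q1 q2)
      then show ?case
        using x mult[OF ukeys add(1)] mult[OF ukeys add(2)] ukeys
        by (simp add: distrib_left RE_smult_add_left RE_smult_add_right RE_smult_closed)
    next
      case v: (single v b)
      have vkeys: "Poly_Mapping.keys (Poly_Mapping.single v b) \<subseteq> S" using v by simp
      note uv = dual_cone_add[OF single v]
      have uvkeys: "Poly_Mapping.keys (Poly_Mapping.single (u + v) (a * b)) \<subseteq> S" using uv by simp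
      have "Poly_Mapping.single (u + v) (a * b) \<odot>\<^bsub>RE\<^esub> x =
        Poly_Mapping.single u a \<odot>\<^bsub>RE\<^esub> (Poly_Mapping.single v b \<odot>\<^bsub>RE\<^esub> x)"
      proof (rule RE_eqI)
        fix m assume m: "m \<in> M"
        have mu: "m - u \<in> M" using m single by (intro dual_lattice_diff) auto
        have muv: "m - u - v \<in> M" by (rule dual_lattice_diff[OF mu]) (use v in blast)
        have "(Poly_Mapping.single (u + v) (a * b) \<odot>\<^bsub>RE\<^esub> x) m = (a * b) \<odot>\<^bsub>E\<^esub> x (m - (u + v))"
          using RE_smult_single[OF x uv m] .
        also have "m - (u + v) = m - u - v" by (rule diff_diff_eq[symmetric])
        also have "(a * b) \<odot>\<^bsub>E\<^esub> x (m - u - v) = a \<odot>\<^bsub>E\<^esub> (b \<odot>\<^bsub>E\<^esub> x (m - u - v))"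
          using RE_at[OF x muv] by (rule E_smult_assoc)
        also have "b \<odot>\<^bsub>E\<^esub> x (m - u - v) = (Poly_Mapping.single v b \<odot>\<^bsub>RE\<^esub> x) (m - u)"
          by (rule RE_smult_single[OF x v mu, symmetric])
        also have "a \<odot>\<^bsub>E\<^esub> \<dots> = (Poly_Mapping.single u a \<odot>\<^bsub>RE\<^esub> (Poly_Mapping.single v b \<odot>\<^bsub>RE\<^esub> x)) m"
          by (rule RE_smult_single[OF RE_smult_closed[OF x vkeys] single m, symmetric])
        finally show "(Poly_Mapping.single (u + v) (a * b) \<odot>\<^bsub>RE\<^esub> x) m =
          (Poly_Mapping.single u a \<odot>\<^bsub>RE\<^esub> (Poly_Mapping.single v b \<odot>\<^bsub>RE\<^esub> x)) m" .
      qed (intro RE_smult_closed x ukeys vkeys uvkeys)+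
      then show ?case by (simp add: mult_single)
    qed
  }
qed

lemma module_RE: "module A RE"
proof (rule moduleI[OF cring_cone_algebra abelian_group_RE])
  fix x assume x: "x \<in> carrier RE"
  show "\<one>\<^bsub>A\<^esub> \<odot>\<^bsub>RE\<^esub> x = x"
  proof (rule RE_eqI)
    have "Poly_Mapping.single 0 1 \<odot>\<^bsub>RE\<^esub> x \<in> carrier RE"
      using dual_cone_zero by (intro RE_smult_closed[OF x]) simp
    then show "\<one>\<^bsub>A\<^esub> \<odot>\<^bsub>RE\<^esub> x \<in> carrier RE" by (simp add: cone_algebra_simps)
    fix m assume m: "m \<in> M"
    show "(\<one>\<^bsub>A\<^esub> \<odot>\<^bsub>RE\<^esub> x) m = x m"
      using RE_smult_single[OF x dual_cone_zero m, of 1] RE_at[OF x m]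
      by (simp add: cone_algebra_simps E_smult)
  qed (rule x)
qed (simp_all add: cone_algebra_simps RE_smult_closed RE_smult_add_left RE_smult_add_right RE_smult_assoc)

sublocale RE: module A RE by (rule module_RE)

lemma evaluation_hom: "m \<in> M \<Longrightarrow> abelian_group_hom RE E (\<lambda>x. x m)"
  by (rule abelian_group_hom_additiveI[OF abelian_group_RE E.M.abelian_group_axioms])
     (auto simp: RE_at RE_simps(2))

text \<open>
  A family concentrated in degree \<open>j\<close> contributes to the value at \<open>m\<close> only for \<open>j = m\<close>.
\<close>

lemma RE_finsum_grade:
  assumes J: "finite J" "J \<subseteq> M" and c: "\<And>j. j \<in> J \<Longrightarrow> c j \<in> grade RE j" and m: "m \<in> M"
  shows "(\<Oplus>\<^bsub>RE\<^esub>j\<in>J. c j) m = (if m \<in> J then c m m else \<zero>\<^bsub>E\<^esub>)"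
proof -
  interpret ev: abelian_group_hom RE E "\<lambda>x. x m" using m by (rule evaluation_hom)
  have cRE: "c \<in> J \<rightarrow> carrier RE" using c by (auto simp: RE_simps(4))
  have at: "c j m \<in> carrier E" if "j \<in> J" for j using cRE that m RE_at by blast
  have zero: "c j m = \<zero>\<^bsub>E\<^esub>" if "j \<in> J" "j \<noteq> m" for j using c[OF that(1)] that(2) m by (auto simp: RE_simps(4))
  have "(\<Oplus>\<^bsub>RE\<^esub>j\<in>J. c j) m = (\<Oplus>\<^bsub>E\<^esub>j\<in>J. c j m)" using cRE by (rule ev.hom_finsum)
  also have "\<dots> = (if m \<in> J then c m m else \<zero>\<^bsub>E\<^esub>)"
  proof (cases "m \<in> J")
    case True
    have "(\<Oplus>\<^bsub>E\<^esub>j\<in>J. c j m) = (\<Oplus>\<^bsub>E\<^esub>j\<in>{m}. c j m)"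
      using J True zero at by (intro E.M.add.finprod_mono_neutral_cong_right) auto
    then show ?thesis using True at by simp
  next
    case False
    then show ?thesis using zero by (auto intro!: E.M.add.finprod_one_eqI)
  qed
  finally show ?thesis .
qed

lemma RE_grade_subgroup:
  assumes m: "m \<in> M"
  shows "subgroup (grade RE m) (add_monoid RE)"
proof (rule group.subgroupI[OF RE.M.a_group])
  have "\<zero>\<^bsub>RE\<^esub> \<in> grade RE m" by (simp add: RE_simps(4), simp add: RE_simps(1))
  then show "grade RE m \<noteq> {}" by blast
  fix x assume x: "x \<in> grade RE m"
  have "(\<ominus>\<^bsub>RE\<^esub> x) m' = \<zero>\<^bsub>E\<^esub>" if m': "m' \<in> M - {m}" for m'
  proof -
    interpret ev: abelian_group_hom RE E "\<lambda>x. x m'" using m' by (intro evaluation_hom) blast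
    show ?thesis using x m' ev.hom_a_inv[of x] by (simp add: RE_simps(4))
  qed
  then show "inv\<^bsub>add_monoid RE\<^esub> x \<in> grade RE m"
    unfolding a_inv_def[symmetric] using x by (simp add: RE_simps(4))
  fix y assume y: "y \<in> grade RE m"
  show "x \<otimes>\<^bsub>add_monoid RE\<^esub> y \<in> grade RE m"
    using x y by (auto simp: RE_simps(2,4) RE_add_closed[unfolded RE_simps])
qed (simp add: RE_simps(4))

text \<open>
  The homogeneous parts of a family \<open>x\<close> are its members \<open>x m\<close>, each extended by zero to a
  family concentrated in degree \<open>m\<close>.
\<close>

lemma is_graded_module_RE: "is_graded_module s N \<sigma> RE"
  unfolding is_graded_module_def
proof (intro conjI ballI allI module_RE RE_grade_subgroup)
  fix x assume x: "x \<in> carrier RE"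
  define d where "d = (\<lambda>m\<in>M. \<lambda>m'\<in>M. if m' = m then x m else \<zero>\<^bsub>E\<^esub>)"
  have d_grade: "d m \<in> grade RE m" if m: "m \<in> M" for m
  proof -
    have "d m \<in> carrier RE"
      unfolding d_def restrict_apply'[OF m]
      by (rule RE_restrictI[where J = "{m}"]) (auto simp: RE_level[OF x m] F_zero)
    then show ?thesis unfolding RE_simps(4) using m by (auto simp: d_def)
  qed
  have d_zero_iff: "d m = \<zero>\<^bsub>RE\<^esub> \<longleftrightarrow> x m = \<zero>\<^bsub>E\<^esub>" if m: "m \<in> M" for m
  proof
    assume "d m = \<zero>\<^bsub>RE\<^esub>"
    from fun_cong[OF this, of m] show "x m = \<zero>\<^bsub>E\<^esub>" using m by (simp add: d_def RE_simps(1))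
  qed (use m in \<open>auto simp: d_def RE_simps(1)\<close>)
  show "\<exists>!c. c \<in> (\<Pi>\<^sub>E m\<in>M. grade RE m) \<and> finite {m\<in>M. c m \<noteq> \<zero>\<^bsub>RE\<^esub>} \<and>
      x = (\<Oplus>\<^bsub>RE\<^esub>m\<in>{m\<in>M. c m \<noteq> \<zero>\<^bsub>RE\<^esub>}. c m)"
  proof (rule ex1I[of _ d], intro conjI)
    let ?J = "{m\<in>M. d m \<noteq> \<zero>\<^bsub>RE\<^esub>}"
    show "d \<in> (\<Pi>\<^sub>E m\<in>M. grade RE m)"
      using d_grade by (intro PiE_I) (auto simp: d_def)
    have "?J = {m\<in>M. x m \<noteq> \<zero>\<^bsub>E\<^esub>}" using d_zero_iff by blast
    then show fin: "finite ?J" using RE_finite[OF x] by simp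
    have dRE: "d \<in> ?J \<rightarrow> carrier RE" using d_grade by (auto simp: RE_simps(4))
    show "x = (\<Oplus>\<^bsub>RE\<^esub>m\<in>?J. d m)"
    proof (rule RE_eqI[OF x RE.M.finsum_closed[OF dRE]])
      fix m assume m: "m \<in> M"
      have "(\<Oplus>\<^bsub>RE\<^esub>m\<in>?J. d m) m = (if m \<in> ?J then d m m else \<zero>\<^bsub>E\<^esub>)"
        using fin d_grade m by (intro RE_finsum_grade) auto
      then show "x m = (\<Oplus>\<^bsub>RE\<^esub>m\<in>?J. d m) m"
        using m d_zero_iff[OF m] by (auto simp: d_def)
    qed
  next
    fix c assume "c \<in> (\<Pi>\<^sub>E m\<in>M. grade RE m) \<and> finite {m\<in>M. c m \<noteq> \<zero>\<^bsub>RE\<^esub>} \<and>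
      x = (\<Oplus>\<^bsub>RE\<^esub>m\<in>{m\<in>M. c m \<noteq> \<zero>\<^bsub>RE\<^esub>}. c m)"
    then have c: "c \<in> (\<Pi>\<^sub>E m\<in>M. grade RE m)" and fin: "finite {m\<in>M. c m \<noteq> \<zero>\<^bsub>RE\<^esub>}"
      and sum: "x = (\<Oplus>\<^bsub>RE\<^esub>m\<in>{m\<in>M. c m \<noteq> \<zero>\<^bsub>RE\<^esub>}. c m)" by blast+
    have cm: "c m \<in> grade RE m" if "m \<in> M" for m using c that by blast
    show "c = d"
    proof (rule ext)
      fix m
      show "c m = d m"
      proof (cases "m \<in> M")
        case m: True
        have carr: "c m \<in> carrier RE" "d m \<in> carrier RE"
          using cm[OF m] d_grade[OF m] by (simp_all add: RE_simps(4))
        show ?thesis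
        proof (rule RE_eqI[OF carr])
          fix m' assume m': "m' \<in> M"
          show "c m m' = d m m'"
          proof (cases "m' = m")
            case True
            have "x m = (if m \<in> {m\<in>M. c m \<noteq> \<zero>\<^bsub>RE\<^esub>} then c m m else \<zero>\<^bsub>E\<^esub>)"
              unfolding sum using fin cm m by (intro RE_finsum_grade) auto
            then have "x m = c m m" using m by (auto simp: RE_simps(1) split: if_splits)
            then show ?thesis using True m by (simp add: d_def)
          next
            case False
            then show ?thesis using cm[OF m] d_grade[OF m] m' by (simp add: RE_simps(4))
          qed
        qed
      next
        case False
        then show ?thesis using c by (auto simp: d_def PiE_iff extensional_def)
      qed
    qed
  qed
next
  fix u a m x assume u: "u \<in> S" and m: "m \<in> M" and x: "x \<in> grade RE m"
  have xRE: "x \<in> carrier RE" using x by (simp add: RE_simps(4))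
  have "(Poly_Mapping.single u a \<odot>\<^bsub>RE\<^esub> x) m' = \<zero>\<^bsub>E\<^esub>" if m': "m' \<in> M - {u + m}" for m'
  proof -
    have "m' \<in> M" "u \<in> M" using m' u by blast+
    then have "m' - u \<in> M" by (rule dual_lattice_diff)
    moreover have "m' - u \<noteq> m"
    proof
      assume "m' - u = m"
      then have "m' = u + m" by (simp add: algebra_simps)
      then show False using m' by blast
    qed
    ultimately have "x (m' - u) = \<zero>\<^bsub>E\<^esub>" using x by (simp add: RE_simps(4))
    then show ?thesis using RE_smult_single[OF xRE u \<open>m' \<in> M\<close>] by (simp add: E_smult)
  qed
  moreover have "Poly_Mapping.single u a \<odot>\<^bsub>RE\<^esub> x \<in> carrier RE"
    using xRE single_in_cone_algebra[OF u] by (intro RE.smult_closed)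
  ultimately show "Poly_Mapping.single u a \<odot>\<^bsub>RE\<^esub> x \<in> grade RE (u + m)" by (simp add: RE_simps(4))
qed


section \<open>Summing a family\<close>

text \<open>
  The canonical map from the direct sum of the \<open>F\<^sub>m\<close> to \<open>E\<close>; it induces the counit of the adjunction.
\<close>

definition "family_sum y = (\<Oplus>\<^bsub>E\<^esub>m\<in>{m\<in>M. y m \<noteq> \<zero>\<^bsub>E\<^esub>}. y m)"

lemma family_sum_superset:
  assumes y: "y \<in> carrier RE" and J: "finite J" "J \<subseteq> M" "{m\<in>M. y m \<noteq> \<zero>\<^bsub>E\<^esub>} \<subseteq> J"
  shows "family_sum y = (\<Oplus>\<^bsub>E\<^esub>m\<in>J. y m)"
  unfolding family_sum_def using J RE_at[OF y]
  by (intro E.M.add.finprod_mono_neutral_cong_left) auto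

lemma family_sum_hom: "abelian_group_hom RE E family_sum"
proof (rule abelian_group_hom_additiveI[OF abelian_group_RE E.M.abelian_group_axioms])
  show "family_sum \<in> carrier RE \<rightarrow> carrier E"
    unfolding family_sum_def by (auto intro!: E.M.finsum_closed simp: RE_at)
  fix x y assume x: "x \<in> carrier RE" and y: "y \<in> carrier RE"
  let ?J = "{m\<in>M. x m \<noteq> \<zero>\<^bsub>E\<^esub>} \<union> {m\<in>M. y m \<noteq> \<zero>\<^bsub>E\<^esub>}"
  have J: "finite ?J" "?J \<subseteq> M" using RE_finite x y by auto
  have "{m\<in>M. (x \<oplus>\<^bsub>RE\<^esub> y) m \<noteq> \<zero>\<^bsub>E\<^esub>} \<subseteq> ?J" by (auto simp: RE_simps(2))
  then have "family_sum (x \<oplus>\<^bsub>RE\<^esub> y) = (\<Oplus>\<^bsub>E\<^esub>m\<in>?J. (x \<oplus>\<^bsub>RE\<^esub> y) m)"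
    using x y J by (intro family_sum_superset) (auto simp: RE_add_closed)
  also have "\<dots> = (\<Oplus>\<^bsub>E\<^esub>m\<in>?J. x m \<oplus>\<^bsub>E\<^esub> y m)"
    using RE_at[OF x] RE_at[OF y] by (intro E.M.finsum_cong') (auto simp: RE_simps(2))
  also have "\<dots> = (\<Oplus>\<^bsub>E\<^esub>m\<in>?J. x m) \<oplus>\<^bsub>E\<^esub> (\<Oplus>\<^bsub>E\<^esub>m\<in>?J. y m)"
    using RE_at[OF x] RE_at[OF y] by (intro E.M.finsum_addf) auto
  also have "\<dots> = family_sum x \<oplus>\<^bsub>E\<^esub> family_sum y"
    using family_sum_superset[OF x J] family_sum_superset[OF y J] by simp
  finally show "family_sum (x \<oplus>\<^bsub>RE\<^esub> y) = family_sum x \<oplus>\<^bsub>E\<^esub> family_sum y" .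
qed

sublocale family_sum: abelian_group_hom RE E family_sum by (rule family_sum_hom)

lemma family_sum_grade:
  assumes y: "y \<in> grade RE m" and m: "m \<in> M"
  shows "family_sum y = y m"
proof -
  have yRE: "y \<in> carrier RE" using y by (simp add: RE_simps(4))
  have "family_sum y = (\<Oplus>\<^bsub>E\<^esub>m\<in>{m}. y m)"
    using y m by (intro family_sum_superset[OF yRE]) (auto simp: RE_simps(4))
  then show ?thesis using RE_at[OF yRE m] by simp
qed

text \<open>
  The monomial moves the members of \<open>y\<close> to other degrees, and their sum in \<open>E\<close> does not depend on
  the degrees; only the coefficient \<open>a\<close> survives.
\<close>

lemma family_sum_single_smult:
  assumes y: "y \<in> carrier RE" and u: "u \<in> S"
  shows "family_sum (Poly_Mapping.single u a \<odot>\<^bsub>RE\<^esub> y) = a \<odot>\<^bsub>E\<^esub> family_sum y"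
proof -
  let ?J = "{m\<in>M. y m \<noteq> \<zero>\<^bsub>E\<^esub>}"
  have uM: "u \<in> M" using u by blast
  have uJ: "(+) u ` ?J \<subseteq> M"
  proof
    fix m assume "m \<in> (+) u ` ?J"
    then obtain m' where "m' \<in> M" "m = u + m'" by blast
    then show "m \<in> M" using uM dual_lattice_add by simp
  qed
  have ay: "Poly_Mapping.single u a \<odot>\<^bsub>RE\<^esub> y \<in> carrier RE"
    using y single_in_cone_algebra[OF u] by (intro RE.smult_closed)
  have "family_sum (Poly_Mapping.single u a \<odot>\<^bsub>RE\<^esub> y) =
      (\<Oplus>\<^bsub>E\<^esub>m\<in>(+) u ` ?J. (Poly_Mapping.single u a \<odot>\<^bsub>RE\<^esub> y) m)"
  proof (rule family_sum_superset[OF ay _ uJ])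
    show "finite ((+) u ` ?J)" using RE_finite[OF y] by (rule finite_imageI)
    show "{m\<in>M. (Poly_Mapping.single u a \<odot>\<^bsub>RE\<^esub> y) m \<noteq> \<zero>\<^bsub>E\<^esub>} \<subseteq> (+) u ` ?J"
    proof
      fix m assume "m \<in> {m\<in>M. (Poly_Mapping.single u a \<odot>\<^bsub>RE\<^esub> y) m \<noteq> \<zero>\<^bsub>E\<^esub>}"
      then have m: "m \<in> M" and ne: "(Poly_Mapping.single u a \<odot>\<^bsub>RE\<^esub> y) m \<noteq> \<zero>\<^bsub>E\<^esub>" by blast+
      have "m - u \<in> M" using m uM by (rule dual_lattice_diff)
      moreover have "y (m - u) \<noteq> \<zero>\<^bsub>E\<^esub>"
        using ne unfolding RE_smult_single[OF y u m] by (auto simp: E_smult)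
      ultimately have "u + (m - u) \<in> (+) u ` ?J" by (intro imageI) blast
      moreover have "u + (m - u) = m" by simp
      ultimately show "m \<in> (+) u ` ?J" by (simp only:)
    qed
  qed
  also have "\<dots> = (\<Oplus>\<^bsub>E\<^esub>m\<in>?J. (Poly_Mapping.single u a \<odot>\<^bsub>RE\<^esub> y) (u + m))"
  proof (rule E.M.finsum_reindex)
    show "Poly_Mapping.single u a \<odot>\<^bsub>RE\<^esub> y \<in> (+) u ` ?J \<rightarrow> carrier E"
      using uJ RE_at[OF ay] by blast
  qed (rule inj_onI, rule add_left_imp_eq)
  also have "\<dots> = (\<Oplus>\<^bsub>E\<^esub>m\<in>?J. a \<odot>\<^bsub>E\<^esub> y m)"
  proof (rule E.M.finsum_cong')
    show "(\<lambda>m. a \<odot>\<^bsub>E\<^esub> y m) \<in> ?J \<rightarrow> carrier E" using RE_at[OF y] by (auto simp: E_smult)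
    fix m assume "m \<in> ?J"
    then have "u + m \<in> M" using uM by (intro dual_lattice_add) auto
    then show "(Poly_Mapping.single u a \<odot>\<^bsub>RE\<^esub> y) (u + m) = a \<odot>\<^bsub>E\<^esub> y m"
      using RE_smult_single[OF y u] by simp
  qed simp
  also have "\<dots> = a \<odot>\<^bsub>E\<^esub> family_sum y"
    unfolding family_sum_def using RE_finite[OF y] RE_at[OF y]
    by (intro E.finsum_smult_ldistr[symmetric]) (auto simp: ground_field_simps)
  finally show ?thesis .
qed

text \<open>
  As \<open>p\<close> acts on sums of families through the scalar \<open>\<Sum>\<^sub>u p\<^sub>u\<close>, the families with zero sum form a
  submodule.
\<close>

lemma family_sum_smult_eq_zero:
  assumes y: "y \<in> carrier RE" and p: "p \<in> carrier A" and zero: "family_sum y = \<zero>\<^bsub>E\<^esub>"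
  shows "family_sum (p \<odot>\<^bsub>RE\<^esub> y) = \<zero>\<^bsub>E\<^esub>"
proof -
  have "Poly_Mapping.keys p \<subseteq> S" using p by (simp add: cone_algebra_simps)
  then show ?thesis
  proof (induction p rule: monomial_induct)
    case zero
    then show ?case by (simp add: RE_smult_zero_left)
  next
    case (single u a)
    then show ?case using zero family_sum_single_smult[OF y single] by (simp add: E_smult)
  next
    case (add p q)
    then show ?case by (simp add: RE_smult_add_left[OF y] RE_smult_closed[OF y])
  qed
qed

lemma val_family_sum_ge:
  assumes y: "y \<in> carrier RE" and \<rho>: "\<rho> \<in> \<sigma>"
    and r: "\<And>m. m \<in> M \<Longrightarrow> y m \<noteq> \<zero>\<^bsub>E\<^esub> \<Longrightarrow> r \<le> m \<rho>"
  shows "Fin r \<le> val E (family_sum y) \<rho>"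
  unfolding family_sum_def
proof (rule val_finsum_ge[OF \<rho>])
  fix m assume "m \<in> {m\<in>M. y m \<noteq> \<zero>\<^bsub>E\<^esub>}"
  then have m: "m \<in> M" "r \<le> m \<rho>" using r by blast+
  have "Fin r \<le> Fin (m \<rho>)" using m(2) by simp
  also have "\<dots> \<le> val E (y m) \<rho>" using RE_level[OF y m(1)] \<rho> by (simp add: F_level_def)
  finally show "Fin r \<le> val E (y m) \<rho>" .
qed (use RE_at[OF y] in auto)

end


section \<open>Induced maps on the families\<close>

lemma prevalued_mapsD:
  assumes "f \<in> prevalued_maps \<sigma> E D"
  shows "f \<in> linear_maps ground_field E D"
    and "x \<in> carrier E \<Longrightarrow> \<rho> \<in> \<sigma> \<Longrightarrow> val E x \<rho> \<le> val D (f x) \<rho>"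
  using assms by (auto simp: prevalued_maps_def)

lemma prevalued_maps_F_level:
  assumes f: "f \<in> prevalued_maps \<sigma> E D" and x: "x \<in> F_level \<sigma> E m"
  shows "f x \<in> F_level \<sigma> D m"
proof -
  have xE: "x \<in> carrier E" using x by (simp add: F_level_def)
  have "Fin (m \<rho>) \<le> val D (f x) \<rho>" if \<rho>: "\<rho> \<in> \<sigma>" for \<rho>
  proof -
    have "Fin (m \<rho>) \<le> val E x \<rho>" using x \<rho> by (simp add: F_level_def)
    also have "\<dots> \<le> val D (f x) \<rho>" using prevalued_mapsD(2)[OF f xE \<rho>] .
    finally show ?thesis .
  qed
  then show ?thesis
    using linear_mapsD(2)[OF prevalued_mapsD(1)[OF f] xE] by (simp add: F_level_def)
qed

lemma R_map_graded_maps: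
  assumes "prevalued_cone_space s N \<sigma> E" "prevalued_cone_space s N \<sigma> D"
    and f: "f \<in> prevalued_maps \<sigma> E D"
  shows "R_map s N \<sigma> E D f \<in> graded_maps s N \<sigma> (R_obj s N \<sigma> E) (R_obj s N \<sigma> D)"
proof -
  interpret E: prevalued_cone_space s N \<sigma> E by fact
  interpret D: prevalued_cone_space s N \<sigma> D by fact
  note lin = prevalued_mapsD(1)[OF f]
  note L = linear_mapsD[OF lin]
  interpret f: abelian_group_hom E D f
    using lin E.E.module_axioms D.E.module_axioms by (rule linear_maps_group_hom)
  have at: "R_map s N \<sigma> E D f x = (\<lambda>m\<in>E.M. f (x m))" if "x \<in> carrier E.RE" for x
    using that by (simp add: R_map_def R_obj_def)
  have closed: "R_map s N \<sigma> E D f x \<in> carrier D.RE" if x: "x \<in> carrier E.RE" for x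
    unfolding at[OF x]
    by (rule D.RE_restrictI[OF _ E.RE_finite[OF x]])
       (use E.RE_level[OF x] prevalued_maps_F_level[OF f] in auto)
  have "R_map s N \<sigma> E D f \<in> linear_maps E.A E.RE D.RE"
  proof (rule E.linear_mapsI_monomials[OF E.module_RE D.module_RE])
    show "R_map s N \<sigma> E D f \<in> carrier E.RE \<rightarrow>\<^sub>E carrier D.RE"
      using closed by (intro PiE_I) (simp_all add: R_map_def R_obj_def)
    fix x assume x: "x \<in> carrier E.RE"
    {
      fix y assume y: "y \<in> carrier E.RE"
      show "R_map s N \<sigma> E D f (x \<oplus>\<^bsub>E.RE\<^esub> y) = R_map s N \<sigma> E D f x \<oplus>\<^bsub>D.RE\<^esub> R_map s N \<sigma> E D f y"
      proof (rule D.RE_eqI)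
        fix m assume m: "m \<in> E.M"
        then show "R_map s N \<sigma> E D f (x \<oplus>\<^bsub>E.RE\<^esub> y) m =
          (R_map s N \<sigma> E D f x \<oplus>\<^bsub>D.RE\<^esub> R_map s N \<sigma> E D f y) m"
          using E.RE_at[OF x m] E.RE_at[OF y m]
          unfolding at[OF x] at[OF y] at[OF E.RE_add_closed[OF x y]]
          by (simp add: E.RE_simps(2) D.RE_simps(2))
      qed (intro closed D.RE_add_closed E.RE_add_closed x y)+
    }
    fix u a assume u: "u \<in> E.S"
    have ax: "Poly_Mapping.single u a \<odot>\<^bsub>E.RE\<^esub> x \<in> carrier E.RE"
      using x E.single_in_cone_algebra[OF u] by (intro E.RE.smult_closed)
    show "R_map s N \<sigma> E D f (Poly_Mapping.single u a \<odot>\<^bsub>E.RE\<^esub> x) =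
      Poly_Mapping.single u a \<odot>\<^bsub>D.RE\<^esub> R_map s N \<sigma> E D f x"
    proof (rule D.RE_eqI[OF closed[OF ax]])
      show "Poly_Mapping.single u a \<odot>\<^bsub>D.RE\<^esub> R_map s N \<sigma> E D f x \<in> carrier D.RE"
        using closed[OF x] E.single_in_cone_algebra[OF u] by (intro D.RE.smult_closed)
      fix m assume m: "m \<in> E.M"
      have mu: "m - u \<in> E.M" using m u by (intro E.dual_lattice_diff) auto
      have "f (a \<odot>\<^bsub>E\<^esub> x (m - u)) = a \<odot>\<^bsub>D\<^esub> f (x (m - u))"
        using L(4)[of a] E.RE_at[OF x mu] by (simp add: ground_field_simps)
      then show "R_map s N \<sigma> E D f (Poly_Mapping.single u a \<odot>\<^bsub>E.RE\<^esub> x) m =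
        (Poly_Mapping.single u a \<odot>\<^bsub>D.RE\<^esub> R_map s N \<sigma> E D f x) m"
        unfolding D.RE_smult_single[OF closed[OF x] u m]
        unfolding at[OF x] at[OF ax]
        using m mu E.RE_smult_single[OF x u m] by simp
    qed
  qed
  moreover have "R_map s N \<sigma> E D f x \<in> grade D.RE m" if "m \<in> E.M" "x \<in> grade E.RE m" for m x
    using that closed at by (auto simp: D.RE_simps(4) E.RE_simps(4))
  ultimately show ?thesis by (auto simp: graded_maps_def)
qed


section \<open>The adjunction\<close>

text \<open>
  The transpose of \<open>h\<close>. Equivalently, the unit \<open>x \<mapsto> ([x\<^sub>m])\<^sub>m\<close> followed by \<open>h\<close> in every degree.
\<close>

definition adjunct ::
  "(rat \<Rightarrow> 'v \<Rightarrow> 'v) \<Rightarrow> ('v::ab_group_add) set \<Rightarrow> 'v set \<Rightarrow> ('k::field, 'v, 'a) cone_module \<Rightarrow>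
   ('a set \<Rightarrow> 'e) \<Rightarrow> 'a \<Rightarrow> ('v \<Rightarrow> rat) \<Rightarrow> 'e" where
  "adjunct s N \<sigma> R h = (\<lambda>x\<in>carrier R. \<lambda>m\<in>dual_lattice s N.
     h (mR s N \<sigma> R +>\<^bsub>R\<^esub> graded_component s N R x m))"

locale adjunction_pair =
  graded_cone_module s N \<sigma> R + prevalued_cone_space s N \<sigma> E
  for s :: "rat \<Rightarrow> 'v \<Rightarrow> 'v::ab_group_add" and N \<sigma> :: "'v set"
    and R :: "('k::field, 'v, 'a) cone_module" and E :: "('k, 'v, 'e) prevalued_space"
begin

abbreviation "L_R \<equiv> L_obj s N \<sigma> R"

text \<open>
  The inverse transpose. The choice of a representative is immaterial by \<open>coadjunct_cls\<close>.
\<close>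

definition coadjunct :: "('a \<Rightarrow> ('v \<Rightarrow> rat) \<Rightarrow> 'e) \<Rightarrow> 'a set \<Rightarrow> 'e" where
  "coadjunct g = (\<lambda>U\<in>carrier L_R. family_sum (g (SOME x. x \<in> carrier R \<and> cls x = U)))"

lemma prevalued_map_cls_hom:
  assumes h: "h \<in> prevalued_maps \<sigma> L_R E"
  shows "abelian_group_hom R E (\<lambda>x. h (cls x))"
proof -
  note L = linear_mapsD[OF prevalued_mapsD(1)[OF h]]
  show ?thesis
  proof (rule abelian_group_hom_additiveI[OF md.M.abelian_group_axioms E.M.abelian_group_axioms])
    show "(\<lambda>x. h (cls x)) \<in> carrier R \<rightarrow> carrier E" using L(2) by (auto simp: L_space_simps)
    fix x y assume x: "x \<in> carrier R" and y: "y \<in> carrier R"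
    show "h (cls (x \<oplus>\<^bsub>R\<^esub> y)) = h (cls x) \<oplus>\<^bsub>E\<^esub> h (cls y)"
      using L(3)[of "cls x" "cls y"] x y by (simp add: L_space_simps)
  qed
qed

lemma prevalued_map_cls_single:
  assumes h: "h \<in> prevalued_maps \<sigma> L_R E" and u: "u \<in> S" and x: "x \<in> carrier R"
  shows "h (cls (Poly_Mapping.single u a \<odot>\<^bsub>R\<^esub> x)) = a \<odot>\<^bsub>E\<^esub> h (cls x)"
  using linear_mapsD(4)[OF prevalued_mapsD(1)[OF h], of a "cls x"] x
  unfolding cls_single[OF u x] by (simp add: L_space_simps ground_field_simps)

text \<open>
  Already in \<open>E\<^sub>R\<close> the class of an element of degree \<open>m\<close> has value at least \<open>m\<close>, and \<open>h\<close> does not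
  decrease values.
\<close>

lemma prevalued_map_cls_level:
  assumes h: "h \<in> prevalued_maps \<sigma> L_R E" and m: "m \<in> M" and x: "x \<in> grade R m"
  shows "h (cls x) \<in> F m"
proof (rule prevalued_maps_F_level[OF h])
  have xR: "x \<in> carrier R" using m x by (rule grade_carrier)
  have "support x \<subseteq> {m}" using component_of_grade[OF x m] by (auto split: if_splits)
  then have "cls x \<in> G_filtration s N \<sigma> R \<rho> (m \<rho>)" for \<rho>
    unfolding G_filtration_iff using xR by (intro bexI[of _ x]) auto
  moreover have "cls x \<in> carrier (E_space s N \<sigma> R)" using xR by (simp add: E_space_simps)
  ultimately show "cls x \<in> F_level \<sigma> L_R m"
    using Fin_le_cone_val by (simp add: F_level_def L_obj_simps)
qed

lemma adjunct_at:
  "x \<in> carrier R \<Longrightarrow> m \<in> M \<Longrightarrow> adjunct s N \<sigma> R h x m = h (cls (component x m))"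
  by (simp add: adjunct_def)

lemma adjunct_closed:
  assumes h: "h \<in> prevalued_maps \<sigma> L_R E" and x: "x \<in> carrier R"
  shows "adjunct s N \<sigma> R h x \<in> carrier RE"
proof -
  interpret hc: abelian_group_hom R E "\<lambda>x. h (cls x)" using h by (rule prevalued_map_cls_hom)
  have "(\<lambda>m\<in>M. h (cls (component x m))) \<in> carrier RE"
  proof (rule RE_restrictI[OF _ finite_support[OF x]])
    fix m assume m: "m \<in> M"
    show "h (cls (component x m)) \<in> F m"
      by (rule prevalued_map_cls_level[OF h m component_grade[OF x m]])
    assume "m \<notin> support x"
    then have "component x m = \<zero>\<^bsub>R\<^esub>" using m by blast
    then show "h (cls (component x m)) = \<zero>\<^bsub>E\<^esub>" using hc.hom_zero by simp
  qed
  then show ?thesis using x by (simp add: adjunct_def)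
qed

lemma adjunct_graded_maps:
  assumes h: "h \<in> prevalued_maps \<sigma> L_R E"
  shows "adjunct s N \<sigma> R h \<in> graded_maps s N \<sigma> R RE"
proof -
  interpret hc: abelian_group_hom R E "\<lambda>x. h (cls x)" using h by (rule prevalued_map_cls_hom)
  note closed = adjunct_closed[OF h]
  have "adjunct s N \<sigma> R h \<in> linear_maps A R RE"
  proof (rule linear_mapsI_monomials[OF md.module_axioms module_RE])
    show "adjunct s N \<sigma> R h \<in> carrier R \<rightarrow>\<^sub>E carrier RE"
      using closed by (intro PiE_I) (simp_all add: adjunct_def)
    fix x assume x: "x \<in> carrier R"
    {
      fix y assume y: "y \<in> carrier R"
      show "adjunct s N \<sigma> R h (x \<oplus>\<^bsub>R\<^esub> y) = adjunct s N \<sigma> R h x \<oplus>\<^bsub>RE\<^esub> adjunct s N \<sigma> R h y"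
      proof (rule RE_eqI)
        fix m assume m: "m \<in> M"
        have "h (cls (component (x \<oplus>\<^bsub>R\<^esub> y) m)) = h (cls (component x m)) \<oplus>\<^bsub>E\<^esub> h (cls (component y m))"
          unfolding component_add[OF x y m]
          by (rule hc.hom_add[OF component_carrier[OF x m] component_carrier[OF y m]])
        then show "adjunct s N \<sigma> R h (x \<oplus>\<^bsub>R\<^esub> y) m =
          (adjunct s N \<sigma> R h x \<oplus>\<^bsub>RE\<^esub> adjunct s N \<sigma> R h y) m"
          using x y m by (simp add: adjunct_at RE_simps(2))
      qed (intro closed RE_add_closed md.M.a_closed x y)+
    }
    fix u and a :: 'k assume u: "u \<in> S"
    have a: "Poly_Mapping.single u a \<in> carrier A" using u by (rule single_in_cone_algebra)
    have ax: "Poly_Mapping.single u a \<odot>\<^bsub>R\<^esub> x \<in> carrier R" using a x by (rule md.smult_closed)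
    show "adjunct s N \<sigma> R h (Poly_Mapping.single u a \<odot>\<^bsub>R\<^esub> x) =
      Poly_Mapping.single u a \<odot>\<^bsub>RE\<^esub> adjunct s N \<sigma> R h x"
    proof (rule RE_eqI[OF closed[OF ax] RE.smult_closed[OF a closed[OF x]]])
      fix m assume m: "m \<in> M"
      have mu: "m - u \<in> M" using u by (intro dual_lattice_diff[OF m]) blast
      show "adjunct s N \<sigma> R h (Poly_Mapping.single u a \<odot>\<^bsub>R\<^esub> x) m =
        (Poly_Mapping.single u a \<odot>\<^bsub>RE\<^esub> adjunct s N \<sigma> R h x) m"
        unfolding RE_smult_single[OF closed[OF x] u m] adjunct_at[OF x mu] adjunct_at[OF ax m]
          component_single_smult[OF x u m]
        by (rule prevalued_map_cls_single[OF h u component_carrier[OF x mu]])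
    qed
  qed
  moreover have "adjunct s N \<sigma> R h x \<in> grade RE m" if m: "m \<in> M" and x: "x \<in> grade R m" for m x
  proof -
    have xR: "x \<in> carrier R" using m x by (rule grade_carrier)
    have "adjunct s N \<sigma> R h x m' = \<zero>\<^bsub>E\<^esub>" if m': "m' \<in> M - {m}" for m'
      using component_of_grade[OF x m, of m'] m' xR hc.hom_zero by (simp add: adjunct_at)
    then show ?thesis using closed[OF xR] by (simp add: RE_simps(4))
  qed
  ultimately show ?thesis by (auto simp: graded_maps_def)
qed

lemma family_sum_graded_map_hom:
  assumes g: "g \<in> graded_maps s N \<sigma> R RE"
  shows "abelian_group_hom R E (\<lambda>x. family_sum (g x))"
proof -
  interpret g: abelian_group_hom R RE g
    using graded_mapsD(1)[OF g] md.module_axioms module_RE by (rule linear_maps_group_hom)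
  show ?thesis
    by (rule abelian_group_hom_additiveI[OF md.M.abelian_group_axioms E.M.abelian_group_axioms]) auto
qed

lemma family_sum_graded_map_single:
  assumes g: "g \<in> graded_maps s N \<sigma> R RE" and u: "u \<in> S" and x: "x \<in> carrier R"
  shows "family_sum (g (Poly_Mapping.single u a \<odot>\<^bsub>R\<^esub> x)) = a \<odot>\<^bsub>E\<^esub> family_sum (g x)"
proof -
  note L = linear_mapsD[OF graded_mapsD(1)[OF g]]
  show ?thesis
    unfolding L(4)[OF single_in_cone_algebra[OF u] x] by (rule family_sum_single_smult[OF L(2)[OF x] u])
qed

text \<open>
  The kernel of \<open>x \<mapsto> \<Sum>\<^sub>m g(x)\<^sub>m\<close> is a submodule, and it contains \<open>\<chi>\<^sub>u x - x\<close> because \<open>\<chi>\<^sub>u\<close> does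
  not change the sum of a family.
\<close>

lemma family_sum_graded_map_mR:
  assumes g: "g \<in> graded_maps s N \<sigma> R RE" and x: "x \<in> mR s N \<sigma> R"
  shows "family_sum (g x) = \<zero>\<^bsub>E\<^esub>"
proof -
  note L = linear_mapsD[OF graded_mapsD(1)[OF g]]
  interpret gs: abelian_group_hom R E "\<lambda>x. family_sum (g x)" using g by (rule family_sum_graded_map_hom)
  have "mR s N \<sigma> R \<subseteq> {x \<in> carrier R. family_sum (g x) \<in> {\<zero>\<^bsub>E\<^esub>}}"
  proof (rule mR_subset)
    show "submodule {x \<in> carrier R. family_sum (g x) \<in> {\<zero>\<^bsub>E\<^esub>}} A R"
    proof (rule md.submodule_vimage[OF gs.is_abelian_group_hom])
      show "subgroup {\<zero>\<^bsub>E\<^esub>} (add_monoid E)"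
        using group.triv_subgroup[OF E.M.a_group] by simp
      fix p :: "('v \<Rightarrow> rat) \<Rightarrow>\<^sub>0 'k" and x assume "p \<in> carrier A" "x \<in> carrier R" "family_sum (g x) \<in> {\<zero>\<^bsub>E\<^esub>}"
      then show "family_sum (g (p \<odot>\<^bsub>R\<^esub> x)) \<in> {\<zero>\<^bsub>E\<^esub>}"
        using L(4)[of p x] family_sum_smult_eq_zero[OF L(2)[of x], of p] by simp
    qed
    fix u x assume u: "u \<in> S" and x: "x \<in> carrier R"
    have cx: "chi u \<odot>\<^bsub>R\<^esub> x \<in> carrier R" using single_in_cone_algebra[OF u] x by (rule md.smult_closed)
    have "family_sum (g (chi u \<odot>\<^bsub>R\<^esub> x)) = family_sum (g x)"
      using family_sum_graded_map_single[OF g u x, of 1] gs.hom_closed[OF x] by (simp add: E_smult)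
    then have "family_sum (g (chi u \<odot>\<^bsub>R\<^esub> x \<ominus>\<^bsub>R\<^esub> x)) = \<zero>\<^bsub>E\<^esub>"
      using gs.hom_add[OF cx md.M.a_inv_closed[OF x]] gs.hom_a_inv[OF x] gs.hom_closed[OF x]
      by (simp add: a_minus_def E.M.r_neg)
    then show "chi u \<odot>\<^bsub>R\<^esub> x \<ominus>\<^bsub>R\<^esub> x \<in> {x \<in> carrier R. family_sum (g x) \<in> {\<zero>\<^bsub>E\<^esub>}}"
      using cx x by simp
  qed
  then show ?thesis using x by blast
qed

lemma coadjunct_cls:
  assumes g: "g \<in> graded_maps s N \<sigma> R RE" and x: "x \<in> carrier R"
  shows "coadjunct g (cls x) = family_sum (g x)"
proof -
  interpret gs: abelian_group_hom R E "\<lambda>x. family_sum (g x)" using g by (rule family_sum_graded_map_hom)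
  define y where "y = (SOME y. y \<in> carrier R \<and> cls y = cls x)"
  have "y \<in> carrier R \<and> cls y = cls x" unfolding y_def by (rule someI[of _ x]) (use x in simp)
  then have y: "y \<in> carrier R" and eq: "cls y = cls x" by blast+
  have "family_sum (g (y \<ominus>\<^bsub>R\<^esub> x)) = \<zero>\<^bsub>E\<^esub>"
    using cls_eqD[OF y x eq] by (rule family_sum_graded_map_mR[OF g])
  then have "family_sum (g y) \<ominus>\<^bsub>E\<^esub> family_sum (g x) = \<zero>\<^bsub>E\<^esub>"
    using gs.hom_add[OF y md.M.a_inv_closed[OF x]] gs.hom_a_inv[OF x] by (simp add: a_minus_def)
  then have "family_sum (g y) = family_sum (g x)"
    using E.M.minus_equality[of "family_sum (g y)" "\<ominus>\<^bsub>E\<^esub> family_sum (g x)"]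
      gs.hom_closed[OF x] gs.hom_closed[OF y] by (simp add: a_minus_def)
  then show ?thesis using x by (simp add: coadjunct_def L_space_simps y_def)
qed

text \<open>
  The image of the component of degree \<open>j\<close> is concentrated in degree \<open>j\<close>, so only the component of
  degree \<open>m\<close> contributes to the value at \<open>m\<close>.
\<close>

lemma graded_map_at:
  assumes g: "g \<in> graded_maps s N \<sigma> R RE" and x: "x \<in> carrier R" and m: "m \<in> M"
  shows "g x m = g (component x m) m"
proof -
  interpret g: abelian_group_hom R RE g
    using graded_mapsD(1)[OF g] md.module_axioms module_RE by (rule linear_maps_group_hom)
  have "g x = g (\<Oplus>\<^bsub>R\<^esub>j\<in>support x. component x j)" using component_sum[OF x] by simp
  also have "\<dots> = (\<Oplus>\<^bsub>RE\<^esub>j\<in>support x. g (component x j))"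
    using component_carrier[OF x] by (intro g.hom_finsum) auto
  finally have "g x m = (\<Oplus>\<^bsub>RE\<^esub>j\<in>support x. g (component x j)) m" by simp
  also have "\<dots> = (if m \<in> support x then g (component x m) m else \<zero>\<^bsub>E\<^esub>)"
    using finite_support[OF x] graded_mapsD(2)[OF g] component_grade[OF x] m
    by (intro RE_finsum_grade) auto
  also have "\<dots> = g (component x m) m"
    using m g.hom_zero by (auto simp: RE_simps(1))
  finally show ?thesis .
qed

text \<open>
  A class in level \<open>r\<close> at \<open>\<rho>\<close> has a representative \<open>x\<close> with degrees \<open>m \<rho> \<ge> r\<close>, and then \<open>g(x)\<close> has
  members in such \<open>F\<^sub>m\<close> only, so that their sum has value at least \<open>r\<close> at \<open>\<rho>\<close>.
\<close>

lemma coadjunct_prevalued_maps: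
  assumes g: "g \<in> graded_maps s N \<sigma> R RE"
  shows "coadjunct g \<in> prevalued_maps \<sigma> L_R E"
proof -
  note L = linear_mapsD[OF graded_mapsD(1)[OF g]]
  note at = coadjunct_cls[OF g]
  interpret gs: abelian_group_hom R E "\<lambda>x. family_sum (g x)" using g by (rule family_sum_graded_map_hom)
  have closed: "coadjunct g U \<in> carrier E" if "U \<in> carrier L_R" for U
    using that at gs.hom_closed by (auto simp: L_space_simps)
  have "coadjunct g \<in> linear_maps ground_field L_R E"
  proof (rule linear_mapsI)
    show "coadjunct g \<in> carrier L_R \<rightarrow>\<^sub>E carrier E"
      using closed by (intro PiE_I) (simp_all add: coadjunct_def)
    fix U assume "U \<in> carrier L_R"
    then obtain x where x: "x \<in> carrier R" "U = cls x" by (auto simp: L_space_simps)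
    fix a :: 'k
    have "Poly_Mapping.single 0 a \<odot>\<^bsub>R\<^esub> x \<in> carrier R"
      using single_in_cone_algebra[OF dual_cone_zero] x(1) by (rule md.smult_closed)
    then show "coadjunct g (a \<odot>\<^bsub>L_R\<^esub> U) = a \<odot>\<^bsub>E\<^esub> coadjunct g U"
      using x family_sum_graded_map_single[OF g dual_cone_zero x(1)] by (simp add: L_space_simps at)
    fix U' assume "U' \<in> carrier L_R"
    then obtain y where y: "y \<in> carrier R" "U' = cls y" by (auto simp: L_space_simps)
    show "coadjunct g (U \<oplus>\<^bsub>L_R\<^esub> U') = coadjunct g U \<oplus>\<^bsub>E\<^esub> coadjunct g U'"
      using x y gs.hom_add[OF x(1) y(1)] by (simp add: L_space_simps at)
  qed
  moreover have "val L_R U \<rho> \<le> val E (coadjunct g U) \<rho>" if "U \<in> carrier L_R" and \<rho>: "\<rho> \<in> \<sigma>" for U \<rho>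
  proof -
    have U: "U \<in> carrier (E_space s N \<sigma> R)" using that(1) by (simp add: L_obj_simps)
    interpret g: abelian_group_hom R RE g
      using graded_mapsD(1)[OF g] md.module_axioms module_RE by (rule linear_maps_group_hom)
    have "Fin r \<le> val E (coadjunct g U) \<rho>" if G: "U \<in> G_filtration s N \<sigma> R \<rho> r" for r
    proof -
      obtain x where x: "x \<in> carrier R" "U = cls x" "\<forall>m\<in>support x. r \<le> m \<rho>"
        using G by (auto simp: G_filtration_iff)
      have "r \<le> m \<rho>" if m: "m \<in> M" and ne: "g x m \<noteq> \<zero>\<^bsub>E\<^esub>" for m
      proof -
        have "component x m \<noteq> \<zero>\<^bsub>R\<^esub>" using ne graded_map_at[OF g x(1) m] g.hom_zero m by (auto simp: RE_simps(1))
        then show ?thesis using x(3) m by blast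
      qed
      then show ?thesis
        unfolding x(2) at[OF x(1)] by (intro val_family_sum_ge[OF L(2)[OF x(1)] \<rho>])
    qed
    then show ?thesis
      unfolding L_obj_simps extended_le_iff_Fin[of "cone_val s N \<sigma> R U \<rho>"] Fin_le_cone_val[OF \<rho> U]
      by blast
  qed
  ultimately show ?thesis by (simp add: prevalued_maps_def)
qed

lemma coadjunct_adjunct:
  assumes h: "h \<in> prevalued_maps \<sigma> L_R E"
  shows "coadjunct (adjunct s N \<sigma> R h) = h"
proof (rule ext)
  fix U
  interpret hc: abelian_group_hom R E "\<lambda>x. h (cls x)" using h by (rule prevalued_map_cls_hom)
  show "coadjunct (adjunct s N \<sigma> R h) U = h U"
  proof (cases "U \<in> carrier L_R")
    case True
    then obtain x where x: "x \<in> carrier R" "U = cls x" by (auto simp: L_space_simps)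
    have sub: "{m\<in>M. adjunct s N \<sigma> R h x m \<noteq> \<zero>\<^bsub>E\<^esub>} \<subseteq> support x"
      using x(1) hc.hom_zero by (auto simp: adjunct_at)
    have "coadjunct (adjunct s N \<sigma> R h) U = family_sum (adjunct s N \<sigma> R h x)"
      unfolding x(2) by (rule coadjunct_cls[OF adjunct_graded_maps[OF h] x(1)])
    also have "\<dots> = (\<Oplus>\<^bsub>E\<^esub>m\<in>support x. adjunct s N \<sigma> R h x m)"
      using finite_support[OF x(1)] sub by (intro family_sum_superset adjunct_closed[OF h x(1)]) auto
    also have "\<dots> = (\<Oplus>\<^bsub>E\<^esub>m\<in>support x. h (cls (component x m)))"
      using x(1) component_carrier[OF x(1)] hc.hom_closed
      by (intro E.M.finsum_cong') (auto simp: adjunct_at)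
    also have "\<dots> = h (cls (\<Oplus>\<^bsub>R\<^esub>m\<in>support x. component x m))"
      using component_carrier[OF x(1)] by (intro hc.hom_finsum[symmetric]) auto
    finally show ?thesis using component_sum[OF x(1)] x(2) by simp
  next
    case False
    then show ?thesis
      using linear_mapsD(1)[OF prevalued_mapsD(1)[OF h]] by (auto simp: coadjunct_def PiE_iff extensional_def)
  qed
qed

lemma adjunct_coadjunct:
  assumes g: "g \<in> graded_maps s N \<sigma> R RE"
  shows "adjunct s N \<sigma> R (coadjunct g) = g"
proof (rule ext)
  fix x
  note L = linear_mapsD[OF graded_mapsD(1)[OF g]]
  show "adjunct s N \<sigma> R (coadjunct g) x = g x"
  proof (cases "x \<in> carrier R")
    case x: True
    show ?thesis
    proof (rule RE_eqI[OF adjunct_closed[OF coadjunct_prevalued_maps[OF g] x] L(2)[OF x]])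
      fix m assume m: "m \<in> M"
      have gr: "component x m \<in> grade R m" using x m by (rule component_grade)
      have "adjunct s N \<sigma> R (coadjunct g) x m = family_sum (g (component x m))"
        unfolding adjunct_at[OF x m] by (rule coadjunct_cls[OF g component_carrier[OF x m]])
      also have "\<dots> = g (component x m) m"
        by (rule family_sum_grade[OF graded_mapsD(2)[OF g m gr] m])
      also have "\<dots> = g x m" by (rule graded_map_at[OF g x m, symmetric])
      finally show "adjunct s N \<sigma> R (coadjunct g) x m = g x m" .
    qed
  next
    case False
    then show ?thesis using L(1) by (auto simp: adjunct_def PiE_iff extensional_def)
  qed
qed

theorem bij_betw_adjunct:
  "bij_betw (adjunct s N \<sigma> R) (prevalued_maps \<sigma> L_R E) (graded_maps s N \<sigma> R RE)"
  by (rule bij_betwI[where g = coadjunct])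
     (auto simp: adjunct_graded_maps coadjunct_prevalued_maps coadjunct_adjunct adjunct_coadjunct)

end

text \<open>
  At \<open>x\<close> and degree \<open>m\<close> both sides are \<open>\<beta> (h [\<alpha> x\<^sub>m])\<close>, as \<open>\<alpha>\<close> commutes with components.
\<close>

lemma adjunct_natural:
  assumes "adjunction_pair s N \<sigma> R E" "adjunction_pair s N \<sigma> R' E'"
    and \<alpha>: "\<alpha> \<in> graded_maps s N \<sigma> R' R"
    and h: "h \<in> prevalued_maps \<sigma> (L_obj s N \<sigma> R) E"
  shows "adjunct s N \<sigma> R' (compose (carrier (L_obj s N \<sigma> R')) \<beta>
           (compose (carrier (L_obj s N \<sigma> R')) h (L_map s N \<sigma> R' R \<alpha>))) =
         compose (carrier R') (R_map s N \<sigma> E E' \<beta>) (compose (carrier R') (adjunct s N \<sigma> R h) \<alpha>)"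
    (is "adjunct s N \<sigma> R' ?k = ?r")
proof (rule ext)
  fix x
  interpret P: adjunction_pair s N \<sigma> R E by fact
  interpret P': adjunction_pair s N \<sigma> R' E' by fact
  note gr = P'.graded_cone_module_axioms P.graded_cone_module_axioms
  note L = linear_mapsD[OF graded_mapsD(1)[OF \<alpha>]]
  show "adjunct s N \<sigma> R' ?k x = ?r x"
  proof (cases "x \<in> carrier R'")
    case x: True
    have r: "?r x = (\<lambda>m\<in>P.M. \<beta> (adjunct s N \<sigma> R h (\<alpha> x) m))"
      using x P.adjunct_closed[OF h L(2)[OF x]] by (simp add: compose_def R_map_def R_obj_def)
    have "?k (P'.cls (P'.component x m)) = \<beta> (adjunct s N \<sigma> R h (\<alpha> x) m)" if m: "m \<in> P.M" for m
    proof -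
      have c: "P'.component x m \<in> carrier R'" using x m by (rule P'.component_carrier)
      then have "P'.cls (P'.component x m) \<in> carrier (L_obj s N \<sigma> R')" by (simp add: P'.L_space_simps)
      then have "?k (P'.cls (P'.component x m)) = \<beta> (h (P.cls (\<alpha> (P'.component x m))))"
        by (simp add: compose_def L_map_cls[OF gr \<alpha> c])
      also have "\<dots> = \<beta> (adjunct s N \<sigma> R h (\<alpha> x) m)"
        by (simp only: P.adjunct_at[OF L(2)[OF x] m] graded_maps_component[OF gr \<alpha> x m])
      finally show ?thesis .
    qed
    then show ?thesis unfolding r using x by (simp add: adjunct_def cong: restrict_cong)
  qed (simp add: adjunct_def compose_def)
qed


section \<open>Functoriality and the adjunction theorem\<close>

context toric_cone
begin

lemma graded_cone_moduleI: "is_graded_module s N \<sigma> R \<Longrightarrow> graded_cone_module s N \<sigma> R"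
  by (simp add: graded_cone_module_def graded_cone_module_axioms_def toric_cone_axioms)

lemma prevalued_cone_spaceI: "is_prevalued_space s \<sigma> E \<Longrightarrow> prevalued_cone_space s N \<sigma> E"
  by (simp add: prevalued_cone_space_def prevalued_cone_space_axioms_def toric_cone_axioms)

lemma is_category_Mod_cat: "is_category (Mod_cat s N \<sigma> :: (('k::field, 'v, 'a) cone_module, _) category)"
proof (rule concrete_is_category[where car = carrier])
  fix R :: "('k, 'v, 'a) cone_module" assume "R \<in> Obj (Mod_cat s N \<sigma>)"
  then interpret R: graded_cone_module s N \<sigma> R by (intro graded_cone_moduleI) (simp add: Mod_cat_def)
  show "(\<lambda>x\<in>carrier R. x) \<in> Hom (Mod_cat s N \<sigma>) R R"
    using linear_maps_ident[OF R.md.module_axioms] R.grade_carrier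
    by (auto simp: Mod_cat_def graded_maps_def)
  fix R' R'' :: "('k, 'v, 'a) cone_module" and f g
  assume "f \<in> Hom (Mod_cat s N \<sigma>) R R'" "g \<in> Hom (Mod_cat s N \<sigma>) R' R''"
  then have f: "f \<in> graded_maps s N \<sigma> R R'" and g: "g \<in> graded_maps s N \<sigma> R' R''"
    by (simp_all add: Mod_cat_def)
  have "compose (carrier R) g f \<in> linear_maps A R R''"
    by (rule linear_maps_compose[OF graded_mapsD(1)[OF f] graded_mapsD(1)[OF g] R.md.module_axioms])
  then show "compose (carrier R) g f \<in> Hom (Mod_cat s N \<sigma>) R R''"
    using graded_mapsD(2)[OF f] graded_mapsD(2)[OF g] R.grade_carrier
    by (auto simp: Mod_cat_def graded_maps_def[of _ _ _ R R''] compose_def)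
qed (auto simp: Mod_cat_def dest: linear_mapsD(1)[OF graded_mapsD(1)])

lemma is_category_Vect_cat: "is_category (Vect_cat s \<sigma> :: (('k::field, 'v, 'e) prevalued_space, _) category)"
proof (rule concrete_is_category[where car = carrier])
  fix E :: "('k, 'v, 'e) prevalued_space" assume "E \<in> Obj (Vect_cat s \<sigma>)"
  then interpret E: prevalued_cone_space s N \<sigma> E by (intro prevalued_cone_spaceI) (simp add: Vect_cat_def)
  show "(\<lambda>x\<in>carrier E. x) \<in> Hom (Vect_cat s \<sigma>) E E"
    using linear_maps_ident[OF E.E.module_axioms] by (simp add: Vect_cat_def prevalued_maps_def)
  fix E' E'' :: "('k, 'v, 'e) prevalued_space" and f g
  assume "f \<in> Hom (Vect_cat s \<sigma>) E E'" "g \<in> Hom (Vect_cat s \<sigma>) E' E''"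
  then have f: "f \<in> prevalued_maps \<sigma> E E'" and g: "g \<in> prevalued_maps \<sigma> E' E''"
    by (simp_all add: Vect_cat_def)
  have "compose (carrier E) g f \<in> linear_maps ground_field E E''"
    by (rule linear_maps_compose[OF prevalued_mapsD(1)[OF f] prevalued_mapsD(1)[OF g] E.E.module_axioms])
  moreover have "val E x \<rho> \<le> val E'' (g (f x)) \<rho>" if x: "x \<in> carrier E" and \<rho>: "\<rho> \<in> \<sigma>" for x \<rho>
    using prevalued_mapsD(2)[OF f x \<rho>]
      prevalued_mapsD(2)[OF g linear_mapsD(2)[OF prevalued_mapsD(1)[OF f] x] \<rho>]
    by (rule order_trans)
  ultimately show "compose (carrier E) g f \<in> Hom (Vect_cat s \<sigma>) E E''"
    by (simp add: Vect_cat_def prevalued_maps_def compose_def)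
qed (auto simp: Vect_cat_def dest: linear_mapsD(1)[OF prevalued_mapsD(1)])

lemma is_functor_L:
  "is_functor (Mod_cat s N \<sigma> :: (('k::field, 'v, 'a) cone_module, _) category) (Vect_cat s \<sigma>)
     (L_obj s N \<sigma>) (L_map s N \<sigma>)"
  unfolding is_functor_def
proof (intro conjI ballI is_category_Mod_cat is_category_Vect_cat)
  fix R :: "('k, 'v, 'a) cone_module" assume "R \<in> Obj (Mod_cat s N \<sigma>)"
  then interpret R: graded_cone_module s N \<sigma> R by (intro graded_cone_moduleI) (simp add: Mod_cat_def)
  show "L_obj s N \<sigma> R \<in> Obj (Vect_cat s \<sigma>)"
    using R.is_prevalued_space_L_obj by (simp add: Vect_cat_def)
  have id: "(\<lambda>x\<in>carrier R. x) \<in> graded_maps s N \<sigma> R R"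
    using linear_maps_ident[OF R.md.module_axioms] R.grade_carrier by (auto simp: graded_maps_def)
  have "L_map s N \<sigma> R R (\<lambda>x\<in>carrier R. x) = (\<lambda>U\<in>carrier (L_obj s N \<sigma> R). U)"
  proof (rule ext)
    fix U
    show "L_map s N \<sigma> R R (\<lambda>x\<in>carrier R. x) U = (\<lambda>U\<in>carrier (L_obj s N \<sigma> R). U) U"
    proof (cases "U \<in> carrier (L_obj s N \<sigma> R)")
      case True
      then obtain x where x: "x \<in> carrier R" "U = R.cls x" by (auto simp: R.L_space_simps)
      then show ?thesis
        using True L_map_cls[OF R.graded_cone_module_axioms R.graded_cone_module_axioms id x(1)] by simp
    qed (simp add: L_map_def)
  qed
  then show "L_map s N \<sigma> R R (Ident (Mod_cat s N \<sigma>) R) = Ident (Vect_cat s \<sigma>) (L_obj s N \<sigma> R)"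
    by (simp add: Mod_cat_def Vect_cat_def)
  fix R' :: "('k, 'v, 'a) cone_module" and f
  assume "R' \<in> Obj (Mod_cat s N \<sigma>)" and "f \<in> Hom (Mod_cat s N \<sigma>) R R'"
  then have f: "f \<in> graded_maps s N \<sigma> R R'" and R': "graded_cone_module s N \<sigma> R'"
    by (auto intro: graded_cone_moduleI simp: Mod_cat_def)
  interpret R': graded_cone_module s N \<sigma> R' by (rule R')
  show "L_map s N \<sigma> R R' f \<in> Hom (Vect_cat s \<sigma>) (L_obj s N \<sigma> R) (L_obj s N \<sigma> R')"
    using L_map_prevalued_maps[OF R.graded_cone_module_axioms R' f] by (simp add: Vect_cat_def)
  fix R'' :: "('k, 'v, 'a) cone_module" and g
  assume R'': "R'' \<in> Obj (Mod_cat s N \<sigma>)" and "g \<in> Hom (Mod_cat s N \<sigma>) R' R''"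
  then have g: "g \<in> graded_maps s N \<sigma> R' R''" and R'': "graded_cone_module s N \<sigma> R''"
    by (auto intro: graded_cone_moduleI simp: Mod_cat_def)
  have gf: "compose (carrier R) g f \<in> graded_maps s N \<sigma> R R''"
    using is_category_Mod_cat \<open>R \<in> _\<close> \<open>R' \<in> _\<close> \<open>R'' \<in> _\<close> \<open>f \<in> Hom _ _ _\<close> \<open>g \<in> Hom _ _ _\<close>
    unfolding is_category_def by (auto simp: Mod_cat_def)
  have "L_map s N \<sigma> R R'' (compose (carrier R) g f) =
    compose (carrier (L_obj s N \<sigma> R)) (L_map s N \<sigma> R' R'' g) (L_map s N \<sigma> R R' f)"
  proof (rule ext)
    fix U
    show "L_map s N \<sigma> R R'' (compose (carrier R) g f) U =
      compose (carrier (L_obj s N \<sigma> R)) (L_map s N \<sigma> R' R'' g) (L_map s N \<sigma> R R' f) U"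
    proof (cases "U \<in> carrier (L_obj s N \<sigma> R)")
      case True
      then obtain x where x: "x \<in> carrier R" "U = R.cls x" by (auto simp: R.L_space_simps)
      have fx: "f x \<in> carrier R'" using linear_mapsD(2)[OF graded_mapsD(1)[OF f] x(1)] .
      show ?thesis
        using True x L_map_cls[OF R.graded_cone_module_axioms R'' gf x(1)]
          L_map_cls[OF R.graded_cone_module_axioms R' f x(1)] L_map_cls[OF R' R'' g fx]
        by (simp add: compose_def)
    qed (simp add: L_map_def compose_def)
  qed
  then show "L_map s N \<sigma> R R'' (Comp (Mod_cat s N \<sigma>) R R' R'' g f) =
    Comp (Vect_cat s \<sigma>) (L_obj s N \<sigma> R) (L_obj s N \<sigma> R') (L_obj s N \<sigma> R'')
      (L_map s N \<sigma> R' R'' g) (L_map s N \<sigma> R R' f)"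
    by (simp add: Mod_cat_def Vect_cat_def)
qed

lemma is_functor_R:
  "is_functor (Vect_cat s \<sigma> :: (('k::field, 'v, 'e) prevalued_space, _) category) (Mod_cat s N \<sigma>)
     (R_obj s N \<sigma>) (R_map s N \<sigma>)"
  unfolding is_functor_def
proof (intro conjI ballI is_category_Mod_cat is_category_Vect_cat)
  fix E :: "('k, 'v, 'e) prevalued_space" assume "E \<in> Obj (Vect_cat s \<sigma>)"
  then interpret E: prevalued_cone_space s N \<sigma> E by (intro prevalued_cone_spaceI) (simp add: Vect_cat_def)
  have carrier: "R_carrier s N \<sigma> E = carrier E.RE" by (simp add: R_obj_def)
  show "E.RE \<in> Obj (Mod_cat s N \<sigma>)"
    using E.is_graded_module_RE by (simp add: Mod_cat_def)
  have "R_map s N \<sigma> E E (\<lambda>f\<in>carrier E. f) x = (\<lambda>x\<in>carrier E.RE. x) x" for x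
  proof (cases "x \<in> carrier E.RE")
    case True
    then have "(\<lambda>m\<in>M. (\<lambda>f\<in>carrier E. f) (x m)) = x"
      using E.RE_at[OF True] E.RE_outside[OF True] by (auto simp: fun_eq_iff)
    then show ?thesis using True by (simp add: R_map_def carrier)
  qed (simp add: R_map_def carrier)
  then show "R_map s N \<sigma> E E (Ident (Vect_cat s \<sigma>) E) = Ident (Mod_cat s N \<sigma>) E.RE"
    by (simp add: Mod_cat_def Vect_cat_def fun_eq_iff)
  fix E' :: "('k, 'v, 'e) prevalued_space" and f
  assume "E' \<in> Obj (Vect_cat s \<sigma>)" and "f \<in> Hom (Vect_cat s \<sigma>) E E'"
  then have f: "f \<in> prevalued_maps \<sigma> E E'" and E': "prevalued_cone_space s N \<sigma> E'"
    by (auto intro: prevalued_cone_spaceI simp: Vect_cat_def)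
  have Rf: "R_map s N \<sigma> E E' f \<in> graded_maps s N \<sigma> E.RE (R_obj s N \<sigma> E')"
    by (rule R_map_graded_maps[OF E.prevalued_cone_space_axioms E' f])
  then show "R_map s N \<sigma> E E' f \<in> Hom (Mod_cat s N \<sigma>) E.RE (R_obj s N \<sigma> E')"
    by (simp add: Mod_cat_def)
  fix E'' :: "('k, 'v, 'e) prevalued_space" and g
  have "R_map s N \<sigma> E E'' (compose (carrier E) g f) x =
    compose (carrier E.RE) (R_map s N \<sigma> E' E'' g) (R_map s N \<sigma> E E' f) x" for x
  proof (cases "x \<in> carrier E.RE")
    case True
    have "R_map s N \<sigma> E E' f x \<in> R_carrier s N \<sigma> E'"
      using linear_mapsD(2)[OF graded_mapsD(1)[OF Rf] True] by (simp add: R_obj_def)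
    moreover have "R_map s N \<sigma> E E' f x = (\<lambda>m\<in>M. f (x m))" using True by (simp add: R_map_def carrier)
    ultimately show ?thesis
      using True E.RE_at[OF True] by (simp add: R_map_def carrier compose_def cong: restrict_cong)
  qed (simp add: R_map_def carrier compose_def)
  then show "R_map s N \<sigma> E E'' (Comp (Vect_cat s \<sigma>) E E' E'' g f) =
    Comp (Mod_cat s N \<sigma>) E.RE (R_obj s N \<sigma> E') (R_obj s N \<sigma> E'') (R_map s N \<sigma> E' E'' g) (R_map s N \<sigma> E E' f)"
    by (simp add: Mod_cat_def Vect_cat_def fun_eq_iff)
qed

end

theorem theorem3p13:
  fixes s :: "rat \<Rightarrow> 'v \<Rightarrow> 'v::ab_group_add"
    and N \<sigma> :: "'v set"
  assumes "is_lattice s N"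
    and "rational_polyhedral_cone s N \<sigma>"
    and "strongly_convex \<sigma>"
  shows "is_functor
           (Mod_cat s N \<sigma> :: (('k::alg_closed_field, 'v, 'a) cone_module, 'a \<Rightarrow> 'a) category)
           (Vect_cat s \<sigma>)
           (L_obj s N \<sigma>) (L_map s N \<sigma>) \<and>
         is_functor
           (Vect_cat s \<sigma> :: (('k, 'v, 'e) prevalued_space, 'e \<Rightarrow> 'e) category)
           (Mod_cat s N \<sigma>)
           (R_obj s N \<sigma>) (R_map s N \<sigma>) \<and>
         (\<exists>\<Phi> :: ('k, 'v, 'a) cone_module \<Rightarrow> ('k, 'v, 'e) prevalued_space \<Rightarrow>
               ('a set \<Rightarrow> 'e) \<Rightarrow> ('a \<Rightarrow> (('v \<Rightarrow> rat) \<Rightarrow> 'e)).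
           (\<forall>R\<in>Obj (Mod_cat s N \<sigma>). \<forall>E\<in>Obj (Vect_cat s \<sigma>).
              bij_betw (\<Phi> R E)
                (prevalued_maps \<sigma> (L_obj s N \<sigma> R) E)
                (graded_maps s N \<sigma> R (R_obj s N \<sigma> E))) \<and>
           (\<forall>R\<in>Obj (Mod_cat s N \<sigma>). \<forall>R'\<in>Obj (Mod_cat s N \<sigma>).
            \<forall>E\<in>Obj (Vect_cat s \<sigma>). \<forall>E'\<in>Obj (Vect_cat s \<sigma>).
            \<forall>\<alpha>\<in>Hom (Mod_cat s N \<sigma>) R' R. \<forall>\<beta>\<in>Hom (Vect_cat s \<sigma>) E E'.
            \<forall>h\<in>prevalued_maps \<sigma> (L_obj s N \<sigma> R) E.
              \<Phi> R' E' (compose (carrier (L_obj s N \<sigma> R')) \<beta>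
                         (compose (carrier (L_obj s N \<sigma> R')) h (L_map s N \<sigma> R' R \<alpha>))) =
              compose (carrier R') (R_map s N \<sigma> E E' \<beta>)
                (compose (carrier R') (\<Phi> R E h) \<alpha>)))"
proof -
  interpret toric_cone s N \<sigma> using assms(1,2) by (rule toric_cone.intro)
  have pair: "adjunction_pair s N \<sigma> R E"
    if "R \<in> Obj (Mod_cat s N \<sigma>)" "E \<in> Obj (Vect_cat s \<sigma>)"
    for R :: "('k, 'v, 'a) cone_module" and E :: "('k, 'v, 'e) prevalued_space"
    using that by (intro adjunction_pair.intro graded_cone_moduleI prevalued_cone_spaceI)
      (simp_all add: Mod_cat_def Vect_cat_def)
  show ?thesis
  proof (intro conjI is_functor_L is_functor_R exI[of _ "\<lambda>R E. adjunct s N \<sigma> R"] ballI)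
    fix R :: "('k, 'v, 'a) cone_module" and E :: "('k, 'v, 'e) prevalued_space"
    assume "R \<in> Obj (Mod_cat s N \<sigma>)" "E \<in> Obj (Vect_cat s \<sigma>)"
    then show "bij_betw (adjunct s N \<sigma> R) (prevalued_maps \<sigma> (L_obj s N \<sigma> R) E)
        (graded_maps s N \<sigma> R (R_obj s N \<sigma> E))"
      by (rule adjunction_pair.bij_betw_adjunct[OF pair])
  next
    fix R R' :: "('k, 'v, 'a) cone_module" and E E' :: "('k, 'v, 'e) prevalued_space" and \<alpha> \<beta> h
    assume "R \<in> Obj (Mod_cat s N \<sigma>)" "R' \<in> Obj (Mod_cat s N \<sigma>)"
      "E \<in> Obj (Vect_cat s \<sigma>)" "E' \<in> Obj (Vect_cat s \<sigma>)"
      "\<alpha> \<in> Hom (Mod_cat s N \<sigma>) R' R" "h \<in> prevalued_maps \<sigma> (L_obj s N \<sigma> R) E"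
    then show "adjunct s N \<sigma> R' (compose (carrier (L_obj s N \<sigma> R')) \<beta>
          (compose (carrier (L_obj s N \<sigma> R')) h (L_map s N \<sigma> R' R \<alpha>))) =
        compose (carrier R') (R_map s N \<sigma> E E' \<beta>) (compose (carrier R') (adjunct s N \<sigma> R h) \<alpha>)"
      by (intro adjunct_natural pair) (simp_all add: Mod_cat_def)
  qed
qed

end
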